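(* Let $K$ be a field of characteristic $\ne2$ and let $N$ be an indecomposable power-associative nil evolution $K$-algebra of dimension $\le 6$ which is not associative and satisfies $\dim(\mathrm{ann}(N))=1$, written in a natural basis $\{e_i\}$ in one of the ten normal forms listed in the context. For a derivation $d$ of $N$ write $d(e_i)=\sum_jd_{ji}e_j$; $d$ is determined by the free parameters listed in the context. Let $d,d'\in\mathfrak{D}(N)$. Then $[d,d']$ is the derivation whose parameters are the following, and the derived algebra $\mathfrak{D}(N)'$ is, as a vector space, as indicated: (1) $N_{4,6}$: $[d,d']_{11}=[d,d']_{22}=0$, $[d,d']_{41}=(d_{11}'d_{41}-d_{11}d_{41}')+2(d_{41}'d_{22}-d_{41}d_{22}')$, $[d,d']_{42}=2(d_{42}'d_{11}-d_{42}d_{11}')$; $\mathfrak{D}(N)'\simeq K^2$. (2) $N_{5,10}(\alpha)$: $[d,d']_{11}=[d,d']_{22}=0$, $[d,d']_{51}=(d_{11}'d_{51}-d_{11}d_{51}')+2(d_{51}'d_{22}-d_{51}d_{22}')$, $[d,d']_{42}=(d_{22}'d_{42}-d_{22}d_{42}')+2(d_{42}'d_{11}-d_{42}d_{11}')$, $[d,d']_{52}=(d_{42}'d_{54}-d_{42}d_{54}')+2(d_{52}'d_{11}-d_{52}d_{11}')$, $[d,d']_{54}=d_{54}'d_{22}-d_{54}d_{22}'$; $\mathfrak{D}(N)'\simeq K\times K^3$. (3) $N_{5,11}(\alpha)$: $[d,d']_{11}=[d,d']_{41}=[d,d']_{22}=0$, $[d,d']_{51}=(d_{11}'d_{51}-d_{11}d_{51}')+(d_{41}'d_{54}-d_{41}d_{54}')+2(d_{51}'d_{22}-d_{51}d_{22}')$,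 $[d,d']_{52}=2(d_{52}'d_{11}-d_{52}d_{11}')$, $[d,d']_{54}=-\alpha(d_{41}'d_{51}-d_{41}d_{51}')+(d_{11}'d_{54}-d_{11}d_{54}')+2(d_{54}'d_{22}-d_{54}d_{22}')$; $\mathfrak{D}(N)'\simeq K^3$. (4) $N_{5,12}(\alpha,\beta)$: $[d,d']_{11}=0$, $[d,d']_{51}=d_{51}'d_{11}-d_{51}d_{11}'$, $[d,d']_{52}=2(d_{52}'d_{11}-d_{52}d_{11}')$, $[d,d']_{54}=d_{54}'d_{11}-d_{54}d_{11}'$; $\mathfrak{D}(N)'\simeq K^3$. (5) $N_{6,19}(\alpha,\beta)$: $[d,d']_{11}=[d,d']_{22}=[d,d']_{54}=0$, $[d,d']_{61}=(d_{11}'d_{61}-d_{11}d_{61}')+2(d_{61}'d_{22}-d_{61}d_{22}')$, $[d,d']_{42}=(d_{22}'d_{42}-d_{22}d_{42}')+2(d_{11}d_{42}'-d_{11}'d_{42})-\alpha^{-1}\beta(d_{52}'d_{54}-d_{52}d_{54}')$, $[d,d']_{52}=(d_{42}'d_{54}-d_{42}d_{54}')+(d_{22}'d_{52}-d_{22}d_{52}')+2(d_{11}d_{52}'-d_{11}'d_{52})$, $[d,d']_{62}=(d_{42}'d_{64}-d_{42}d_{64}')+(d_{52}'d_{65}-d_{52}d_{65}')+2(d_{62}'d_{11}-d_{62}d_{11}')$, $[d,d']_{64}=(d_{64}'d_{22}-d_{64}d_{22}')+(d_{54}'d_{65}-d_{54}d_{65}')$, $[d,d']_{65}=-\alpha^{-1}\beta(d_{54}'d_{64}-d_{54}d_{64}')+(d_{65}'d_{22}-d_{65}d_{22}')$;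 $\mathfrak{D}(N)'\simeq K^2\times K^4$. (6) $N_{6,20}(\alpha,\beta)$: $[d,d']_{11}=[d,d']_{41}=[d,d']_{22}=0$, $[d,d']_{61}=(d_{11}'d_{61}-d_{11}d_{61}')+(d_{41}'d_{64}-d_{41}d_{64}')+2(d_{61}'d_{22}-d_{61}d_{22}')$, $[d,d']_{52}=(d_{22}'d_{52}-d_{22}d_{52}')+2(d_{11}d_{52}'-d_{11}'d_{52})$, $[d,d']_{62}=(d_{52}'d_{65}-d_{52}d_{65}')+2(d_{11}d_{62}'-d_{11}'d_{62})$, $[d,d']_{64}=-\alpha(d_{41}'d_{61}-d_{41}d_{61}')+(d_{11}'d_{64}-d_{11}d_{64}')+2(d_{64}'d_{22}-d_{64}d_{22}')$, $[d,d']_{65}=d_{65}'d_{22}-d_{65}d_{22}'$; $\mathfrak{D}(N)'\simeq K\times K^4$. (7) $N_{6,21}(\alpha,\beta,\gamma)$: $[d,d']_{11}=0$, $[d,d']_{61}=d_{61}'d_{11}-d_{61}d_{11}'$, $[d,d']_{52}=d_{52}'d_{11}-d_{52}d_{11}'$, $[d,d']_{62}=(d_{52}'d_{65}-d_{52}d_{65}')+2(d_{62}'d_{11}-d_{62}d_{11}')$, $[d,d']_{64}=d_{64}'d_{11}-d_{64}d_{11}'$, $[d,d']_{65}=d_{65}'d_{11}-d_{65}d_{11}'$; $\mathfrak{D}(N)'\simeq K\times K^4$. (8) $N_{6,22}(\alpha,\beta)$: $[d,d']_{11}=[d,d']_{22}=0$, $[d,d']_{41}=\alpha^{-1}\beta(d_{51}d_{54}'-d_{51}'d_{54})$,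 $[d,d']_{51}=d_{41}'d_{54}-d_{41}d_{54}'$, $[d,d']_{61}=(d_{11}'d_{61}-d_{11}d_{61}')+(d_{41}'d_{64}-d_{41}d_{64}')+(d_{51}'d_{65}-d_{51}d_{65}')+2(d_{61}'d_{22}-d_{61}d_{22}')$, $[d,d']_{62}=2(d_{11}d_{62}'-d_{11}'d_{62})$, $[d,d']_{54}=\alpha(d_{41}d_{51}'-d_{41}'d_{51})$, $[d,d']_{64}=(d_{64}'d_{11}-d_{64}d_{11}')+(d_{54}'d_{65}-d_{54}d_{65}')+\alpha(d_{41}d_{61}'-d_{41}'d_{61})$, $[d,d']_{65}=-\beta(d_{51}'d_{61}-d_{51}d_{61}')-\alpha^{-1}\beta(d_{54}'d_{64}-d_{54}d_{64}')+(d_{11}'d_{65}-d_{11}d_{65}')+2(d_{65}'d_{22}-d_{65}d_{22}')$; $\mathfrak{D}(N)'\simeq K^3\times K^4$. (9) $N_{6,23}(\alpha,\beta,\gamma,\delta)$: $[d,d']_{11}=0$, $[d,d']_{61}=d_{61}'d_{11}-d_{11}'d_{61}$, $[d,d']_{62}=2(d_{62}'d_{11}-d_{62}d_{11}')$, $[d,d']_{64}=d_{64}'d_{11}-d_{64}d_{11}'$, $[d,d']_{65}=d_{65}'d_{11}-d_{65}d_{11}'$; $\mathfrak{D}(N)'\simeq K^4$. (10) $N_{6,24}(\alpha,\beta,\gamma)$: $[d,d']_{11}=[d,d']_{51}=0$, $[d,d']_{61}=(d_{61}'d_{11}-d_{61}d_{11}')+(d_{51}'d_{65}-d_{51}d_{65}')$,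 $[d,d']_{62}=2(d_{62}'d_{11}-d_{62}d_{11}')$, $[d,d']_{64}=d_{64}'d_{11}-d_{64}d_{11}'$, $[d,d']_{65}=\gamma(d_{51}d_{61}'-d_{51}'d_{61})+(d_{65}'d_{11}-d_{65}d_{11}')$; $\mathfrak{D}(N)'\simeq K^4$.
   Context: An evolution $K$-algebra is a finite-dimensional commutative (not necessarily associative) $K$-algebra with a basis $\{e_1,\dots,e_n\}$ (a natural basis) such that $e_ie_j=0$ for $i\neq j$. It is power-associative if every subalgebra generated by one element is associative; nil if for every $a$ some power $a^m$ is $0$; indecomposable if it is not a direct sum of two nonzero ideals; $\mathrm{ann}(N)=\{x\in N:xN=0\}$. $\mathfrak{D}(N)$ is the Lie algebra of derivations (linear $d:N\to N$ with $d(uv)=ud(v)+d(u)v$) with $[d,d']=d\circ d'-d'\circ d$; $\mathfrak{D}(N)'=[\mathfrak{D}(N),\mathfrak{D}(N)]$. Known classification (from earlier work, to be taken as given): every non-associative indecomposable power-associative nil evolution algebra of dimension $n\le6$ with one-dimensional annihilator is isomorphic to one of the following. In all of them $e_ie_j=0$ for $i\ne j$, $e_1^2=e_2+e_3$, $e_2^2=e_n$, $e_3^2=-e_n$, $e_n^2=0$, where $n=\dim N$; the remaining squares, and the general form of a derivation (all displayed $d_{ji}\in K$ arbitrary), are: - $N_{4,6}$ ($n=4$): no further squares. $d(e_1)=d_{11}e_1+d_{41}e_4$, $d(e_2)=d_{22}e_2+(2d_{11}-d_{22})e_3+d_{42}e_4$, $d(e_3)=(2d_{11}-d_{22})e_2+d_{22}e_3-d_{42}e_4$,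 $d(e_4)=2d_{22}e_4$. - $N_{5,10}(\alpha)$ ($n=5$): $e_4^2=\alpha e_5$, $\alpha\in K^*$. $d(e_1)=d_{11}e_1+d_{51}e_5$, $d(e_2)=d_{22}e_2+(2d_{11}-d_{22})e_3+d_{42}e_4+d_{52}e_5$, $d(e_3)=(2d_{11}-d_{22})e_2+d_{22}e_3-d_{42}e_4-d_{52}e_5$, $d(e_4)=-\alpha d_{42}(e_2+e_3)+d_{22}e_4+d_{54}e_5$, $d(e_5)=2d_{22}e_5$. - $N_{5,11}(\alpha)$ ($n=5$): $e_4^2=\alpha(e_2+e_3)$, $\alpha\in K^*$. $d(e_1)=d_{11}e_1+d_{41}e_4+d_{51}e_5$, $d(e_2)=d_{22}e_2+(2d_{11}-d_{22})e_3+d_{52}e_5$, $d(e_3)=(2d_{11}-d_{22})e_2+d_{22}e_3-d_{52}e_5$, $d(e_4)=-\alpha d_{41}e_1+d_{11}e_4+d_{54}e_5$, $d(e_5)=2d_{22}e_5$. - $N_{5,12}(\alpha,\beta)$ ($n=5$): $e_4^2=\alpha(e_2+e_3)+\beta e_5$, $\alpha,\beta\in K^*$. $d(e_1)=d_{11}e_1+d_{51}e_5$, $d(e_2)=d_{11}(e_2+e_3)+d_{52}e_5$, $d(e_3)=d_{11}(e_2+e_3)-d_{52}e_5$, $d(e_4)=d_{11}e_4+d_{54}e_5$, $d(e_5)=2d_{11}e_5$. - $N_{6,19}(\alpha,\beta)$ ($n=6$, as in all the following): $e_4^2=\alpha e_6$, $e_5^2=\beta e_6$, $\alpha,\beta\in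 K^*$. $d(e_1)=d_{11}e_1+d_{61}e_6$, $d(e_2)=d_{22}e_2+(2d_{11}-d_{22})e_3+d_{42}e_4+d_{52}e_5+d_{62}e_6$, $d(e_3)=(2d_{11}-d_{22})e_2+d_{22}e_3-d_{42}e_4-d_{52}e_5-d_{62}e_6$, $d(e_4)=-\alpha d_{42}(e_2+e_3)+d_{22}e_4+d_{54}e_5+d_{64}e_6$, $d(e_5)=-\beta d_{52}(e_2+e_3)-\alpha^{-1}\beta d_{54}e_4+d_{22}e_5+d_{65}e_6$, $d(e_6)=2d_{22}e_6$. - $N_{6,20}(\alpha,\beta)$: $e_4^2=\alpha(e_2+e_3)$, $e_5^2=\beta e_6$, $\alpha,\beta\in K^*$. $d(e_1)=d_{11}e_1+d_{41}e_4+d_{61}e_6$, $d(e_2)=d_{22}e_2+(2d_{11}-d_{22})e_3+d_{52}e_5+d_{62}e_6$, $d(e_3)=(2d_{11}-d_{22})e_2+d_{22}e_3-d_{52}e_5-d_{62}e_6$, $d(e_4)=-\alpha d_{41}e_1+d_{11}e_4+d_{64}e_6$, $d(e_5)=-\beta d_{52}(e_2+e_3)+d_{22}e_5+d_{65}e_6$, $d(e_6)=2d_{22}e_6$. - $N_{6,21}(\alpha,\beta,\gamma)$: $e_4^2=\alpha(e_2+e_3)+\beta e_6$, $e_5^2=\gamma e_6$, $\alpha,\beta,\gamma\in K^*$. $d(e_1)=d_{11}e_1+d_{61}e_6$, $d(e_2)=d_{11}(e_2+e_3)+d_{52}e_5+d_{62}e_6$, $d(e_3)=d_{11}(e_2+e_3)-d_{52}e_5-d_{62}e_6$,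 $d(e_4)=d_{11}e_4+d_{64}e_6$, $d(e_5)=-\gamma d_{52}(e_2+e_3)+d_{11}e_5+d_{65}e_6$, $d(e_6)=2d_{11}e_6$. - $N_{6,22}(\alpha,\beta)$: $e_4^2=\alpha(e_2+e_3)$, $e_5^2=\beta(e_2+e_3)$, $\alpha,\beta\in K^*$. $d(e_1)=d_{11}e_1+d_{41}e_4+d_{51}e_5+d_{61}e_6$, $d(e_2)=d_{22}e_2+(2d_{11}-d_{22})e_3+d_{62}e_6$, $d(e_3)=(2d_{11}-d_{22})e_2+d_{22}e_3-d_{62}e_6$, $d(e_4)=-\alpha d_{41}e_1+d_{11}e_4+d_{54}e_5+d_{64}e_6$, $d(e_5)=-\beta d_{51}e_1-\alpha^{-1}\beta d_{54}e_4+d_{11}e_5+d_{65}e_6$, $d(e_6)=2d_{22}e_6$. - $N_{6,23}(\alpha,\beta,\gamma,\delta)$: $e_4^2=\alpha(e_2+e_3)+\beta e_6$, $e_5^2=\gamma(e_2+e_3)+\delta e_6$, with $\alpha\delta-\beta\gamma\ne0$, $\alpha\gamma\neq0$, $\beta\delta\ne0$. $d(e_1)=d_{11}e_1+d_{61}e_6$, $d(e_2)=d_{11}(e_2+e_3)+d_{62}e_6$, $d(e_3)=d_{11}(e_2+e_3)-d_{62}e_6$, $d(e_4)=d_{11}e_4+d_{64}e_6$, $d(e_5)=d_{11}e_5+d_{65}e_6$, $d(e_6)=2d_{11}e_6$. - $N_{6,24}(\alpha,\beta,\gamma)$: $e_4^2=\alpha(e_2+e_3)+\beta e_6$, $e_5^2=\gamma(e_2+e_3)$,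 with $\alpha\beta\gamma\neq0$. $d(e_1)=d_{11}e_1+d_{51}e_5+d_{61}e_6$, $d(e_2)=d_{11}(e_2+e_3)+d_{62}e_6$, $d(e_3)=d_{11}(e_2+e_3)-d_{62}e_6$, $d(e_4)=d_{11}e_4+d_{64}e_6$, $d(e_5)=-\gamma d_{51}e_1+d_{11}e_5+d_{65}e_6$, $d(e_6)=2d_{11}e_6$.
   Formalization: In item (8), N_{6,22}, the false printed term (d_{64}'d_{11}-d_{64}d_{11}') of [d,d']_{64} is replaced by (d_{11}'d_{64}-d_{11}d_{64}')+2(d_{64}'d_{22}-d_{64}d_{22}'); the printed one fails for d_{22}=d_{64}'=1 with all other parameters 0. *)

theory Defs
  imports "HOL-Analysis.Analysis" "HOL-Library.Function_Algebras"
begin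

text \<open>
  An algebra over the field \<open>'k\<close> is carried by the whole type \<open>'v\<close>, with a scalar multiplication
  (written \<open>*\<^sub>K\<close>) and a product (written \<open>\<cdot>\<close>). Finite dimensionality is part of
  \<open>evolution_algebra\<close>, which asks for a finite natural basis.
\<close>

locale comm_algebra = vector_space scale
  for scale :: "'k::field \<Rightarrow> 'v::ab_group_add \<Rightarrow> 'v" (infixr "*\<^sub>K" 75) +
  fixes mult :: "'v \<Rightarrow> 'v \<Rightarrow> 'v" (infixl "\<cdot>" 70)
  assumes mult_commute: "x \<cdot> y = y \<cdot> x"
    and mult_add_left: "(x + y) \<cdot> z = x \<cdot> z + y \<cdot> z"
    and mult_scale_left: "(a *\<^sub>K x) \<cdot> y = a *\<^sub>K (x \<cdot> y)"

context
  fixes scale :: "'k::field \<Rightarrow> 'v::ab_group_add \<Rightarrow> 'v" (infixr "*\<^sub>K" 75)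
    and mult :: "'v \<Rightarrow> 'v \<Rightarrow> 'v" (infixl "\<cdot>" 70)
begin

text \<open>Only the values \<open>e 1, \<dots>, e n\<close> of a family \<open>e\<close> matter.\<close>

definition natural_basis :: "nat \<Rightarrow> (nat \<Rightarrow> 'v) \<Rightarrow> bool" where
  "natural_basis n e \<longleftrightarrow>
     inj_on e {1..n} \<and> \<not> module.dependent scale (e ` {1..n}) \<and>
     module.span scale (e ` {1..n}) = UNIV \<and>
     (\<forall>i\<in>{1..n}. \<forall>j\<in>{1..n}. i \<noteq> j \<longrightarrow> e i \<cdot> e j = 0)"

definition evolution_algebra :: bool where
  "evolution_algebra \<longleftrightarrow> comm_algebra scale mult \<and> (\<exists>n e. natural_basis n e)"

definition associative_on :: "'v set \<Rightarrow> bool" where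
  "associative_on S \<longleftrightarrow> (\<forall>x\<in>S. \<forall>y\<in>S. \<forall>z\<in>S. (x \<cdot> y) \<cdot> z = x \<cdot> (y \<cdot> z))"

definition subalgebra :: "'v set \<Rightarrow> bool" where
  "subalgebra S \<longleftrightarrow> module.subspace scale S \<and> (\<forall>x\<in>S. \<forall>y\<in>S. x \<cdot> y \<in> S)"

definition generated_subalgebra :: "'v \<Rightarrow> 'v set" where
  "generated_subalgebra a = \<Inter> {S. subalgebra S \<and> a \<in> S}"

definition power_associative :: bool where
  "power_associative \<longleftrightarrow> (\<forall>a. associative_on (generated_subalgebra a))"

text \<open>\<open>principal_power a m\<close> is the principal power \<open>a\<^sup>m\<^sup>+\<^sup>1 = (\<dots>((a \<cdot> a) \<cdot> a)\<dots>) \<cdot> a\<close>.\<close>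

definition principal_power :: "'v \<Rightarrow> nat \<Rightarrow> 'v" where
  "principal_power a m = ((\<lambda>x. x \<cdot> a) ^^ m) a"

definition nil_algebra :: bool where
  "nil_algebra \<longleftrightarrow> (\<forall>a. \<exists>m. principal_power a m = 0)"

definition algebra_ideal :: "'v set \<Rightarrow> bool" where
  "algebra_ideal I \<longleftrightarrow> module.subspace scale I \<and> (\<forall>x\<in>I. \<forall>y. x \<cdot> y \<in> I \<and> y \<cdot> x \<in> I)"

definition indecomposable :: bool where
  "indecomposable \<longleftrightarrow>
     \<not> (\<exists>I J. algebra_ideal I \<and> algebra_ideal J \<and> I \<noteq> {0} \<and> J \<noteq> {0} \<and>
            I \<inter> J = {0} \<and> (\<forall>z. \<exists>x\<in>I. \<exists>y\<in>J. z = x + y))"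

definition annihilator :: "'v set" where
  "annihilator = {x. \<forall>y. x \<cdot> y = 0}"

definition derivations :: "('v \<Rightarrow> 'v) set" where
  "derivations = {f. Vector_Spaces.linear scale scale f \<and>
                     (\<forall>u v. f (u \<cdot> v) = u \<cdot> f v + f u \<cdot> v)}"

definition fun_scale :: "'k \<Rightarrow> ('v \<Rightarrow> 'v) \<Rightarrow> 'v \<Rightarrow> 'v" where
  "fun_scale a f = (\<lambda>x. a *\<^sub>K f x)"

definition bracket :: "('v \<Rightarrow> 'v) \<Rightarrow> ('v \<Rightarrow> 'v) \<Rightarrow> 'v \<Rightarrow> 'v" where
  "bracket f g = (\<lambda>x. f (g x) - g (f x))"

definition derived_algebra :: "('v \<Rightarrow> 'v) set" where
  "derived_algebra = module.span fun_scale {bracket f g |f g. f \<in> derivations \<and> g \<in> derivations}"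

text \<open>The subspace \<open>derived_algebra\<close> is linearly isomorphic to the space \<open>'w\<close> with scalar
  multiplication \<open>t\<close>; the isomorphism is given as an embedding of \<open>'w\<close> with the right image.\<close>

definition derived_algebra_iso :: "('k \<Rightarrow> 'w::ab_group_add \<Rightarrow> 'w) \<Rightarrow> bool" where
  "derived_algebra_iso t \<longleftrightarrow>
     (\<exists>\<phi>. Vector_Spaces.linear t fun_scale \<phi> \<and> inj \<phi> \<and> range \<phi> = derived_algebra)"

text \<open>\<open>matrix_entries n e f d\<close>: the matrix \<open>d\<close> of \<open>f\<close> has the coordinates of \<open>f (e i)\<close> in its
  column \<open>i\<close>; \<open>d j i\<close> is row \<open>j\<close>, column \<open>i\<close>.\<close>

definition matrix_entries :: "nat \<Rightarrow> (nat \<Rightarrow> 'v) \<Rightarrow> ('v \<Rightarrow> 'v) \<Rightarrow> (nat \<Rightarrow> nat \<Rightarrow> 'k) \<Rightarrow> bool" where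
  "matrix_entries n e f d \<longleftrightarrow> (\<forall>i\<in>{1..n}. f (e i) = (\<Sum>j=1..n. d j i *\<^sub>K e j))"

text \<open>The normal forms \<open>N_n_k\<close>, each followed by the general form \<open>D_n_k\<close> of a linear map in
  terms of its free matrix entries.\<close>

definition normal_base :: "nat \<Rightarrow> (nat \<Rightarrow> 'v) \<Rightarrow> bool" where
  "normal_base n e \<longleftrightarrow> natural_basis n e \<and>
     e 1 \<cdot> e 1 = e 2 + e 3 \<and> e 2 \<cdot> e 2 = e n \<and> e 3 \<cdot> e 3 = - e n \<and> e n \<cdot> e n = 0"

definition N_4_6 :: "nat \<Rightarrow> (nat \<Rightarrow> 'v) \<Rightarrow> bool" where
  "N_4_6 n e \<longleftrightarrow> n = 4 \<and> normal_base n e"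

definition D_4_6 :: "(nat \<Rightarrow> 'v) \<Rightarrow> (nat \<Rightarrow> nat \<Rightarrow> 'k) \<Rightarrow> ('v \<Rightarrow> 'v) \<Rightarrow> bool" where
  "D_4_6 e d f \<longleftrightarrow>
     f (e 1) = d 1 1 *\<^sub>K e 1 + d 4 1 *\<^sub>K e 4 \<and>
     f (e 2) = d 2 2 *\<^sub>K e 2 + (2 * d 1 1 - d 2 2) *\<^sub>K e 3 + d 4 2 *\<^sub>K e 4 \<and>
     f (e 3) = (2 * d 1 1 - d 2 2) *\<^sub>K e 2 + d 2 2 *\<^sub>K e 3 - d 4 2 *\<^sub>K e 4 \<and>
     f (e 4) = (2 * d 2 2) *\<^sub>K e 4"

definition N_5_10 :: "nat \<Rightarrow> (nat \<Rightarrow> 'v) \<Rightarrow> 'k \<Rightarrow> bool" where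
  "N_5_10 n e \<alpha> \<longleftrightarrow> n = 5 \<and> normal_base n e \<and>
     e 4 \<cdot> e 4 = \<alpha> *\<^sub>K e 5 \<and>
     \<alpha> \<noteq> 0"

definition D_5_10 :: "(nat \<Rightarrow> 'v) \<Rightarrow> 'k \<Rightarrow> (nat \<Rightarrow> nat \<Rightarrow> 'k) \<Rightarrow> ('v \<Rightarrow> 'v) \<Rightarrow> bool" where
  "D_5_10 e \<alpha> d f \<longleftrightarrow>
     f (e 1) = d 1 1 *\<^sub>K e 1 + d 5 1 *\<^sub>K e 5 \<and>
     f (e 2) = d 2 2 *\<^sub>K e 2 + (2 * d 1 1 - d 2 2) *\<^sub>K e 3 + d 4 2 *\<^sub>K e 4 + d 5 2 *\<^sub>K e 5 \<and>
     f (e 3) = (2 * d 1 1 - d 2 2) *\<^sub>K e 2 + d 2 2 *\<^sub>K e 3 - d 4 2 *\<^sub>K e 4 - d 5 2 *\<^sub>K e 5 \<and>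
     f (e 4) = - (\<alpha> * d 4 2) *\<^sub>K (e 2 + e 3) + d 2 2 *\<^sub>K e 4 + d 5 4 *\<^sub>K e 5 \<and>
     f (e 5) = (2 * d 2 2) *\<^sub>K e 5"

definition N_5_11 :: "nat \<Rightarrow> (nat \<Rightarrow> 'v) \<Rightarrow> 'k \<Rightarrow> bool" where
  "N_5_11 n e \<alpha> \<longleftrightarrow> n = 5 \<and> normal_base n e \<and>
     e 4 \<cdot> e 4 = \<alpha> *\<^sub>K (e 2 + e 3) \<and>
     \<alpha> \<noteq> 0"

definition D_5_11 :: "(nat \<Rightarrow> 'v) \<Rightarrow> 'k \<Rightarrow> (nat \<Rightarrow> nat \<Rightarrow> 'k) \<Rightarrow> ('v \<Rightarrow> 'v) \<Rightarrow> bool" where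
  "D_5_11 e \<alpha> d f \<longleftrightarrow>
     f (e 1) = d 1 1 *\<^sub>K e 1 + d 4 1 *\<^sub>K e 4 + d 5 1 *\<^sub>K e 5 \<and>
     f (e 2) = d 2 2 *\<^sub>K e 2 + (2 * d 1 1 - d 2 2) *\<^sub>K e 3 + d 5 2 *\<^sub>K e 5 \<and>
     f (e 3) = (2 * d 1 1 - d 2 2) *\<^sub>K e 2 + d 2 2 *\<^sub>K e 3 - d 5 2 *\<^sub>K e 5 \<and>
     f (e 4) = - (\<alpha> * d 4 1) *\<^sub>K e 1 + d 1 1 *\<^sub>K e 4 + d 5 4 *\<^sub>K e 5 \<and>
     f (e 5) = (2 * d 2 2) *\<^sub>K e 5"

definition N_5_12 :: "nat \<Rightarrow> (nat \<Rightarrow> 'v) \<Rightarrow> 'k \<Rightarrow> 'k \<Rightarrow> bool" where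
  "N_5_12 n e \<alpha> \<beta> \<longleftrightarrow> n = 5 \<and> normal_base n e \<and>
     e 4 \<cdot> e 4 = \<alpha> *\<^sub>K (e 2 + e 3) + \<beta> *\<^sub>K e 5 \<and>
     \<alpha> \<noteq> 0 \<and> \<beta> \<noteq> 0"

definition D_5_12 :: "(nat \<Rightarrow> 'v) \<Rightarrow> (nat \<Rightarrow> nat \<Rightarrow> 'k) \<Rightarrow> ('v \<Rightarrow> 'v) \<Rightarrow> bool" where
  "D_5_12 e d f \<longleftrightarrow>
     f (e 1) = d 1 1 *\<^sub>K e 1 + d 5 1 *\<^sub>K e 5 \<and>
     f (e 2) = d 1 1 *\<^sub>K (e 2 + e 3) + d 5 2 *\<^sub>K e 5 \<and>
     f (e 3) = d 1 1 *\<^sub>K (e 2 + e 3) - d 5 2 *\<^sub>K e 5 \<and>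
     f (e 4) = d 1 1 *\<^sub>K e 4 + d 5 4 *\<^sub>K e 5 \<and>
     f (e 5) = (2 * d 1 1) *\<^sub>K e 5"

definition N_6_19 :: "nat \<Rightarrow> (nat \<Rightarrow> 'v) \<Rightarrow> 'k \<Rightarrow> 'k \<Rightarrow> bool" where
  "N_6_19 n e \<alpha> \<beta> \<longleftrightarrow> n = 6 \<and> normal_base n e \<and>
     e 4 \<cdot> e 4 = \<alpha> *\<^sub>K e 6 \<and>
     e 5 \<cdot> e 5 = \<beta> *\<^sub>K e 6 \<and>
     \<alpha> \<noteq> 0 \<and> \<beta> \<noteq> 0"

definition D_6_19 :: "(nat \<Rightarrow> 'v) \<Rightarrow> 'k \<Rightarrow> 'k \<Rightarrow> (nat \<Rightarrow> nat \<Rightarrow> 'k) \<Rightarrow> ('v \<Rightarrow> 'v) \<Rightarrow> bool" where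
  "D_6_19 e \<alpha> \<beta> d f \<longleftrightarrow>
     f (e 1) = d 1 1 *\<^sub>K e 1 + d 6 1 *\<^sub>K e 6 \<and>
     f (e 2) = d 2 2 *\<^sub>K e 2 + (2 * d 1 1 - d 2 2) *\<^sub>K e 3 + d 4 2 *\<^sub>K e 4 + d 5 2 *\<^sub>K e 5 + d 6 2 *\<^sub>K e 6 \<and>
     f (e 3) = (2 * d 1 1 - d 2 2) *\<^sub>K e 2 + d 2 2 *\<^sub>K e 3 - d 4 2 *\<^sub>K e 4 - d 5 2 *\<^sub>K e 5 - d 6 2 *\<^sub>K e 6 \<and>
     f (e 4) = - (\<alpha> * d 4 2) *\<^sub>K (e 2 + e 3) + d 2 2 *\<^sub>K e 4 + d 5 4 *\<^sub>K e 5 + d 6 4 *\<^sub>K e 6 \<and>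
     f (e 5) = - (\<beta> * d 5 2) *\<^sub>K (e 2 + e 3) - (inverse \<alpha> * \<beta> * d 5 4) *\<^sub>K e 4 + d 2 2 *\<^sub>K e 5 + d 6 5 *\<^sub>K e 6 \<and>
     f (e 6) = (2 * d 2 2) *\<^sub>K e 6"

definition N_6_20 :: "nat \<Rightarrow> (nat \<Rightarrow> 'v) \<Rightarrow> 'k \<Rightarrow> 'k \<Rightarrow> bool" where
  "N_6_20 n e \<alpha> \<beta> \<longleftrightarrow> n = 6 \<and> normal_base n e \<and>
     e 4 \<cdot> e 4 = \<alpha> *\<^sub>K (e 2 + e 3) \<and>
     e 5 \<cdot> e 5 = \<beta> *\<^sub>K e 6 \<and>
     \<alpha> \<noteq> 0 \<and> \<beta> \<noteq> 0"

definition D_6_20 :: "(nat \<Rightarrow> 'v) \<Rightarrow> 'k \<Rightarrow> 'k \<Rightarrow> (nat \<Rightarrow> nat \<Rightarrow> 'k) \<Rightarrow> ('v \<Rightarrow> 'v) \<Rightarrow> bool" where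
  "D_6_20 e \<alpha> \<beta> d f \<longleftrightarrow>
     f (e 1) = d 1 1 *\<^sub>K e 1 + d 4 1 *\<^sub>K e 4 + d 6 1 *\<^sub>K e 6 \<and>
     f (e 2) = d 2 2 *\<^sub>K e 2 + (2 * d 1 1 - d 2 2) *\<^sub>K e 3 + d 5 2 *\<^sub>K e 5 + d 6 2 *\<^sub>K e 6 \<and>
     f (e 3) = (2 * d 1 1 - d 2 2) *\<^sub>K e 2 + d 2 2 *\<^sub>K e 3 - d 5 2 *\<^sub>K e 5 - d 6 2 *\<^sub>K e 6 \<and>
     f (e 4) = - (\<alpha> * d 4 1) *\<^sub>K e 1 + d 1 1 *\<^sub>K e 4 + d 6 4 *\<^sub>K e 6 \<and>
     f (e 5) = - (\<beta> * d 5 2) *\<^sub>K (e 2 + e 3) + d 2 2 *\<^sub>K e 5 + d 6 5 *\<^sub>K e 6 \<and>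
     f (e 6) = (2 * d 2 2) *\<^sub>K e 6"

definition N_6_21 :: "nat \<Rightarrow> (nat \<Rightarrow> 'v) \<Rightarrow> 'k \<Rightarrow> 'k \<Rightarrow> 'k \<Rightarrow> bool" where
  "N_6_21 n e \<alpha> \<beta> \<gamma> \<longleftrightarrow> n = 6 \<and> normal_base n e \<and>
     e 4 \<cdot> e 4 = \<alpha> *\<^sub>K (e 2 + e 3) + \<beta> *\<^sub>K e 6 \<and>
     e 5 \<cdot> e 5 = \<gamma> *\<^sub>K e 6 \<and>
     \<alpha> \<noteq> 0 \<and> \<beta> \<noteq> 0 \<and> \<gamma> \<noteq> 0"

definition D_6_21 :: "(nat \<Rightarrow> 'v) \<Rightarrow> 'k \<Rightarrow> (nat \<Rightarrow> nat \<Rightarrow> 'k) \<Rightarrow> ('v \<Rightarrow> 'v) \<Rightarrow> bool" where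
  "D_6_21 e \<gamma> d f \<longleftrightarrow>
     f (e 1) = d 1 1 *\<^sub>K e 1 + d 6 1 *\<^sub>K e 6 \<and>
     f (e 2) = d 1 1 *\<^sub>K (e 2 + e 3) + d 5 2 *\<^sub>K e 5 + d 6 2 *\<^sub>K e 6 \<and>
     f (e 3) = d 1 1 *\<^sub>K (e 2 + e 3) - d 5 2 *\<^sub>K e 5 - d 6 2 *\<^sub>K e 6 \<and>
     f (e 4) = d 1 1 *\<^sub>K e 4 + d 6 4 *\<^sub>K e 6 \<and>
     f (e 5) = - (\<gamma> * d 5 2) *\<^sub>K (e 2 + e 3) + d 1 1 *\<^sub>K e 5 + d 6 5 *\<^sub>K e 6 \<and>
     f (e 6) = (2 * d 1 1) *\<^sub>K e 6"

text \<open>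
  For \<open>N_6_22\<close> the entries \<open>d 1 1\<close> and \<open>d 2 2\<close> are independent, and \<open>e 6\<close> is scaled by
  \<open>2 * d 2 2\<close>. So the entry \<open>c 6 4\<close> of a commutator
  contains
  \<open>(d' 1 1 * d 6 4 - d 1 1 * d' 6 4) + 2 * (d' 6 4 * d 2 2 - d 6 4 * d' 2 2)\<close>. The term
  \<open>d' 6 4 * d 1 1 - d 6 4 * d' 1 1\<close> printed in the source at this place is a
  misprint: it vanishes on \<open>d 1 1 = d' 1 1 = 0\<close>, \<open>d 2 2 = d' 6 4 = 1\<close>, \<open>d' 2 2 = 0\<close>
  (all other entries 0), where \<open>c 6 4 = 2\<close>.
\<close>

definition N_6_22 :: "nat \<Rightarrow> (nat \<Rightarrow> 'v) \<Rightarrow> 'k \<Rightarrow> 'k \<Rightarrow> bool" where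
  "N_6_22 n e \<alpha> \<beta> \<longleftrightarrow> n = 6 \<and> normal_base n e \<and>
     e 4 \<cdot> e 4 = \<alpha> *\<^sub>K (e 2 + e 3) \<and>
     e 5 \<cdot> e 5 = \<beta> *\<^sub>K (e 2 + e 3) \<and>
     \<alpha> \<noteq> 0 \<and> \<beta> \<noteq> 0"

definition D_6_22 :: "(nat \<Rightarrow> 'v) \<Rightarrow> 'k \<Rightarrow> 'k \<Rightarrow> (nat \<Rightarrow> nat \<Rightarrow> 'k) \<Rightarrow> ('v \<Rightarrow> 'v) \<Rightarrow> bool" where
  "D_6_22 e \<alpha> \<beta> d f \<longleftrightarrow>
     f (e 1) = d 1 1 *\<^sub>K e 1 + d 4 1 *\<^sub>K e 4 + d 5 1 *\<^sub>K e 5 + d 6 1 *\<^sub>K e 6 \<and>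
     f (e 2) = d 2 2 *\<^sub>K e 2 + (2 * d 1 1 - d 2 2) *\<^sub>K e 3 + d 6 2 *\<^sub>K e 6 \<and>
     f (e 3) = (2 * d 1 1 - d 2 2) *\<^sub>K e 2 + d 2 2 *\<^sub>K e 3 - d 6 2 *\<^sub>K e 6 \<and>
     f (e 4) = - (\<alpha> * d 4 1) *\<^sub>K e 1 + d 1 1 *\<^sub>K e 4 + d 5 4 *\<^sub>K e 5 + d 6 4 *\<^sub>K e 6 \<and>
     f (e 5) = - (\<beta> * d 5 1) *\<^sub>K e 1 - (inverse \<alpha> * \<beta> * d 5 4) *\<^sub>K e 4 + d 1 1 *\<^sub>K e 5 + d 6 5 *\<^sub>K e 6 \<and>
     f (e 6) = (2 * d 2 2) *\<^sub>K e 6"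

definition N_6_23 :: "nat \<Rightarrow> (nat \<Rightarrow> 'v) \<Rightarrow> 'k \<Rightarrow> 'k \<Rightarrow> 'k \<Rightarrow> 'k \<Rightarrow> bool" where
  "N_6_23 n e \<alpha> \<beta> \<gamma> \<delta> \<longleftrightarrow> n = 6 \<and> normal_base n e \<and>
     e 4 \<cdot> e 4 = \<alpha> *\<^sub>K (e 2 + e 3) + \<beta> *\<^sub>K e 6 \<and>
     e 5 \<cdot> e 5 = \<gamma> *\<^sub>K (e 2 + e 3) + \<delta> *\<^sub>K e 6 \<and>
     \<alpha> * \<delta> - \<beta> * \<gamma> \<noteq> 0 \<and> \<alpha> * \<gamma> \<noteq> 0 \<and> \<beta> * \<delta> \<noteq> 0"

definition D_6_23 :: "(nat \<Rightarrow> 'v) \<Rightarrow> (nat \<Rightarrow> nat \<Rightarrow> 'k) \<Rightarrow> ('v \<Rightarrow> 'v) \<Rightarrow> bool" where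
  "D_6_23 e d f \<longleftrightarrow>
     f (e 1) = d 1 1 *\<^sub>K e 1 + d 6 1 *\<^sub>K e 6 \<and>
     f (e 2) = d 1 1 *\<^sub>K (e 2 + e 3) + d 6 2 *\<^sub>K e 6 \<and>
     f (e 3) = d 1 1 *\<^sub>K (e 2 + e 3) - d 6 2 *\<^sub>K e 6 \<and>
     f (e 4) = d 1 1 *\<^sub>K e 4 + d 6 4 *\<^sub>K e 6 \<and>
     f (e 5) = d 1 1 *\<^sub>K e 5 + d 6 5 *\<^sub>K e 6 \<and>
     f (e 6) = (2 * d 1 1) *\<^sub>K e 6"

definition N_6_24 :: "nat \<Rightarrow> (nat \<Rightarrow> 'v) \<Rightarrow> 'k \<Rightarrow> 'k \<Rightarrow> 'k \<Rightarrow> bool" where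
  "N_6_24 n e \<alpha> \<beta> \<gamma> \<longleftrightarrow> n = 6 \<and> normal_base n e \<and>
     e 4 \<cdot> e 4 = \<alpha> *\<^sub>K (e 2 + e 3) + \<beta> *\<^sub>K e 6 \<and>
     e 5 \<cdot> e 5 = \<gamma> *\<^sub>K (e 2 + e 3) \<and>
     \<alpha> * \<beta> * \<gamma> \<noteq> 0"

definition D_6_24 :: "(nat \<Rightarrow> 'v) \<Rightarrow> 'k \<Rightarrow> (nat \<Rightarrow> nat \<Rightarrow> 'k) \<Rightarrow> ('v \<Rightarrow> 'v) \<Rightarrow> bool" where
  "D_6_24 e \<gamma> d f \<longleftrightarrow>
     f (e 1) = d 1 1 *\<^sub>K e 1 + d 5 1 *\<^sub>K e 5 + d 6 1 *\<^sub>K e 6 \<and>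
     f (e 2) = d 1 1 *\<^sub>K (e 2 + e 3) + d 6 2 *\<^sub>K e 6 \<and>
     f (e 3) = d 1 1 *\<^sub>K (e 2 + e 3) - d 6 2 *\<^sub>K e 6 \<and>
     f (e 4) = d 1 1 *\<^sub>K e 4 + d 6 4 *\<^sub>K e 6 \<and>
     f (e 5) = - (\<gamma> * d 5 1) *\<^sub>K e 1 + d 1 1 *\<^sub>K e 5 + d 6 5 *\<^sub>K e 6 \<and>
     f (e 6) = (2 * d 1 1) *\<^sub>K e 6"

end

end

theory Submission
  imports Defs
begin

text \<open>
  All ten normal forms belong to one family. Put \<open>s = e\<^sub>2 + e\<^sub>3\<close>. Then \<open>e\<^sub>1\<^sup>2 = s\<close>, \<open>e\<^sub>2\<^sup>2 = e\<^sub>n\<close>,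
  \<open>e\<^sub>3\<^sup>2 = - e\<^sub>n\<close>, \<open>e\<^sub>n\<^sup>2 = 0\<close>, and the other squares also lie in the plane spanned by the independent
  vectors \<open>s\<close> and \<open>e\<^sub>n\<close>: \<open>e\<^sub>i\<^sup>2 = p\<^sub>i s + q\<^sub>i e\<^sub>n\<close> for all \<open>i\<close>.

  Let \<open>f\<close> be linear with matrix \<open>d\<close>. As \<open>e\<^sub>i e\<^sub>k = 0\<close> for \<open>i \<noteq> k\<close>, only one term survives in
  \<open>e\<^sub>i f(e\<^sub>j) = d\<^sub>i\<^sub>j e\<^sub>i\<^sup>2\<close>. So \<open>f\<close> is a derivation iff
  \<open>d\<^sub>i\<^sub>j e\<^sub>i\<^sup>2 + d\<^sub>j\<^sub>i e\<^sub>j\<^sup>2 = 0\<close> for \<open>i \<noteq> j\<close> and \<open>f(e\<^sub>i\<^sup>2) = 2 d\<^sub>i\<^sub>i e\<^sub>i\<^sup>2\<close>.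
  The second condition for \<open>i = 1, 2\<close> reads \<open>f(s) = 2 d\<^sub>1\<^sub>1 s\<close> and \<open>f(e\<^sub>n) = 2 d\<^sub>2\<^sub>2 e\<^sub>n\<close>; given these, for
  the other \<open>i\<close> it says \<open>p\<^sub>i (d\<^sub>i\<^sub>i - d\<^sub>1\<^sub>1) = 0 = q\<^sub>i (d\<^sub>i\<^sub>i - d\<^sub>2\<^sub>2)\<close>, since \<open>2\<close> is invertible. Comparing
  coefficients of \<open>s\<close> and \<open>e\<^sub>n\<close> in the first condition leaves a linear system for the entries of \<open>d\<close>
  (\<open>derivation_iff_matrix\<close>), which is solved for each normal form
  (\<open>derivation_matrix_form_4_6\<close> and its companions).

  The bracket of derivations has the commutator of their matrices as its matrix. It is a derivation
  again, hence of the same general form, so only its free entries have to be computed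
  (\<open>commutator_form_4_6\<close> and its companions).

  Some of these free entries vanish identically; this bounds the derived algebra from above. For the
  lower bound let \<open>T\<close> be the grading derivation, the one with \<open>d\<^sub>1\<^sub>1 = d\<^sub>2\<^sub>2 = 1\<close> and all other free
  entries 0. If \<open>d\<^sub>1\<^sub>1 = d\<^sub>2\<^sub>2 = 0\<close> in a derivation \<open>D\<close>, then \<open>[T, D]\<close> arises from \<open>D\<close> by multiplying
  each free entry by its weight. The entry in position \<open>(n, 2)\<close> has weight 2, which is invertible. The
  other entries that survive in the derived algebra have weight 1. So \<open>T\<close> alone produces
  the whole derived algebra as brackets \<open>[T, D]\<close>. The only exception is \<open>N_6_22\<close>, where three
  surviving entries have weight 0; they are the coordinates of a perfect three-dimensional Lie algebra,
  and are brackets of one another (\<open>derived_algebra_6_22\<close>).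
\<close>

section \<open>Matrices of derivations\<close>

\<comment> \<open>Matrix indices start from 1; the index 1 should not turn into \<open>Suc 0\<close>.\<close>
declare One_nat_def [simp del]

lemma two_neq_zero:
  assumes "CHAR('k::field) \<noteq> 2"
  shows "(2::'k) \<noteq> 0"
proof
  assume "(2::'k) = 0"
  then have "of_nat 2 = (0::'k)" by simp
  then have "CHAR('k) dvd 2" by (simp only: of_nat_eq_0_iff_char_dvd)
  then have "CHAR('k) \<le> 2" "CHAR('k) \<noteq> 0" by (auto dest: dvd_imp_le intro: Nat.gr0I)
  then show False using assms CHAR_not_1[where 'a = 'k] by linarith
qed

definition commutator :: "nat \<Rightarrow> (nat \<Rightarrow> nat \<Rightarrow> 'k::field) \<Rightarrow> (nat \<Rightarrow> nat \<Rightarrow> 'k) \<Rightarrow> nat \<Rightarrow> nat \<Rightarrow> 'k" where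
  "commutator n a b j i = (\<Sum>k=1..n. a j k * b k i - b j k * a k i)"

definition agree :: "nat \<Rightarrow> (nat \<Rightarrow> nat \<Rightarrow> 'k) \<Rightarrow> (nat \<Rightarrow> nat \<Rightarrow> 'k) \<Rightarrow> bool" where
  "agree n a b \<longleftrightarrow> (\<forall>i\<in>{1..n}. \<forall>j\<in>{1..n}. a j i = b j i)"

lemma commutator_cong:
  "agree n a a' \<Longrightarrow> agree n b b' \<Longrightarrow>
  agree n (commutator n a b) (commutator n a' b')"
  by (simp add: agree_def commutator_def)

lemma agree_trans: "agree n a b \<Longrightarrow> agree n b c \<Longrightarrow> agree n a c"
  by (simp add: agree_def)

lemma matrix_entries_cong:
  fixes scale :: "'k::field \<Rightarrow> 'v::ab_group_add \<Rightarrow> 'v"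
  shows "matrix_entries scale n e f a \<Longrightarrow> agree n a b \<Longrightarrow> matrix_entries scale n e f b"
  by (simp add: agree_def matrix_entries_def)

text \<open>
  The Leibniz rule for an algebra with squares \<open>p i *\<^sub>K (e 2 + e 3) + q i *\<^sub>K e n\<close>, in terms of the
  matrix of the map. The first clause is the rule for two different basis vectors. With
  \<open>e 1 \<cdot> e 1 = e 2 + e 3\<close> and \<open>e 2 \<cdot> e 2 = e n\<close>, the second and third are the rules for \<open>e 1\<close> and
  \<open>e 2\<close> with themselves, solved for column 3 and column \<open>n\<close>. The last one is what these leave of the
  rule for \<open>e i\<close> with itself after the factor 2 is cancelled.
\<close>

definition derivation_matrix ::
    "nat \<Rightarrow> (nat \<Rightarrow> 'k::field) \<Rightarrow> (nat \<Rightarrow> 'k) \<Rightarrow> (nat \<Rightarrow> nat \<Rightarrow> 'k) \<Rightarrow> bool" where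
  "derivation_matrix n p q d \<longleftrightarrow>
     (\<forall>i\<in>{1..n}. \<forall>j\<in>{1..n}. i < j \<longrightarrow>
        p j * d j i + p i * d i j = 0 \<and> q j * d j i + q i * d i j = 0) \<and>
     (\<forall>j\<in>{1..n}. d j 3 = (if j = 2 \<or> j = 3 then 2 * d 1 1 else 0) - d j 2) \<and>
     (\<forall>j\<in>{1..n}. d j n = (if j = n then 2 * d 2 2 else 0)) \<and>
     (\<forall>i\<in>{1..n}. p i * (d i i - d 1 1) = 0 \<and> q i * (d i i - d 2 2) = 0)"

section \<open>Linear maps and coordinates\<close>

context comm_algebra
begin

lemma mult_add_right: "x \<cdot> (y + z) = x \<cdot> y + x \<cdot> z"
  using mult_add_left mult_commute by metis

lemma mult_scale_right: "x \<cdot> (a *\<^sub>K y) = a *\<^sub>K (x \<cdot> y)"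
  using mult_scale_left mult_commute by metis

lemma mult_zero_right: "x \<cdot> 0 = 0"
  using mult_scale_right[of x 0 0] by simp

lemma mult_diff_right: "x \<cdot> (y - z) = x \<cdot> y - x \<cdot> z"
  using mult_add_right[of x "y - z" z] by (simp add: eq_diff_eq)

lemma mult_diff_left: "(x - y) \<cdot> z = x \<cdot> z - y \<cdot> z"
  using mult_diff_right mult_commute by metis

lemma mult_sum_right: "x \<cdot> (\<Sum>i\<in>A. g i) = (\<Sum>i\<in>A. x \<cdot> g i)"
  by (induction A rule: infinite_finite_induct) (simp_all add: mult_zero_right mult_add_right)

lemma linear_iff_additive:
  "Vector_Spaces.linear scale scale f \<longleftrightarrow>
     (\<forall>x y. f (x + y) = f x + f y) \<and> (\<forall>a x. f (a *\<^sub>K x) = a *\<^sub>K f x)"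
  using vector_space_axioms by (simp add: Vector_Spaces.linear_iff)

lemma bracket_derivation:
  assumes "f \<in> derivations scale mult" "g \<in> derivations scale mult"
  shows "bracket f g \<in> derivations scale mult"
proof -
  have f: "f (x + y) = f x + f y" "f (a *\<^sub>K x) = a *\<^sub>K f x" "f (x \<cdot> y) = x \<cdot> f y + f x \<cdot> y"
    and g: "g (x + y) = g x + g y" "g (a *\<^sub>K x) = a *\<^sub>K g x" "g (x \<cdot> y) = x \<cdot> g y + g x \<cdot> y"
    for x y a
    using assms by (auto simp: derivations_def linear_iff_additive)
  show ?thesis
    unfolding derivations_def bracket_def mem_Collect_eq linear_iff_additive
    by (intro conjI allI)
      (simp_all add: f g scale_right_diff_distrib mult_diff_right mult_diff_left algebra_simps)
qed

end

locale based_algebra = comm_algebra scale mult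
  for scale :: "'k::field \<Rightarrow> 'v::ab_group_add \<Rightarrow> 'v" (infixr "*\<^sub>K" 75)
    and mult :: "'v \<Rightarrow> 'v \<Rightarrow> 'v" (infixl "\<cdot>" 70) +
  fixes n :: nat and e :: "nat \<Rightarrow> 'v"
  assumes basis: "natural_basis scale mult n e"
begin

definition coord :: "nat \<Rightarrow> 'v \<Rightarrow> 'k" where
  "coord i x = representation (e ` {1..n}) x (e i)"

lemma inj: "inj_on e {1..n}" and indep: "independent (e ` {1..n})" and span:
    "span (e ` {1..n}) = UNIV"
  and orthogonal: "i \<in> {1..n} \<Longrightarrow> j \<in> {1..n} \<Longrightarrow> i \<noteq> j \<Longrightarrow> e i \<cdot> e j = 0"
  using basis by (auto simp: natural_basis_def)

lemma coord_add: "coord i (x + y) = coord i x + coord i y"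
  and coord_diff: "coord i (x - y) = coord i x - coord i y"
  and coord_scale: "coord i (a *\<^sub>K x) = a * coord i x"
  and coord_zero: "coord i 0 = 0"
  and coord_sum: "coord i (\<Sum>k\<in>A. g k) = (\<Sum>k\<in>A. coord i (g k))"
  unfolding coord_def
  by (simp_all add: indep span representation_add representation_diff
      representation_scale representation_zero representation_sum)

lemma coord_basis: "i \<in> {1..n} \<Longrightarrow> j \<in> {1..n} \<Longrightarrow> coord j (e i) = (if j = i then 1 else 0)"
  by (simp add: coord_def indep representation_basis inj_on_eq_iff[OF inj])

lemmas coord_simps = coord_add coord_diff coord_scale coord_zero coord_sum coord_basis

lemma expansion: "(\<Sum>i=1..n. coord i x *\<^sub>K e i) = x"
  using sum_representation_eq[OF indep, of x "e ` {1..n}"]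
  by (simp add: span sum.reindex[OF inj] coord_def)

lemma coord_eqI:
  assumes "\<And>i. i \<in> {1..n} \<Longrightarrow> coord i x = coord i y"
  shows "x = y"
proof -
  have "(\<Sum>i=1..n. coord i x *\<^sub>K e i) = (\<Sum>i=1..n. coord i y *\<^sub>K e i)"
    using assms by (intro sum.cong) auto
  then show ?thesis by (simp only: expansion)
qed

lemma eq_iff_coord: "x = y \<longleftrightarrow> (\<forall>i\<in>{1..n}. coord i x = coord i y)"
  using coord_eqI by blast

lemma coord_combination: "j \<in> {1..n} \<Longrightarrow> coord j (\<Sum>i=1..n. a i *\<^sub>K e i) = a j"
  by (simp add: coord_simps if_distrib[of "\<lambda>x. _ * x"] cong: if_cong)

definition matrix_map :: "(nat \<Rightarrow> nat \<Rightarrow> 'k) \<Rightarrow> 'v \<Rightarrow> 'v" where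
  "matrix_map d x = (\<Sum>j=1..n. (\<Sum>i=1..n. d j i * coord i x) *\<^sub>K e j)"

lemma coord_matrix_map: "j \<in> {1..n} \<Longrightarrow> coord j (matrix_map d x) = (\<Sum>i=1..n. d j i * coord i x)"
  unfolding matrix_map_def by (rule coord_combination)

lemma linear_matrix_map: "Vector_Spaces.linear scale scale (matrix_map d)"
  unfolding linear_iff_additive
  by (auto intro!: coord_eqI
      simp: coord_matrix_map coord_simps distrib_left sum.distrib sum_distrib_left mult.left_commute)

lemma matrix_map_basis: "i \<in> {1..n} \<Longrightarrow> matrix_map d (e i) = (\<Sum>j=1..n. d j i *\<^sub>K e j)"
  by (rule coord_eqI)
    (simp add: coord_matrix_map coord_combination coord_basis if_distrib[of "\<lambda>x. _ * x"] cong: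
        if_cong)

lemma linear_extensional:
  assumes "Vector_Spaces.linear scale scale f" "Vector_Spaces.linear scale scale g"
    and "\<And>i. i \<in> {1..n} \<Longrightarrow> f (e i) = g (e i)"
  shows "f = g"
proof
  interpret vector_space_pair scale scale by unfold_locales
  fix x show "f x = g x"
    by (rule linear_eq_on[OF assms(1,2), of x "e ` {1..n}"]) (use assms(3) span in auto)
qed

lemma linear_eq_matrix_map:
  assumes "Vector_Spaces.linear scale scale f" "matrix_entries scale n e f d"
  shows "f = matrix_map d"
  by (rule linear_extensional[OF assms(1) linear_matrix_map])
    (use assms(2) in \<open>auto simp: matrix_entries_def matrix_map_basis\<close>)

lemma matrix_map_cong: "agree n a b \<Longrightarrow> matrix_map a = matrix_map b"
  by (rule linear_extensional[OF linear_matrix_map linear_matrix_map])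
    (auto simp: matrix_map_basis agree_def)

lemma matrix_map_inject: "agree n a b" if "matrix_map a = matrix_map b"
  unfolding agree_def
proof (intro ballI)
  fix i j assume "i \<in> {1..n}" "j \<in> {1..n}"
  then show "a j i = b j i"
    using arg_cong[OF that, of "\<lambda>f. coord j (f (e i))"] by
        (simp add: matrix_map_basis coord_combination)
qed

lemma bracket_matrix_map: "bracket (matrix_map a) (matrix_map b) = matrix_map (commutator n a b)"
proof (intro ext coord_eqI)
  fix x j assume j: "j \<in> {1..n}"
  have swap: "(\<Sum>k=1..n. u j k * (\<Sum>i=1..n. v k i * coord i x)) =
      (\<Sum>i=1..n. \<Sum>k=1..n. u j k * v k i * coord i x)" for u v
    by (subst sum.swap) (simp add: sum_distrib_left mult.assoc)
  show "coord j (bracket (matrix_map a) (matrix_map b) x) = coord j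
      (matrix_map (commutator n a b) x)"
    using j by (simp add: bracket_def coord_diff coord_matrix_map commutator_def swap
        sum_distrib_right sum_subtractf left_diff_distrib)
qed

lemma matrix_entries_unique:
  assumes "matrix_entries scale n e f a" "matrix_entries scale n e f b"
  shows "agree n a b"
  unfolding agree_def
proof (intro ballI)
  fix i j assume ij: "i \<in> {1..n}" "j \<in> {1..n}"
  then have "(\<Sum>k=1..n. a k i *\<^sub>K e k) = (\<Sum>k=1..n. b k i *\<^sub>K e k)"
    using assms by (simp add: matrix_entries_def)
  then show "a j i = b j i"
    using coord_combination[OF ij(2)] by metis
qed

lemma matrix_entries_matrix_map: "matrix_entries scale n e (matrix_map d) d"
  by (simp add: matrix_entries_def matrix_map_basis)

lemma commutator_entries:
  assumes "Vector_Spaces.linear scale scale f" "Vector_Spaces.linear scale scale g"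
    and "matrix_entries scale n e f a" "matrix_entries scale n e g b"
    and "matrix_entries scale n e (bracket f g) c"
  shows "agree n c (commutator n a b)"
  using assms linear_eq_matrix_map bracket_matrix_map matrix_entries_unique matrix_entries_matrix_map
  by metis

text \<open>Both sides of the Leibniz rule are bilinear.\<close>

lemma derivation_iff_on_basis:
  assumes lin: "Vector_Spaces.linear scale scale f"
  shows "f \<in> derivations scale mult \<longleftrightarrow>
    (\<forall>i\<in>{1..n}. \<forall>j\<in>{1..n}. f (e i \<cdot> e j) = e i \<cdot> f (e j) + f (e i) \<cdot> e j)"
    (is "_ \<longleftrightarrow> ?onbasis")
proof
  assume "f \<in> derivations scale mult" then show ?onbasis by (auto simp: derivations_def)
next
  assume basis: ?onbasis
  have f: "f (x + y) = f x + f y" "f (a *\<^sub>K x) = a *\<^sub>K f x" for x y a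
    using lin by (auto simp: linear_iff_additive)
  have f0: "f 0 = 0" using f(2)[of 0 0] by simp
  let ?leib = "\<lambda>u v. f (u \<cdot> v) = u \<cdot> f v + f u \<cdot> v"
  note expand = f f0 mult_add_left mult_add_right mult_scale_left mult_scale_right mult_zero_right
    mult_commute[of 0] scale_right_distrib
  have sub1: "subspace (Collect (?leib u))" for u
    by (auto simp: subspace_def expand)
  have sub2: "subspace {u. ?leib u v}" for v
    by (auto simp: subspace_def expand)
  have "?leib (e i) v" if "i \<in> {1..n}" for i v
  proof -
    have "v \<in> span (e ` {1..n})" by (simp add: span)
    then show ?thesis
      by (rule span_induct[OF _ sub1]) (use that basis in auto)
  qed
  moreover have "u \<in> span (e ` {1..n})" for u by (simp add: span)
  ultimately have "?leib u v" for u v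
    by (rule_tac span_induct[OF _ sub2, of u]) auto
  then show "f \<in> derivations scale mult" using lin by (auto simp: derivations_def)
qed

end

section \<open>Algebras whose squares span a plane\<close>

locale two_square_algebra = based_algebra scale mult n e
  for scale :: "'k::field \<Rightarrow> 'v::ab_group_add \<Rightarrow> 'v" (infixr "*\<^sub>K" 75)
    and mult :: "'v \<Rightarrow> 'v \<Rightarrow> 'v" (infixl "\<cdot>" 70)
    and n :: nat and e :: "nat \<Rightarrow> 'v" +
  fixes p q :: "nat \<Rightarrow> 'k"
  assumes n_ge_4: "4 \<le> n"
    and char: "CHAR('k) \<noteq> 2"
    and square: "i \<in> {1..n} \<Longrightarrow> e i \<cdot> e i = p i *\<^sub>K (e 2 + e 3) + q i *\<^sub>K e n"
    and pq: "p 1 = 1" "q 1 = 0" "p 2 = 0" "q 2 = 1"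
begin

lemma two: "(2::'k) \<noteq> 0"
  by (rule two_neq_zero[OF char])

text \<open>The vectors \<open>e 2 + e 3\<close> and \<open>e n\<close> have disjoint supports because \<open>n \<ge> 4\<close>, so each coordinate of
  a square involves only one of \<open>p\<close> and \<open>q\<close>.\<close>

lemma coord_square:
  "i \<in> {1..n} \<Longrightarrow> k \<in> {1..n} \<Longrightarrow>
     coord k (e i \<cdot> e i) = (if k = 2 \<or> k = 3 then p i else if k = n then q i else 0)"
  using n_ge_4 by (auto simp: square coord_simps)

lemma matrix_map_square:
  assumes "i \<in> {1..n}" "k \<in> {1..n}"
  shows "coord k (matrix_map d (e i \<cdot> e i)) = p i * (d k 2 + d k 3) + q i * d k n"
proof -
  have "matrix_map d (e i \<cdot> e i) =
      p i *\<^sub>K (matrix_map d (e 2) + matrix_map d (e 3)) + q i *\<^sub>K matrix_map d (e n)"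
    using assms linear_matrix_map[of d] by (simp add: square linear_iff_additive)
  then show ?thesis
    using assms n_ge_4 by (simp add: coord_add coord_scale matrix_map_basis coord_combination)
qed

lemma mult_matrix_map:
  assumes "i \<in> {1..n}" "j \<in> {1..n}"
  shows "e i \<cdot> matrix_map d (e j) = d i j *\<^sub>K (e i \<cdot> e i)"
proof -
  have "e i \<cdot> matrix_map d (e j) = (\<Sum>k=1..n. d k j *\<^sub>K (e i \<cdot> e k))"
    using assms by (simp add: matrix_map_basis mult_sum_right mult_scale_right)
  also have "\<dots> = (\<Sum>k=1..n. if k = i then d i j *\<^sub>K (e i \<cdot> e i) else 0)"
    using assms by (intro sum.cong) (auto simp: orthogonal)
  finally show ?thesis using assms by simp
qed

text \<open>
  The Leibniz rule for \<open>e i\<close> and \<open>e j\<close> is compared coordinate by coordinate: coordinate 2 gives the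
  conditions on \<open>p\<close>, coordinate \<open>n\<close> those on \<open>q\<close>. The characteristic enters only when the factor 2 is
  cancelled in the rule for \<open>e i\<close> with itself.
\<close>

theorem derivation_iff_matrix:
  "matrix_map d \<in> derivations scale mult \<longleftrightarrow> derivation_matrix n p q d"
proof -
  let ?leib = "\<lambda>i j k. coord k (matrix_map d (e i \<cdot> e j)) =
    d i j * coord k (e i \<cdot> e i) + d j i * coord k (e j \<cdot> e j)"
  have "matrix_map d \<in> derivations scale mult \<longleftrightarrow>
      (\<forall>i\<in>{1..n}. \<forall>j\<in>{1..n}. \<forall>k\<in>{1..n}. ?leib i j k)" (is "_ \<longleftrightarrow> ?all")
  proof -
    have "matrix_map d (e i \<cdot> e j) = e i \<cdot> matrix_map d (e j) + matrix_map d (e i) \<cdot> e j \<longleftrightarrow>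
        (\<forall>k\<in>{1..n}. ?leib i j k)" if "i \<in> {1..n}" "j \<in> {1..n}" for i j
    proof -
      have "e i \<cdot> matrix_map d (e j) + matrix_map d (e i) \<cdot> e j =
          d i j *\<^sub>K (e i \<cdot> e i) + d j i *\<^sub>K (e j \<cdot> e j)"
        using that mult_matrix_map mult_commute by metis
      then show ?thesis
        by (simp add: eq_iff_coord coord_add coord_scale)
    qed
    then show ?thesis
      by (simp add: derivation_iff_on_basis[OF linear_matrix_map])
  qed
  also have "\<dots> \<longleftrightarrow> derivation_matrix n p q d"
  proof
    assume all: ?all
    have off: "d i j * coord k (e i \<cdot> e i) + d j i * coord k (e j \<cdot> e j) = 0"
      if "i \<in> {1..n}" "j \<in> {1..n}" "k \<in> {1..n}" "i \<noteq> j" for i j k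
    proof -
      have "coord k (matrix_map d (e i \<cdot> e j)) = 0"
        using that by (simp add: orthogonal coord_matrix_map coord_zero)
      then show ?thesis using all that by simp
    qed
    have diag: "p i * (d k 2 + d k 3) + q i * d k n =
        2 * d i i * (if k = 2 \<or> k = 3 then p i else if k = n then q i else 0)"
      if "i \<in> {1..n}" "k \<in> {1..n}" for i k
    proof -
      have "coord k (matrix_map d (e i \<cdot> e i)) = d i i * coord k (e i \<cdot> e i) + d i i * coord k
          (e i \<cdot> e i)"
        using all that by blast
      then show ?thesis
        unfolding matrix_map_square[OF that] coord_square[OF that] by (simp add: mult.assoc)
    qed
    have in_range: "1 \<in> {1..n}" "2 \<in> {1..n}" "3 \<in> {1..n}" "n \<in> {1..n}" "n \<noteq> 2" "n \<noteq> 3"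
      using n_ge_4 by auto
    have c3: "d k 2 + d k 3 = (if k = 2 \<or> k = 3 then 2 * d 1 1 else 0)" if "k \<in> {1..n}" for k
      using diag[OF in_range(1) that] by (simp add: pq)
    have cn: "d k n = (if k = n then 2 * d 2 2 else 0)" if "k \<in> {1..n}" for k
      using diag[OF in_range(2) that] n_ge_4 by (simp add: pq split: if_splits)
    have "p i * (d i i - d 1 1) = 0" "q i * (d i i - d 2 2) = 0" if i: "i \<in> {1..n}" for i
    proof -
      have "2 * (p i * (d i i - d 1 1)) = 0"
        using diag[OF i in_range(2)] c3[OF in_range(2)] cn[OF in_range(2)] n_ge_4
        by (auto simp: algebra_simps)
      then show "p i * (d i i - d 1 1) = 0" using two by simp
      have "2 * (q i * (d i i - d 2 2)) = 0"
        using diag[OF i in_range(4)] c3[OF in_range(4)] cn[OF in_range(4)] n_ge_4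
        by (auto simp: algebra_simps)
      then show "q i * (d i i - d 2 2) = 0" using two by simp
    qed
    moreover have "p j * d j i + p i * d i j = 0" "q j * d j i + q i * d i j = 0"
      if "i \<in> {1..n}" "j \<in> {1..n}" "i < j" for i j
      using off[of i j 2] off[of i j n] that in_range by
          (simp_all add: coord_square algebra_simps)
    moreover have "d k 3 = (if k = 2 \<or> k = 3 then 2 * d 1 1 else 0) - d k 2" if "k \<in> {1..n}" for k
      using c3[OF that] by (simp add: eq_diff_eq add.commute)
    ultimately show "derivation_matrix n p q d"
      using cn unfolding derivation_matrix_def by simp
  next
    assume dm: "derivation_matrix n p q d"
    have off: "p j * d j i + p i * d i j = 0 \<and> q j * d j i + q i * d i j = 0"
      if "i \<in> {1..n}" "j \<in> {1..n}" "i \<noteq> j" for i j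
    proof (cases "i < j")
      case True then show ?thesis using dm that unfolding derivation_matrix_def by blast
    next
      case False
      then have "p i * d i j + p j * d j i = 0 \<and> q i * d i j + q j * d j i = 0"
        using dm that unfolding derivation_matrix_def by (meson linorder_neqE_nat)
      then show ?thesis by (simp add: add.commute)
    qed
    have c3: "d k 3 = (if k = 2 \<or> k = 3 then 2 * d 1 1 else 0) - d k 2"
      and cn: "d k n = (if k = n then 2 * d 2 2 else 0)"
      and pd: "p k * d k k = p k * d 1 1" and qd: "q k * d k k = q k * d 2 2" if "k \<in> {1..n}"
          for k
      using dm that unfolding derivation_matrix_def by (auto simp: algebra_simps)
    show ?all
    proof (intro ballI)
      fix i j k assume i: "i \<in> {1..n}" and j: "j \<in> {1..n}" and k: "k \<in> {1..n}"
      show "?leib i j k"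
      proof (cases "i = j")
        case True
        have "p i * (d k 2 + d k 3) + q i * d k n =
            2 * (if k = 2 \<or> k = 3 then p i * d i i else if k = n then q i * d i i else 0)"
          using c3[OF k] cn[OF k] pd[OF i] qd[OF i] n_ge_4 by (auto simp: algebra_simps)
        then show ?thesis
          using True i k by (simp add: matrix_map_square coord_square mult.commute split:
              if_splits)
      next
        case False
        have "coord k (matrix_map d (e i \<cdot> e j)) = 0"
          using False i j k by (simp add: orthogonal coord_matrix_map coord_zero)
        then show ?thesis
          using off[OF i j False] i j k by (simp add: coord_square algebra_simps)
      qed
    qed
  qed
  finally show ?thesis .
qed

lemma derivationE:
  assumes "f \<in> derivations scale mult"
  obtains d where "f = matrix_map d" "derivation_matrix n p q d"
proof
  let ?d = "\<lambda>j i. coord j (f (e i))"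
  show f: "f = matrix_map ?d"
    using assms by (intro linear_eq_matrix_map)
        (auto simp: derivations_def matrix_entries_def expansion)
  then show "derivation_matrix n p q ?d"
    using assms derivation_iff_matrix by metis
qed

lemma derivation_matrix_of_entries:
  assumes "f \<in> derivations scale mult" "matrix_entries scale n e f d"
  shows "derivation_matrix n p q d"
  using assms linear_eq_matrix_map derivation_iff_matrix unfolding derivations_def
  by (metis (no_types, lifting) mem_Collect_eq)

text \<open>The bracket of derivations is a derivation; on matrices this would be a tedious computation.\<close>

lemma derivation_matrix_commutator:
  "derivation_matrix n p q a \<Longrightarrow> derivation_matrix n p q b \<Longrightarrow> derivation_matrix n p q
      (commutator n a b)"
  using bracket_derivation bracket_matrix_map derivation_iff_matrix by metis

lemma matrix_map_add: "matrix_map (\<lambda>j i. a j i + b j i) = matrix_map a + matrix_map b"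
  and matrix_map_scale: "matrix_map (\<lambda>j i. r * a j i) = fun_scale scale r (matrix_map a)"
  by (intro ext coord_eqI; simp add: coord_matrix_map coord_simps fun_scale_def distrib_right
      sum.distrib sum_distrib_left mult.assoc)+

lemma matrix_map_zero: "matrix_map (\<lambda>j i. 0) = 0"
  by (intro ext coord_eqI) (simp add: coord_matrix_map coord_zero)

lemma fun_scale_vector_space: "vector_space (fun_scale scale)"
  by unfold_locales (auto simp: fun_scale_def fun_eq_iff algebra_simps)

text \<open>
  The derived algebra is the span of the maps whose matrices are commutators of derivation matrices.
  If a linear injective parametrisation \<open>B\<close> of matrices covers all these commutators, and if all its
  values are sums of such commutators, then it parametrises exactly the derived algebra.
\<close>

lemma derived_algebra_isoI:
  fixes t :: "'k \<Rightarrow> 'w::ab_group_add \<Rightarrow> 'w" and B :: "'w \<Rightarrow> nat \<Rightarrow> nat \<Rightarrow> 'k"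
  assumes t: "vector_space t"
    and add: "\<And>u v. agree n (B (u + v)) (\<lambda>j i. B u j i + B v j i)"
    and scale: "\<And>r u. agree n (B (t r u)) (\<lambda>j i. r * B u j i)"
    and inj: "\<And>u. agree n (B u) (\<lambda>j i. 0) \<Longrightarrow> u = 0"
    and upper: "\<And>a b. derivation_matrix n p q a \<Longrightarrow> derivation_matrix n p q b \<Longrightarrow>
      derivation_matrix n p q (commutator n a b) \<Longrightarrow> \<exists>u. agree n (commutator n a b) (B u)"
    and lower: "\<And>u. \<exists>L. (\<forall>(a, b)\<in>set L. derivation_matrix n p q a \<and> derivation_matrix n p q b) \<and>
      agree n (B u) (\<lambda>j i. \<Sum>(a, b)\<leftarrow>L. commutator n a b j i)"
  shows "derived_algebra_iso scale mult t"
proof -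
  interpret F: vector_space "fun_scale scale" by (rule fun_scale_vector_space)
  let ?\<phi> = "\<lambda>u. matrix_map (B u)"
  have lin: "Vector_Spaces.linear t (fun_scale scale) ?\<phi>"
    using t fun_scale_vector_space matrix_map_cong[OF add] matrix_map_cong[OF scale]
    by (simp add: Vector_Spaces.linear_iff matrix_map_add matrix_map_scale)
  interpret phi: Vector_Spaces.linear t "fun_scale scale" ?\<phi> by (rule lin)
  have "u = 0" if "?\<phi> u = 0" for u
    using that matrix_map_inject[of "B u" "\<lambda>j i. 0"] inj by (simp add: matrix_map_zero)
  then have "inj ?\<phi>"
    by (simp add: phi.inj_iff_eq_0)
  moreover have "range ?\<phi> = derived_algebra scale mult"
  proof
    let ?brackets = "{bracket f g |f g. f \<in> derivations scale mult \<and> g \<in> derivations scale mult}"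
    have "?\<phi> u \<in> F.span ?brackets" for u
    proof -
      obtain L where L: "\<forall>(a, b)\<in>set L. derivation_matrix n p q a \<and> derivation_matrix n p q b"
        and B: "agree n (B u) (\<lambda>j i. \<Sum>(a, b)\<leftarrow>L. commutator n a b j i)"
        using lower by blast
      have "matrix_map (\<lambda>j i. \<Sum>(a, b)\<leftarrow>L. commutator n a b j i) \<in> F.span ?brackets"
        using L
      proof (induction L)
        case Nil
        show ?case
          by (simp only: list.map sum_list.Nil matrix_map_zero F.span_zero)
      next
        case (Cons ab L)
        obtain a b where ab: "ab = (a, b)" by (cases ab)
        then have "matrix_map a \<in> derivations scale mult" "matrix_map b \<in> derivations scale mult"
          using Cons.prems by (simp_all add: derivation_iff_matrix)
        then have "matrix_map (commutator n a b) \<in> F.span ?brackets"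
          unfolding bracket_matrix_map[symmetric] by (intro F.span_base) blast
        moreover have "matrix_map (\<lambda>j i. \<Sum>(a, b)\<leftarrow>L. commutator n a b j i) \<in> F.span ?brackets"
          using Cons by simp
        ultimately show ?case
          unfolding ab list.map sum_list.Cons prod.case matrix_map_add by (rule F.span_add)
      qed
      then show ?thesis using matrix_map_cong[OF B] by simp
    qed
    then show "range ?\<phi> \<subseteq> derived_algebra scale mult"
      by (auto simp: derived_algebra_def)
    have "?brackets \<subseteq> range ?\<phi>"
    proof clarify
      fix f g assume "f \<in> derivations scale mult" "g \<in> derivations scale mult"
      then obtain a b where ab: "f = matrix_map a" "derivation_matrix n p q a"
          "g = matrix_map b" "derivation_matrix n p q b"
        by (metis derivationE)
      then obtain u where "agree n (commutator n a b) (B u)"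
        using upper derivation_matrix_commutator by blast
      then show "bracket f g \<in> range ?\<phi>"
        using matrix_map_cong ab by (auto simp: bracket_matrix_map)
    qed
    moreover have "F.subspace (range ?\<phi>)"
      using phi.subspace_image[OF phi.vs1.subspace_UNIV] by simp
    ultimately show "derived_algebra scale mult \<subseteq> range ?\<phi>"
      unfolding derived_algebra_def by (intro F.span_minimal)
  qed
  ultimately show ?thesis
    unfolding derived_algebra_iso_def using lin by blast
qed

text \<open>
  The same criterion when the derivations are given by a general form \<open>G\<close> in some free entries.
  The commutator of two matrices of this form is a derivation matrix, so it is determined
  by its own free entries; the map \<open>s\<close> places the parameters at the free entries that can be nonzero.
\<close>

lemma derived_algebra_iso_formI:
  fixes t :: "'k \<Rightarrow> 'w::ab_group_add \<Rightarrow> 'w" and s :: "'w \<Rightarrow> nat \<Rightarrow> nat \<Rightarrow> 'k"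
  assumes t: "vector_space t"
    and form: "\<And>d. derivation_matrix n p q d \<Longrightarrow> agree n d (G d)"
    and derivation: "\<And>d. derivation_matrix n p q (G d)"
    and add: "\<And>u v. agree n (G (s (u + v))) (\<lambda>j i. G (s u) j i + G (s v) j i)"
    and scale: "\<And>r u. agree n (G (s (t r u))) (\<lambda>j i. r * G (s u) j i)"
    and inj: "\<And>u. agree n (G (s u)) (\<lambda>j i. 0) \<Longrightarrow> u = 0"
    and upper: "\<And>d d'. \<exists>u. agree n (G (commutator n (G d) (G d'))) (G (s u))"
    and lower: "\<And>u. \<exists>L. agree n (G (s u)) (\<lambda>j i. \<Sum>(d, d')\<leftarrow>L. commutator n (G d) (G d') j i)"
  shows "derived_algebra_iso scale mult t"
proof (rule derived_algebra_isoI[OF t add scale inj])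
  fix a b
  assume ab: "derivation_matrix n p q a" "derivation_matrix n p q b"
  then have "agree n (commutator n a b) (commutator n (G a) (G b))"
    using form by (intro commutator_cong)
  moreover have "agree n (commutator n (G a) (G b)) (G (commutator n (G a) (G b)))"
    using derivation by (intro form derivation_matrix_commutator)
  moreover obtain u where "agree n (G (commutator n (G a) (G b))) (G (s u))"
    using upper by blast
  ultimately show "\<exists>u. agree n (commutator n a b) (G (s u))"
    using agree_trans by blast
next
  fix u
  obtain L where "agree n (G (s u)) (\<lambda>j i. \<Sum>(d, d')\<leftarrow>L. commutator n (G d) (G d') j i)"
    using lower by blast
  then show "\<exists>L. (\<forall>(a, b)\<in>set L. derivation_matrix n p q a \<and> derivation_matrix n p q b) \<and>
      agree n (G (s u)) (\<lambda>j i. \<Sum>(a, b)\<leftarrow>L. commutator n a b j i)"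
    using derivation
    by (intro exI[of _ "map (\<lambda>(d, d'). (G d, G d')) L"]) (auto simp: o_def case_prod_unfold)
qed

lemma bracket_form:
  assumes form: "\<And>d. derivation_matrix n p q d \<Longrightarrow> agree n d (G d)"
    and f: "f \<in> derivations scale mult" "matrix_entries scale n e f d"
    and g: "g \<in> derivations scale mult" "matrix_entries scale n e g d'"
    and fg: "matrix_entries scale n e (bracket f g) c"
  shows "matrix_entries scale n e (bracket f g) (G c)" "agree n c (commutator n (G d) (G d'))"
proof -
  have "agree n c (G c)"
    using bracket_derivation[OF f(1) g(1)] fg by (intro form derivation_matrix_of_entries)
  with fg show "matrix_entries scale n e (bracket f g) (G c)"
    by (rule matrix_entries_cong)
  have "agree n d (G d)" "agree n d' (G d')"
    using f g by (auto intro: form derivation_matrix_of_entries)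
  moreover have "agree n c (commutator n d d')"
    using f g fg commutator_entries unfolding derivations_def by blast
  ultimately show "agree n c (commutator n (G d) (G d'))"
    using commutator_cong agree_trans by blast
qed

end

section \<open>Matrices given by lists of columns\<close>

definition column_matrix :: "'k list list \<Rightarrow> nat \<Rightarrow> nat \<Rightarrow> 'k" where
  "column_matrix cs j i = cs ! (i - 1) ! (j - 1)"

definition nth1 :: "'k list \<Rightarrow> nat \<Rightarrow> 'k" where
  "nth1 xs i = xs ! (i - 1)"

text \<open>A choice of free entries; the entries that are not listed are 0.\<close>

definition entries :: "((nat \<times> nat) \<times> 'k::zero) list \<Rightarrow> nat \<Rightarrow> nat \<Rightarrow> 'k" where
  "entries xs j i = (case map_of xs (j, i) of None \<Rightarrow> 0 | Some x \<Rightarrow> x)"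

lemma interval_4: "{1..4::nat} = {1, 2, 3, 4}"
  and interval_5: "{1..5::nat} = {1, 2, 3, 4, 5}"
  and interval_6: "{1..6::nat} = {1, 2, 3, 4, 5, 6}"
  by auto

lemmas matrix_simps = interval_4 interval_5 interval_6 column_matrix_def nth1_def nth_Cons'

text \<open>
  The matrix on \<open>e 2, e 3\<close> is symmetric as \<open>e 2\<close> and \<open>e 3\<close> have opposite squares, its diagonal is
  constant as these squares are eigenvectors for the same eigenvalue, and its rows sum to \<open>2 * d 1 1\<close>.
\<close>

lemma middle_entries:
  assumes "derivation_matrix n (nth1 (1 # 0 # 0 # ps)) (nth1 (0 # 1 # - 1 # qs)) d" "4 \<le> n"
  shows "d 2 3 = 2 * d 1 1 - d 2 2" "d 3 2 = 2 * d 1 1 - d 2 2" "d 3 3 = d 2 2"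
proof -
  let ?p = "nth1 (1 # 0 # 0 # ps)" and ?q = "nth1 (0 # 1 # - 1 # qs)"
  have in_range: "2 \<in> {1..n}" "3 \<in> {1..n}" "2 < (3 :: nat)"
    using assms(2) by auto
  have "?q 3 * d 3 2 + ?q 2 * d 2 3 = 0"
    using assms(1) in_range unfolding derivation_matrix_def by blast
  moreover have "d 2 3 = 2 * d 1 1 - d 2 2" "?q 3 * (d 3 3 - d 2 2) = 0"
    using assms(1) in_range unfolding derivation_matrix_def by auto
  ultimately show "d 2 3 = 2 * d 1 1 - d 2 2" "d 3 2 = 2 * d 1 1 - d 2 2" "d 3 3 = d 2 2"
    by (simp_all add: nth1_def)
qed

text \<open>
  A square with components along both \<open>e 2 + e 3\<close> and \<open>e n\<close> ties their eigenvalues \<open>2 * d 1 1\<close> and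
  \<open>2 * d 2 2\<close> together.
\<close>

lemma scalar_entries_eq:
  assumes "derivation_matrix n p q d" "i \<in> {1..n}" "p i \<noteq> 0" "q i \<noteq> 0"
  shows "d 2 2 = d 1 1"
  using assms unfolding derivation_matrix_def by auto

lemma vector_4 [simp]:
  "(vector [w, x, y, z] :: 'k::zero ^ 4) $ 1 = w" "(vector [w, x, y, z] :: 'k ^ 4) $ 2 = x"
  "(vector [w, x, y, z] :: 'k ^ 4) $ 3 = y" "(vector [w, x, y, z] :: 'k ^ 4) $ 4 = z"
  by (simp_all add: vector_def)

lemma prod_scale:
  assumes "vector_space s" "vector_space t"
  shows "vector_space (module_prod.scale s t)"
    and "module_prod.scale s t r v = (s r (fst v), t r (snd v))"
proof -
  interpret vector_space_prod s t
    using assms by (simp add: vector_space_prod_def vector_space_pair_def)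
  show "vector_space (module_prod.scale s t)" by (rule p.vector_space_axioms)
  show "module_prod.scale s t r v = (s r (fst v), t r (snd v))" by (rule scale_def)
qed

lemmas vec_space = vec.vector_space_axioms vector_space_over_itself.vector_space_axioms

section \<open>The ten normal forms\<close>

text \<open>
  One scheme of lemmas serves all normal forms. Except for \<open>N_6_22\<close>, the derived algebra is bounded
  from below by the bracket of the grading derivation, \<open>entries [((1, 1), 1), ((2, 2), 1)]\<close>, with the
  wanted derivation, whose entry of weight 2 is halved first.
\<close>

subsection \<open>The derivations of \<open>N_4_6\<close>\<close>

definition form_4_6 :: "(nat \<Rightarrow> nat \<Rightarrow> 'k::field) \<Rightarrow> nat \<Rightarrow> nat \<Rightarrow> 'k" where
  "form_4_6 d = column_matrix
     [[d 1 1, 0, 0, d 4 1],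
      [0, d 2 2, 2 * d 1 1 - d 2 2, d 4 2],
      [0, 2 * d 1 1 - d 2 2, d 2 2, - d 4 2],
      [0, 0, 0, 2 * d 2 2]]"

lemma derivation_matrix_form_4_6:
  assumes "derivation_matrix 4 (nth1 [1, 0, 0, 0]) (nth1 [0, 1, - 1, 0]) d"
  shows "agree 4 d (form_4_6 d)"
  using assms middle_entries[OF assms(1)]
  by (auto simp: matrix_simps form_4_6_def agree_def derivation_matrix_def add_eq_0_iff)

lemma commutator_form_4_6:
  fixes d d' :: "nat \<Rightarrow> nat \<Rightarrow> 'k::field"
  defines "c \<equiv> commutator 4 (form_4_6 d) (form_4_6 d')"
  shows "c 1 1 = 0"
    "c 2 2 = 0"
    "c 4 1 = (d' 1 1 * d 4 1 - d 1 1 * d' 4 1) + 2 * (d' 4 1 * d 2 2 - d 4 1 * d' 2 2)"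
    "c 4 2 = 2 * (d' 4 2 * d 1 1 - d 4 2 * d' 1 1)"
  by (simp_all add: matrix_simps form_4_6_def commutator_def c_def field_simps)

lemma linear_map_form_4_6:
  fixes scale :: "'k::field \<Rightarrow> 'v::ab_group_add \<Rightarrow> 'v"
  assumes "vector_space scale" "matrix_entries scale 4 e f (form_4_6 c)"
  shows "D_4_6 scale e c f"
proof -
  interpret vector_space scale by fact
  show ?thesis
    using assms(2)
    by (simp add: matrix_entries_def matrix_simps form_4_6_def D_4_6_def
        scale_right_distrib add.assoc)
qed

lemma two_square_algebra_4_6:
  fixes scale :: "'k::field \<Rightarrow> 'v::ab_group_add \<Rightarrow> 'v" and mult :: "'v \<Rightarrow> 'v \<Rightarrow> 'v"
  assumes "comm_algebra scale mult" "CHAR('k) \<noteq> 2" "N_4_6 scale mult n e"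
  shows "n = 4" "two_square_algebra scale mult 4 e (nth1 [1, 0, 0, 0]) (nth1 [0, 1, - 1, 0])"
proof -
  interpret comm_algebra scale mult by fact
  show "n = 4" using assms(3) by (simp add: N_4_6_def)
  show "two_square_algebra scale mult 4 e (nth1 [1, 0, 0, 0]) (nth1 [0, 1, - 1, 0])"
    using assms(2,3) by unfold_locales (auto simp: N_4_6_def normal_base_def matrix_simps)
qed

lemma derived_algebra_4_6:
  fixes scale :: "'k::field \<Rightarrow> 'v::ab_group_add \<Rightarrow> 'v" and mult :: "'v \<Rightarrow> 'v \<Rightarrow> 'v"
  assumes "two_square_algebra scale mult 4 e (nth1 [1, 0, 0, 0]) (nth1 [0, 1, - 1, 0])"
  shows "derived_algebra_iso scale mult ((*s) :: 'k \<Rightarrow> 'k ^ 2 \<Rightarrow> 'k ^ 2)"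
proof -
  interpret two_square_algebra scale mult 4 e "nth1 [1, 0, 0, 0]" "nth1 [0, 1, - 1, 0]" by fact
  let ?G = "form_4_6"
  let ?s = "\<lambda>u :: 'k ^ 2. entries [((4, 1), u $ 1), ((4, 2), u $ 2)]"
  let ?der = "derivation_matrix 4 (nth1 [1, 0, 0, 0]) (nth1 [0, 1, - 1, 0])"
  let ?t = "((*s) :: 'k \<Rightarrow> 'k ^ 2 \<Rightarrow> 'k ^ 2)"
  note defs = matrix_simps form_4_6_def agree_def entries_def
  show ?thesis
  proof (rule derived_algebra_iso_formI[where G = ?G and s = ?s])
    show "vector_space ?t"
      by (intro prod_scale vec_space)
    show "agree 4 d (?G d)" if "?der d" for d
      using that by (rule derivation_matrix_form_4_6)
    show "?der (?G d)" for d
      by (simp add: defs derivation_matrix_def)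
    show "agree 4 (?G (?s (u + v))) (\<lambda>j i. ?G (?s u) j i + ?G (?s v) j i)" for u v
      by (simp add: defs algebra_simps)
    show "agree 4 (?G (?s (?t r u))) (\<lambda>j i. r * ?G (?s u) j i)" for r u
      by (simp add: defs algebra_simps)
    show "u = 0" if "agree 4 (?G (?s u)) (\<lambda>j i. 0)" for u
      using that by (simp add: defs prod_eq_iff vec_eq_iff forall_2 forall_3 forall_4)
    show "\<exists>u. agree 4 (?G (commutator 4 (?G d) (?G d'))) (?G (?s u))" for d d'
    proof -
      define c where "c = commutator 4 (?G d) (?G d')"
      have "c 1 1 = 0" "c 2 2 = 0"
        unfolding c_def by (simp_all add: commutator_form_4_6)
      then show ?thesis
        unfolding c_def[symmetric]
        by (intro exI[of _ "vector [c 4 1, c 4 2]"]) (simp add: defs)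
    qed
    show "\<exists>L. agree 4 (?G (?s u)) (\<lambda>j i. \<Sum>(d, d')\<leftarrow>L. commutator 4 (?G d) (?G d') j i)" for u
      using two
      by (intro exI[of _ "[(entries [((1, 1), 1), ((2, 2), 1)],
        entries [((4, 1), u $ 1), ((4, 2), u $ 2 / 2)])]"])
        (simp add: defs commutator_def)
  qed
qed

lemma derivation_brackets_4_6:
  fixes scale :: "'k::field \<Rightarrow> 'v::ab_group_add \<Rightarrow> 'v" and mult :: "'v \<Rightarrow> 'v \<Rightarrow> 'v"
  assumes "comm_algebra scale mult" "CHAR('k) \<noteq> 2" "N_4_6 scale mult n e"
    and f: "f \<in> derivations scale mult" "matrix_entries scale n e f d"
    and g: "g \<in> derivations scale mult" "matrix_entries scale n e g d'"
    and fg: "matrix_entries scale n e (bracket f g) c"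
  shows "D_4_6 scale e c (bracket f g) \<and>
    c 1 1 = 0 \<and> c 2 2 = 0 \<and>
    c 4 1 = (d' 1 1 * d 4 1 - d 1 1 * d' 4 1) + 2 * (d' 4 1 * d 2 2 - d 4 1 * d' 2 2) \<and>
    c 4 2 = 2 * (d' 4 2 * d 1 1 - d 4 2 * d' 1 1) \<and>
    derived_algebra_iso scale mult ((*s) :: 'k \<Rightarrow> 'k ^ 2 \<Rightarrow> 'k ^ 2)"
proof -
  have n: "n = 4"
    by (rule two_square_algebra_4_6(1)[OF assms(1-3)])
  have alg: "two_square_algebra scale mult 4 e (nth1 [1, 0, 0, 0]) (nth1 [0, 1, - 1, 0])"
    by (rule two_square_algebra_4_6(2)[OF assms(1-3)])
  interpret two_square_algebra scale mult 4 e "nth1 [1, 0, 0, 0]" "nth1 [0, 1, - 1, 0]"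
      by (rule alg)
  note bracket = bracket_form[of "form_4_6",
      OF derivation_matrix_form_4_6 f[unfolded n] g[unfolded n] fg[unfolded n]]
  have "c j i = commutator 4 (form_4_6 d) (form_4_6 d') j i" if "i \<in> {1..4}" "j \<in> {1..4}" for i j
    using bracket(2) that by (simp add: agree_def)
  then show ?thesis
    using linear_map_form_4_6[OF vector_space_axioms bracket(1)] derived_algebra_4_6[OF alg]
    by (simp add: commutator_form_4_6)
qed

subsection \<open>The derivations of \<open>N_5_10\<close>\<close>

definition form_5_10 :: "'k::field \<Rightarrow> (nat \<Rightarrow> nat \<Rightarrow> 'k) \<Rightarrow> nat \<Rightarrow> nat \<Rightarrow> 'k" where
  "form_5_10 \<alpha> d = column_matrix
     [[d 1 1, 0, 0, 0, d 5 1],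
      [0, d 2 2, 2 * d 1 1 - d 2 2, d 4 2, d 5 2],
      [0, 2 * d 1 1 - d 2 2, d 2 2, - d 4 2, - d 5 2],
      [0, - (\<alpha> * d 4 2), - (\<alpha> * d 4 2), d 2 2, d 5 4],
      [0, 0, 0, 0, 2 * d 2 2]]"

lemma derivation_matrix_form_5_10:
  assumes "derivation_matrix 5 (nth1 [1, 0, 0, 0, 0]) (nth1 [0, 1, - 1, \<alpha>, 0]) d"
    and "\<alpha> \<noteq> 0"
  shows "agree 5 d (form_5_10 \<alpha> d)"
  using assms middle_entries[OF assms(1)]
  by (auto simp: matrix_simps form_5_10_def agree_def derivation_matrix_def add_eq_0_iff)

lemma commutator_form_5_10:
  fixes d d' :: "nat \<Rightarrow> nat \<Rightarrow> 'k::field" and \<alpha> :: 'k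
  defines "c \<equiv> commutator 5 (form_5_10 \<alpha> d) (form_5_10 \<alpha> d')"
  shows "c 1 1 = 0"
    "c 2 2 = 0"
    "c 5 1 = (d' 1 1 * d 5 1 - d 1 1 * d' 5 1) + 2 * (d' 5 1 * d 2 2 - d 5 1 * d' 2 2)"
    "c 4 2 = (d' 2 2 * d 4 2 - d 2 2 * d' 4 2) + 2 * (d' 4 2 * d 1 1 - d 4 2 * d' 1 1)"
    "c 5 2 = (d' 4 2 * d 5 4 - d 4 2 * d' 5 4) + 2 * (d' 5 2 * d 1 1 - d 5 2 * d' 1 1)"
    "c 5 4 = d' 5 4 * d 2 2 - d 5 4 * d' 2 2"
  by (simp_all add: matrix_simps form_5_10_def commutator_def c_def field_simps)

lemma linear_map_form_5_10:
  fixes scale :: "'k::field \<Rightarrow> 'v::ab_group_add \<Rightarrow> 'v"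
  assumes "vector_space scale" "matrix_entries scale 5 e f (form_5_10 \<alpha> c)"
  shows "D_5_10 scale e \<alpha> c f"
proof -
  interpret vector_space scale by fact
  show ?thesis
    using assms(2)
    by (simp add: matrix_entries_def matrix_simps form_5_10_def D_5_10_def
        scale_right_distrib add.assoc)
qed

lemma two_square_algebra_5_10:
  fixes scale :: "'k::field \<Rightarrow> 'v::ab_group_add \<Rightarrow> 'v" and mult :: "'v \<Rightarrow> 'v \<Rightarrow> 'v"
  assumes "comm_algebra scale mult" "CHAR('k) \<noteq> 2" "N_5_10 scale mult n e \<alpha>"
  shows "n = 5" "two_square_algebra scale mult 5 e (nth1 [1, 0, 0, 0, 0])
      (nth1 [0, 1, - 1, \<alpha>, 0])"
proof -
  interpret comm_algebra scale mult by fact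
  show "n = 5" using assms(3) by (simp add: N_5_10_def)
  show "two_square_algebra scale mult 5 e (nth1 [1, 0, 0, 0, 0]) (nth1 [0, 1, - 1, \<alpha>, 0])"
    using assms(2,3) by unfold_locales (auto simp: N_5_10_def normal_base_def matrix_simps)
qed

lemma derived_algebra_5_10:
  fixes scale :: "'k::field \<Rightarrow> 'v::ab_group_add \<Rightarrow> 'v" and mult :: "'v \<Rightarrow> 'v \<Rightarrow> 'v"
  assumes "two_square_algebra scale mult 5 e (nth1 [1, 0, 0, 0, 0]) (nth1 [0, 1, - 1, \<alpha>, 0])"
    and "\<alpha> \<noteq> 0"
  shows "derived_algebra_iso scale mult (module_prod.scale ((*) :: 'k \<Rightarrow> 'k \<Rightarrow> 'k)
      ((*s) :: 'k \<Rightarrow> 'k ^ 3 \<Rightarrow> 'k ^ 3))"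
proof -
  interpret two_square_algebra scale mult 5 e "nth1 [1, 0, 0, 0, 0]" "nth1 [0, 1, - 1, \<alpha>, 0]"
      by fact
  let ?G = "form_5_10 \<alpha>"
  let ?s = "\<lambda>u :: 'k \<times> ('k ^ 3). entries [((5, 1), fst u), ((4, 2), snd u $ 1),
      ((5, 2), snd u $ 2), ((5, 4), snd u $ 3)]"
  let ?der = "derivation_matrix 5 (nth1 [1, 0, 0, 0, 0]) (nth1 [0, 1, - 1, \<alpha>, 0])"
  let ?t = "(module_prod.scale ((*) :: 'k \<Rightarrow> 'k \<Rightarrow> 'k) ((*s) :: 'k \<Rightarrow> 'k ^ 3 \<Rightarrow> 'k ^ 3))"
  note defs = matrix_simps form_5_10_def agree_def entries_def
  show ?thesis
  proof (rule derived_algebra_iso_formI[where G = ?G and s = ?s])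
    show "vector_space ?t"
      by (intro prod_scale vec_space)
    show "agree 5 d (?G d)" if "?der d" for d
      using that assms(2-) by (rule derivation_matrix_form_5_10)
    show "?der (?G d)" for d
      using assms(2-) by (simp add: defs derivation_matrix_def)
    show "agree 5 (?G (?s (u + v))) (\<lambda>j i. ?G (?s u) j i + ?G (?s v) j i)" for u v
      by (simp add: defs algebra_simps)
    show "agree 5 (?G (?s (?t r u))) (\<lambda>j i. r * ?G (?s u) j i)" for r u
      by (simp add: defs prod_scale vec_space algebra_simps)
    show "u = 0" if "agree 5 (?G (?s u)) (\<lambda>j i. 0)" for u
      using that by (simp add: defs prod_eq_iff vec_eq_iff forall_2 forall_3 forall_4)
    show "\<exists>u. agree 5 (?G (commutator 5 (?G d) (?G d'))) (?G (?s u))" for d d'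
    proof -
      define c where "c = commutator 5 (?G d) (?G d')"
      have "c 1 1 = 0" "c 2 2 = 0"
        unfolding c_def by (simp_all add: commutator_form_5_10)
      then show ?thesis
        unfolding c_def[symmetric]
        by (intro exI[of _ "(c 5 1, vector [c 4 2, c 5 2, c 5 4])"]) (simp add: defs)
    qed
    show "\<exists>L. agree 5 (?G (?s u)) (\<lambda>j i. \<Sum>(d, d')\<leftarrow>L. commutator 5 (?G d) (?G d') j i)" for u
      using two assms(2-)
      by (intro exI[of _ "[(entries [((1, 1), 1), ((2, 2), 1)],
        entries [((5, 1), fst u), ((4, 2), snd u $ 1), ((5, 2), snd u $ 2 / 2),
            ((5, 4), snd u $ 3)])]"])
        (simp add: defs commutator_def)
  qed
qed

lemma derivation_brackets_5_10:
  fixes scale :: "'k::field \<Rightarrow> 'v::ab_group_add \<Rightarrow> 'v" and mult :: "'v \<Rightarrow> 'v \<Rightarrow> 'v"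
  assumes "comm_algebra scale mult" "CHAR('k) \<noteq> 2" "N_5_10 scale mult n e \<alpha>"
    and f: "f \<in> derivations scale mult" "matrix_entries scale n e f d"
    and g: "g \<in> derivations scale mult" "matrix_entries scale n e g d'"
    and fg: "matrix_entries scale n e (bracket f g) c"
  shows "D_5_10 scale e \<alpha> c (bracket f g) \<and>
    c 1 1 = 0 \<and> c 2 2 = 0 \<and>
    c 5 1 = (d' 1 1 * d 5 1 - d 1 1 * d' 5 1) + 2 * (d' 5 1 * d 2 2 - d 5 1 * d' 2 2) \<and>
    c 4 2 = (d' 2 2 * d 4 2 - d 2 2 * d' 4 2) + 2 * (d' 4 2 * d 1 1 - d 4 2 * d' 1 1) \<and>
    c 5 2 = (d' 4 2 * d 5 4 - d 4 2 * d' 5 4) + 2 * (d' 5 2 * d 1 1 - d 5 2 * d' 1 1) \<and>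
    c 5 4 = d' 5 4 * d 2 2 - d 5 4 * d' 2 2 \<and>
    derived_algebra_iso scale mult (module_prod.scale ((*) :: 'k \<Rightarrow> 'k \<Rightarrow> 'k)
        ((*s) :: 'k \<Rightarrow> 'k ^ 3 \<Rightarrow> 'k ^ 3))"
proof -
  have n: "n = 5"
    by (rule two_square_algebra_5_10(1)[OF assms(1-3)])
  have alg: "two_square_algebra scale mult 5 e (nth1 [1, 0, 0, 0, 0]) (nth1 [0, 1, - 1, \<alpha>, 0])"
    by (rule two_square_algebra_5_10(2)[OF assms(1-3)])
  have nz: "\<alpha> \<noteq> 0"
    using assms(3) by (simp add: N_5_10_def)
  interpret two_square_algebra scale mult 5 e "nth1 [1, 0, 0, 0, 0]" "nth1 [0, 1, - 1, \<alpha>, 0]"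
      by (rule alg)
  note bracket = bracket_form[of "form_5_10 \<alpha>",
      OF derivation_matrix_form_5_10[OF _ nz] f[unfolded n] g[unfolded n] fg[unfolded n]]
  have "c j i = commutator 5 (form_5_10 \<alpha> d) (form_5_10 \<alpha> d') j i" if "i \<in> {1..5}" "j \<in> {1..5}"
      for i j
    using bracket(2) that by (simp add: agree_def)
  then show ?thesis
    using linear_map_form_5_10[OF vector_space_axioms bracket(1)] derived_algebra_5_10[OF alg nz] nz
    by (simp add: commutator_form_5_10)
qed

subsection \<open>The derivations of \<open>N_5_11\<close>\<close>

definition form_5_11 :: "'k::field \<Rightarrow> (nat \<Rightarrow> nat \<Rightarrow> 'k) \<Rightarrow> nat \<Rightarrow> nat \<Rightarrow> 'k" where
  "form_5_11 \<alpha> d = column_matrix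
     [[d 1 1, 0, 0, d 4 1, d 5 1],
      [0, d 2 2, 2 * d 1 1 - d 2 2, 0, d 5 2],
      [0, 2 * d 1 1 - d 2 2, d 2 2, 0, - d 5 2],
      [- (\<alpha> * d 4 1), 0, 0, d 1 1, d 5 4],
      [0, 0, 0, 0, 2 * d 2 2]]"

lemma derivation_matrix_form_5_11:
  assumes "derivation_matrix 5 (nth1 [1, 0, 0, \<alpha>, 0]) (nth1 [0, 1, - 1, 0, 0]) d"
    and "\<alpha> \<noteq> 0"
  shows "agree 5 d (form_5_11 \<alpha> d)"
  using assms middle_entries[OF assms(1)]
  by (auto simp: matrix_simps form_5_11_def agree_def derivation_matrix_def add_eq_0_iff)

lemma commutator_form_5_11:
  fixes d d' :: "nat \<Rightarrow> nat \<Rightarrow> 'k::field" and \<alpha> :: 'k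
  defines "c \<equiv> commutator 5 (form_5_11 \<alpha> d) (form_5_11 \<alpha> d')"
  shows "c 1 1 = 0"
    "c 4 1 = 0"
    "c 2 2 = 0"
    "c 5 1 = (d' 1 1 * d 5 1 - d 1 1 * d' 5 1) + (d' 4 1 * d 5 4 - d 4 1 * d' 5 4) + 2 *
        (d' 5 1 * d 2 2 - d 5 1 * d' 2 2)"
    "c 5 2 = 2 * (d' 5 2 * d 1 1 - d 5 2 * d' 1 1)"
    "c 5 4 = - \<alpha> * (d' 4 1 * d 5 1 - d 4 1 * d' 5 1) + (d' 1 1 * d 5 4 - d 1 1 * d' 5 4) + 2 *
        (d' 5 4 * d 2 2 - d 5 4 * d' 2 2)"
  by (simp_all add: matrix_simps form_5_11_def commutator_def c_def field_simps)

lemma linear_map_form_5_11: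
  fixes scale :: "'k::field \<Rightarrow> 'v::ab_group_add \<Rightarrow> 'v"
  assumes "vector_space scale" "matrix_entries scale 5 e f (form_5_11 \<alpha> c)"
  shows "D_5_11 scale e \<alpha> c f"
proof -
  interpret vector_space scale by fact
  show ?thesis
    using assms(2)
    by (simp add: matrix_entries_def matrix_simps form_5_11_def D_5_11_def
        scale_right_distrib add.assoc)
qed

lemma two_square_algebra_5_11:
  fixes scale :: "'k::field \<Rightarrow> 'v::ab_group_add \<Rightarrow> 'v" and mult :: "'v \<Rightarrow> 'v \<Rightarrow> 'v"
  assumes "comm_algebra scale mult" "CHAR('k) \<noteq> 2" "N_5_11 scale mult n e \<alpha>"
  shows "n = 5" "two_square_algebra scale mult 5 e (nth1 [1, 0, 0, \<alpha>, 0])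
      (nth1 [0, 1, - 1, 0, 0])"
proof -
  interpret comm_algebra scale mult by fact
  show "n = 5" using assms(3) by (simp add: N_5_11_def)
  show "two_square_algebra scale mult 5 e (nth1 [1, 0, 0, \<alpha>, 0]) (nth1 [0, 1, - 1, 0, 0])"
    using assms(2,3) by unfold_locales (auto simp: N_5_11_def normal_base_def matrix_simps)
qed

lemma derived_algebra_5_11:
  fixes scale :: "'k::field \<Rightarrow> 'v::ab_group_add \<Rightarrow> 'v" and mult :: "'v \<Rightarrow> 'v \<Rightarrow> 'v"
  assumes "two_square_algebra scale mult 5 e (nth1 [1, 0, 0, \<alpha>, 0]) (nth1 [0, 1, - 1, 0, 0])"
    and "\<alpha> \<noteq> 0"
  shows "derived_algebra_iso scale mult ((*s) :: 'k \<Rightarrow> 'k ^ 3 \<Rightarrow> 'k ^ 3)"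
proof -
  interpret two_square_algebra scale mult 5 e "nth1 [1, 0, 0, \<alpha>, 0]" "nth1 [0, 1, - 1, 0, 0]"
      by fact
  let ?G = "form_5_11 \<alpha>"
  let ?s = "\<lambda>u :: 'k ^ 3. entries [((5, 1), u $ 1), ((5, 2), u $ 2), ((5, 4), u $ 3)]"
  let ?der = "derivation_matrix 5 (nth1 [1, 0, 0, \<alpha>, 0]) (nth1 [0, 1, - 1, 0, 0])"
  let ?t = "((*s) :: 'k \<Rightarrow> 'k ^ 3 \<Rightarrow> 'k ^ 3)"
  note defs = matrix_simps form_5_11_def agree_def entries_def
  show ?thesis
  proof (rule derived_algebra_iso_formI[where G = ?G and s = ?s])
    show "vector_space ?t"
      by (intro prod_scale vec_space)
    show "agree 5 d (?G d)" if "?der d" for d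
      using that assms(2-) by (rule derivation_matrix_form_5_11)
    show "?der (?G d)" for d
      using assms(2-) by (simp add: defs derivation_matrix_def)
    show "agree 5 (?G (?s (u + v))) (\<lambda>j i. ?G (?s u) j i + ?G (?s v) j i)" for u v
      by (simp add: defs algebra_simps)
    show "agree 5 (?G (?s (?t r u))) (\<lambda>j i. r * ?G (?s u) j i)" for r u
      by (simp add: defs algebra_simps)
    show "u = 0" if "agree 5 (?G (?s u)) (\<lambda>j i. 0)" for u
      using that by (simp add: defs prod_eq_iff vec_eq_iff forall_2 forall_3 forall_4)
    show "\<exists>u. agree 5 (?G (commutator 5 (?G d) (?G d'))) (?G (?s u))" for d d'
    proof -
      define c where "c = commutator 5 (?G d) (?G d')"
      have "c 1 1 = 0" "c 4 1 = 0" "c 2 2 = 0"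
        unfolding c_def by (simp_all add: commutator_form_5_11)
      then show ?thesis
        unfolding c_def[symmetric]
        by (intro exI[of _ "vector [c 5 1, c 5 2, c 5 4]"]) (simp add: defs)
    qed
    show "\<exists>L. agree 5 (?G (?s u)) (\<lambda>j i. \<Sum>(d, d')\<leftarrow>L. commutator 5 (?G d) (?G d') j i)" for u
      using two assms(2-)
      by (intro exI[of _ "[(entries [((1, 1), 1), ((2, 2), 1)],
        entries [((5, 1), u $ 1), ((5, 2), u $ 2 / 2), ((5, 4), u $ 3)])]"])
        (simp add: defs commutator_def)
  qed
qed

lemma derivation_brackets_5_11:
  fixes scale :: "'k::field \<Rightarrow> 'v::ab_group_add \<Rightarrow> 'v" and mult :: "'v \<Rightarrow> 'v \<Rightarrow> 'v"
  assumes "comm_algebra scale mult" "CHAR('k) \<noteq> 2" "N_5_11 scale mult n e \<alpha>"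
    and f: "f \<in> derivations scale mult" "matrix_entries scale n e f d"
    and g: "g \<in> derivations scale mult" "matrix_entries scale n e g d'"
    and fg: "matrix_entries scale n e (bracket f g) c"
  shows "D_5_11 scale e \<alpha> c (bracket f g) \<and>
    c 1 1 = 0 \<and> c 4 1 = 0 \<and> c 2 2 = 0 \<and>
    c 5 1 = (d' 1 1 * d 5 1 - d 1 1 * d' 5 1) + (d' 4 1 * d 5 4 - d 4 1 * d' 5 4) + 2 *
        (d' 5 1 * d 2 2 - d 5 1 * d' 2 2) \<and>
    c 5 2 = 2 * (d' 5 2 * d 1 1 - d 5 2 * d' 1 1) \<and>
    c 5 4 = - \<alpha> * (d' 4 1 * d 5 1 - d 4 1 * d' 5 1) + (d' 1 1 * d 5 4 - d 1 1 * d' 5 4) + 2 *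
        (d' 5 4 * d 2 2 - d 5 4 * d' 2 2) \<and>
    derived_algebra_iso scale mult ((*s) :: 'k \<Rightarrow> 'k ^ 3 \<Rightarrow> 'k ^ 3)"
proof -
  have n: "n = 5"
    by (rule two_square_algebra_5_11(1)[OF assms(1-3)])
  have alg: "two_square_algebra scale mult 5 e (nth1 [1, 0, 0, \<alpha>, 0]) (nth1 [0, 1, - 1, 0, 0])"
    by (rule two_square_algebra_5_11(2)[OF assms(1-3)])
  have nz: "\<alpha> \<noteq> 0"
    using assms(3) by (simp add: N_5_11_def)
  interpret two_square_algebra scale mult 5 e "nth1 [1, 0, 0, \<alpha>, 0]" "nth1 [0, 1, - 1, 0, 0]"
      by (rule alg)
  note bracket = bracket_form[of "form_5_11 \<alpha>",
      OF derivation_matrix_form_5_11[OF _ nz] f[unfolded n] g[unfolded n] fg[unfolded n]]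
  have "c j i = commutator 5 (form_5_11 \<alpha> d) (form_5_11 \<alpha> d') j i" if "i \<in> {1..5}" "j \<in> {1..5}"
      for i j
    using bracket(2) that by (simp add: agree_def)
  then show ?thesis
    using linear_map_form_5_11[OF vector_space_axioms bracket(1)] derived_algebra_5_11[OF alg nz] nz
    by (simp add: commutator_form_5_11)
qed

subsection \<open>The derivations of \<open>N_5_12\<close>\<close>

definition form_5_12 :: "(nat \<Rightarrow> nat \<Rightarrow> 'k::field) \<Rightarrow> nat \<Rightarrow> nat \<Rightarrow> 'k" where
  "form_5_12 d = column_matrix
     [[d 1 1, 0, 0, 0, d 5 1],
      [0, d 1 1, d 1 1, 0, d 5 2],
      [0, d 1 1, d 1 1, 0, - d 5 2],
      [0, 0, 0, d 1 1, d 5 4],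
      [0, 0, 0, 0, 2 * d 1 1]]"

lemma derivation_matrix_form_5_12:
  assumes "derivation_matrix 5 (nth1 [1, 0, 0, \<alpha>, 0]) (nth1 [0, 1, - 1, \<beta>, 0]) d"
    and "\<alpha> \<noteq> 0 \<and> \<beta> \<noteq> 0"
  shows "agree 5 d (form_5_12 d)"
  using assms middle_entries[OF assms(1)] scalar_entries_eq[OF assms(1), of 4]
  by (auto simp: matrix_simps form_5_12_def agree_def derivation_matrix_def add_eq_0_iff)

lemma commutator_form_5_12:
  fixes d d' :: "nat \<Rightarrow> nat \<Rightarrow> 'k::field"
  defines "c \<equiv> commutator 5 (form_5_12 d) (form_5_12 d')"
  shows "c 1 1 = 0"
    "c 5 1 = d' 5 1 * d 1 1 - d 5 1 * d' 1 1"
    "c 5 2 = 2 * (d' 5 2 * d 1 1 - d 5 2 * d' 1 1)"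
    "c 5 4 = d' 5 4 * d 1 1 - d 5 4 * d' 1 1"
  by (simp_all add: matrix_simps form_5_12_def commutator_def c_def field_simps)

lemma linear_map_form_5_12:
  fixes scale :: "'k::field \<Rightarrow> 'v::ab_group_add \<Rightarrow> 'v"
  assumes "vector_space scale" "matrix_entries scale 5 e f (form_5_12 c)"
  shows "D_5_12 scale e c f"
proof -
  interpret vector_space scale by fact
  show ?thesis
    using assms(2)
    by (simp add: matrix_entries_def matrix_simps form_5_12_def D_5_12_def
        scale_right_distrib add.assoc)
qed

lemma two_square_algebra_5_12:
  fixes scale :: "'k::field \<Rightarrow> 'v::ab_group_add \<Rightarrow> 'v" and mult :: "'v \<Rightarrow> 'v \<Rightarrow> 'v"
  assumes "comm_algebra scale mult" "CHAR('k) \<noteq> 2" "N_5_12 scale mult n e \<alpha> \<beta>"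
  shows "n = 5" "two_square_algebra scale mult 5 e (nth1 [1, 0, 0, \<alpha>, 0])
      (nth1 [0, 1, - 1, \<beta>, 0])"
proof -
  interpret comm_algebra scale mult by fact
  show "n = 5" using assms(3) by (simp add: N_5_12_def)
  show "two_square_algebra scale mult 5 e (nth1 [1, 0, 0, \<alpha>, 0]) (nth1 [0, 1, - 1, \<beta>, 0])"
    using assms(2,3) by unfold_locales (auto simp: N_5_12_def normal_base_def matrix_simps)
qed

lemma derived_algebra_5_12:
  fixes scale :: "'k::field \<Rightarrow> 'v::ab_group_add \<Rightarrow> 'v" and mult :: "'v \<Rightarrow> 'v \<Rightarrow> 'v"
  assumes "two_square_algebra scale mult 5 e (nth1 [1, 0, 0, \<alpha>, 0]) (nth1 [0, 1, - 1, \<beta>, 0])"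
    and "\<alpha> \<noteq> 0 \<and> \<beta> \<noteq> 0"
  shows "derived_algebra_iso scale mult ((*s) :: 'k \<Rightarrow> 'k ^ 3 \<Rightarrow> 'k ^ 3)"
proof -
  interpret two_square_algebra scale mult 5 e "nth1 [1, 0, 0, \<alpha>, 0]" "nth1 [0, 1, - 1, \<beta>, 0]"
      by fact
  let ?G = "form_5_12"
  let ?s = "\<lambda>u :: 'k ^ 3. entries [((5, 1), u $ 1), ((5, 2), u $ 2), ((5, 4), u $ 3)]"
  let ?der = "derivation_matrix 5 (nth1 [1, 0, 0, \<alpha>, 0]) (nth1 [0, 1, - 1, \<beta>, 0])"
  let ?t = "((*s) :: 'k \<Rightarrow> 'k ^ 3 \<Rightarrow> 'k ^ 3)"
  note defs = matrix_simps form_5_12_def agree_def entries_def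
  show ?thesis
  proof (rule derived_algebra_iso_formI[where G = ?G and s = ?s])
    show "vector_space ?t"
      by (intro prod_scale vec_space)
    show "agree 5 d (?G d)" if "?der d" for d
      using that assms(2-) by (rule derivation_matrix_form_5_12)
    show "?der (?G d)" for d
      using assms(2-) by (simp add: defs derivation_matrix_def)
    show "agree 5 (?G (?s (u + v))) (\<lambda>j i. ?G (?s u) j i + ?G (?s v) j i)" for u v
      by (simp add: defs algebra_simps)
    show "agree 5 (?G (?s (?t r u))) (\<lambda>j i. r * ?G (?s u) j i)" for r u
      by (simp add: defs algebra_simps)
    show "u = 0" if "agree 5 (?G (?s u)) (\<lambda>j i. 0)" for u
      using that by (simp add: defs prod_eq_iff vec_eq_iff forall_2 forall_3 forall_4)
    show "\<exists>u. agree 5 (?G (commutator 5 (?G d) (?G d'))) (?G (?s u))" for d d'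
    proof -
      define c where "c = commutator 5 (?G d) (?G d')"
      have "c 1 1 = 0"
        unfolding c_def by (simp_all add: commutator_form_5_12)
      then show ?thesis
        unfolding c_def[symmetric]
        by (intro exI[of _ "vector [c 5 1, c 5 2, c 5 4]"]) (simp add: defs)
    qed
    show "\<exists>L. agree 5 (?G (?s u)) (\<lambda>j i. \<Sum>(d, d')\<leftarrow>L. commutator 5 (?G d) (?G d') j i)" for u
      using two assms(2-)
      by (intro exI[of _ "[(entries [((1, 1), 1), ((2, 2), 1)],
        entries [((5, 1), u $ 1), ((5, 2), u $ 2 / 2), ((5, 4), u $ 3)])]"])
        (simp add: defs commutator_def)
  qed
qed

lemma derivation_brackets_5_12:
  fixes scale :: "'k::field \<Rightarrow> 'v::ab_group_add \<Rightarrow> 'v" and mult :: "'v \<Rightarrow> 'v \<Rightarrow> 'v"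
  assumes "comm_algebra scale mult" "CHAR('k) \<noteq> 2" "N_5_12 scale mult n e \<alpha> \<beta>"
    and f: "f \<in> derivations scale mult" "matrix_entries scale n e f d"
    and g: "g \<in> derivations scale mult" "matrix_entries scale n e g d'"
    and fg: "matrix_entries scale n e (bracket f g) c"
  shows "D_5_12 scale e c (bracket f g) \<and>
    c 1 1 = 0 \<and>
    c 5 1 = d' 5 1 * d 1 1 - d 5 1 * d' 1 1 \<and>
    c 5 2 = 2 * (d' 5 2 * d 1 1 - d 5 2 * d' 1 1) \<and>
    c 5 4 = d' 5 4 * d 1 1 - d 5 4 * d' 1 1 \<and>
    derived_algebra_iso scale mult ((*s) :: 'k \<Rightarrow> 'k ^ 3 \<Rightarrow> 'k ^ 3)"
proof -
  have n: "n = 5"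
    by (rule two_square_algebra_5_12(1)[OF assms(1-3)])
  have alg: "two_square_algebra scale mult 5 e (nth1 [1, 0, 0, \<alpha>, 0]) (nth1 [0, 1, - 1, \<beta>, 0])"
    by (rule two_square_algebra_5_12(2)[OF assms(1-3)])
  have nz: "\<alpha> \<noteq> 0 \<and> \<beta> \<noteq> 0"
    using assms(3) by (simp add: N_5_12_def)
  interpret two_square_algebra scale mult 5 e "nth1 [1, 0, 0, \<alpha>, 0]" "nth1 [0, 1, - 1, \<beta>, 0]"
      by (rule alg)
  note bracket = bracket_form[of "form_5_12",
      OF derivation_matrix_form_5_12[OF _ nz] f[unfolded n] g[unfolded n] fg[unfolded n]]
  have "c j i = commutator 5 (form_5_12 d) (form_5_12 d') j i" if "i \<in> {1..5}" "j \<in> {1..5}"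
      for i j
    using bracket(2) that by (simp add: agree_def)
  then show ?thesis
    using linear_map_form_5_12[OF vector_space_axioms bracket(1)] derived_algebra_5_12[OF alg nz] nz
    by (simp add: commutator_form_5_12)
qed

subsection \<open>The derivations of \<open>N_6_19\<close>\<close>

definition form_6_19 :: "'k::field \<Rightarrow> 'k \<Rightarrow> (nat \<Rightarrow> nat \<Rightarrow> 'k) \<Rightarrow> nat \<Rightarrow> nat \<Rightarrow> 'k" where
  "form_6_19 \<alpha> \<beta> d = column_matrix
     [[d 1 1, 0, 0, 0, 0, d 6 1],
      [0, d 2 2, 2 * d 1 1 - d 2 2, d 4 2, d 5 2, d 6 2],
      [0, 2 * d 1 1 - d 2 2, d 2 2, - d 4 2, - d 5 2, - d 6 2],
      [0, - (\<alpha> * d 4 2), - (\<alpha> * d 4 2), d 2 2, d 5 4, d 6 4],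
      [0, - (\<beta> * d 5 2), - (\<beta> * d 5 2), - (inverse \<alpha> * \<beta> * d 5 4), d 2 2, d 6 5],
      [0, 0, 0, 0, 0, 2 * d 2 2]]"

text \<open>
  Here \<open>e\<^sub>4\<close> and \<open>e\<^sub>5\<close> have proportional squares, so the Leibniz rule for this pair leaves one
  entry free: an infinitesimal rotation of the plane they span, for the form with diagonal
  \<open>\<alpha>, \<beta>\<close>.
\<close>

lemma derivation_matrix_form_6_19:
  assumes "derivation_matrix 6 (nth1 [1, 0, 0, 0, 0, 0]) (nth1 [0, 1, - 1, \<alpha>, \<beta>, 0]) d"
    and "\<alpha> \<noteq> 0 \<and> \<beta> \<noteq> 0"
  shows "agree 6 d (form_6_19 \<alpha> \<beta> d)"
proof -
  have "d 4 5 = - (inverse \<alpha> * \<beta> * d 5 4)"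
    using assms by (simp add: matrix_simps derivation_matrix_def add_eq_0_iff field_simps)
  then show ?thesis
    using assms middle_entries[OF assms(1)]
    by (simp add: matrix_simps form_6_19_def agree_def derivation_matrix_def add_eq_0_iff)
qed

lemma commutator_form_6_19:
  fixes d d' :: "nat \<Rightarrow> nat \<Rightarrow> 'k::field" and \<alpha> \<beta> :: 'k
  assumes "\<alpha> \<noteq> 0"
  defines "c \<equiv> commutator 6 (form_6_19 \<alpha> \<beta> d) (form_6_19 \<alpha> \<beta> d')"
  shows "c 1 1 = 0"
    "c 2 2 = 0"
    "c 5 4 = 0"
    "c 6 1 = (d' 1 1 * d 6 1 - d 1 1 * d' 6 1) + 2 * (d' 6 1 * d 2 2 - d 6 1 * d' 2 2)"
    "c 4 2 = (d' 2 2 * d 4 2 - d 2 2 * d' 4 2) + 2 * (d 1 1 * d' 4 2 - d' 1 1 * d 4 2)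
        - inverse \<alpha> * \<beta> * (d' 5 2 * d 5 4 - d 5 2 * d' 5 4)"
    "c 5 2 = (d' 4 2 * d 5 4 - d 4 2 * d' 5 4) + (d' 2 2 * d 5 2 - d 2 2 * d' 5 2) + 2 *
        (d 1 1 * d' 5 2 - d' 1 1 * d 5 2)"
    "c 6 2 = (d' 4 2 * d 6 4 - d 4 2 * d' 6 4) + (d' 5 2 * d 6 5 - d 5 2 * d' 6 5) + 2 *
        (d' 6 2 * d 1 1 - d 6 2 * d' 1 1)"
    "c 6 4 = (d' 6 4 * d 2 2 - d 6 4 * d' 2 2) + (d' 5 4 * d 6 5 - d 5 4 * d' 6 5)"
    "c 6 5 = - inverse \<alpha> * \<beta> * (d' 5 4 * d 6 4 - d 5 4 * d' 6 4) +
        (d' 6 5 * d 2 2 - d 6 5 * d' 2 2)"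
  using assms(1)
  by (simp_all add: matrix_simps form_6_19_def commutator_def c_def field_simps)

lemma linear_map_form_6_19:
  fixes scale :: "'k::field \<Rightarrow> 'v::ab_group_add \<Rightarrow> 'v"
  assumes "vector_space scale" "matrix_entries scale 6 e f (form_6_19 \<alpha> \<beta> c)"
  shows "D_6_19 scale e \<alpha> \<beta> c f"
proof -
  interpret vector_space scale by fact
  show ?thesis
    using assms(2)
    by (simp add: matrix_entries_def matrix_simps form_6_19_def D_6_19_def
        scale_right_distrib add.assoc)
qed

lemma two_square_algebra_6_19:
  fixes scale :: "'k::field \<Rightarrow> 'v::ab_group_add \<Rightarrow> 'v" and mult :: "'v \<Rightarrow> 'v \<Rightarrow> 'v"
  assumes "comm_algebra scale mult" "CHAR('k) \<noteq> 2" "N_6_19 scale mult n e \<alpha> \<beta>"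
  shows "n = 6" "two_square_algebra scale mult 6 e (nth1 [1, 0, 0, 0, 0, 0])
      (nth1 [0, 1, - 1, \<alpha>, \<beta>, 0])"
proof -
  interpret comm_algebra scale mult by fact
  show "n = 6" using assms(3) by (simp add: N_6_19_def)
  show "two_square_algebra scale mult 6 e (nth1 [1, 0, 0, 0, 0, 0]) (nth1 [0, 1, - 1, \<alpha>, \<beta>, 0])"
    using assms(2,3) by unfold_locales (auto simp: N_6_19_def normal_base_def matrix_simps)
qed

lemma derived_algebra_6_19:
  fixes scale :: "'k::field \<Rightarrow> 'v::ab_group_add \<Rightarrow> 'v" and mult :: "'v \<Rightarrow> 'v \<Rightarrow> 'v"
  assumes "two_square_algebra scale mult 6 e (nth1 [1, 0, 0, 0, 0, 0])
      (nth1 [0, 1, - 1, \<alpha>, \<beta>, 0])"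
    and "\<alpha> \<noteq> 0 \<and> \<beta> \<noteq> 0"
  shows "derived_algebra_iso scale mult (module_prod.scale ((*s) :: 'k \<Rightarrow> 'k ^ 2 \<Rightarrow> 'k ^ 2)
      ((*s) :: 'k \<Rightarrow> 'k ^ 4 \<Rightarrow> 'k ^ 4))"
proof -
  interpret two_square_algebra scale mult 6 e "nth1 [1, 0, 0, 0, 0, 0]"
      "nth1 [0, 1, - 1, \<alpha>, \<beta>, 0]" by fact
  let ?G = "form_6_19 \<alpha> \<beta>"
  let ?s = "\<lambda>u :: ('k ^ 2) \<times> ('k ^ 4). entries [((6, 1), fst u $ 1), ((4, 2), fst u $ 2),
      ((5, 2), snd u $ 1), ((6, 2), snd u $ 2), ((6, 4), snd u $ 3), ((6, 5), snd u $ 4)]"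
  let ?der = "derivation_matrix 6 (nth1 [1, 0, 0, 0, 0, 0]) (nth1 [0, 1, - 1, \<alpha>, \<beta>, 0])"
  let ?t = "(module_prod.scale ((*s) :: 'k \<Rightarrow> 'k ^ 2 \<Rightarrow> 'k ^ 2) ((*s) :: 'k \<Rightarrow> 'k ^ 4 \<Rightarrow> 'k ^ 4))"
  note defs = matrix_simps form_6_19_def agree_def entries_def
  show ?thesis
  proof (rule derived_algebra_iso_formI[where G = ?G and s = ?s])
    show "vector_space ?t"
      by (intro prod_scale vec_space)
    show "agree 6 d (?G d)" if "?der d" for d
      using that assms(2-) by (rule derivation_matrix_form_6_19)
    show "?der (?G d)" for d
      using assms(2-) by (simp add: defs derivation_matrix_def)
    show "agree 6 (?G (?s (u + v))) (\<lambda>j i. ?G (?s u) j i + ?G (?s v) j i)" for u v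
      by (simp add: defs algebra_simps)
    show "agree 6 (?G (?s (?t r u))) (\<lambda>j i. r * ?G (?s u) j i)" for r u
      by (simp add: defs prod_scale vec_space algebra_simps)
    show "u = 0" if "agree 6 (?G (?s u)) (\<lambda>j i. 0)" for u
      using that by (simp add: defs prod_eq_iff vec_eq_iff forall_2 forall_3 forall_4)
    show "\<exists>u. agree 6 (?G (commutator 6 (?G d) (?G d'))) (?G (?s u))" for d d'
    proof -
      define c where "c = commutator 6 (?G d) (?G d')"
      have "c 1 1 = 0" "c 2 2 = 0" "c 5 4 = 0"
        unfolding c_def by (simp_all add: commutator_form_6_19[OF conjunct1[OF assms(2)]])
      then show ?thesis
        unfolding c_def[symmetric]
        by (intro exI[of _ "(vector [c 6 1, c 4 2], vector [c 5 2, c 6 2, c 6 4, c 6 5])"])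
            (simp add: defs)
    qed
    show "\<exists>L. agree 6 (?G (?s u)) (\<lambda>j i. \<Sum>(d, d')\<leftarrow>L. commutator 6 (?G d) (?G d') j i)" for u
      using two assms(2-)
      by (intro exI[of _ "[(entries [((1, 1), 1), ((2, 2), 1)],
        entries [((6, 1), fst u $ 1), ((4, 2), fst u $ 2), ((5, 2), snd u $ 1),
            ((6, 2), snd u $ 2 / 2), ((6, 4), snd u $ 3), ((6, 5), snd u $ 4)])]"])
        (simp add: defs commutator_def)
  qed
qed

lemma derivation_brackets_6_19:
  fixes scale :: "'k::field \<Rightarrow> 'v::ab_group_add \<Rightarrow> 'v" and mult :: "'v \<Rightarrow> 'v \<Rightarrow> 'v"
  assumes "comm_algebra scale mult" "CHAR('k) \<noteq> 2" "N_6_19 scale mult n e \<alpha> \<beta>"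
    and f: "f \<in> derivations scale mult" "matrix_entries scale n e f d"
    and g: "g \<in> derivations scale mult" "matrix_entries scale n e g d'"
    and fg: "matrix_entries scale n e (bracket f g) c"
  shows "D_6_19 scale e \<alpha> \<beta> c (bracket f g) \<and>
    c 1 1 = 0 \<and> c 2 2 = 0 \<and> c 5 4 = 0 \<and>
    c 6 1 = (d' 1 1 * d 6 1 - d 1 1 * d' 6 1) + 2 * (d' 6 1 * d 2 2 - d 6 1 * d' 2 2) \<and>
    c 4 2 = (d' 2 2 * d 4 2 - d 2 2 * d' 4 2) + 2 * (d 1 1 * d' 4 2 - d' 1 1 * d 4 2)
        - inverse \<alpha> * \<beta> * (d' 5 2 * d 5 4 - d 5 2 * d' 5 4) \<and>
    c 5 2 = (d' 4 2 * d 5 4 - d 4 2 * d' 5 4) + (d' 2 2 * d 5 2 - d 2 2 * d' 5 2) + 2 *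
        (d 1 1 * d' 5 2 - d' 1 1 * d 5 2) \<and>
    c 6 2 = (d' 4 2 * d 6 4 - d 4 2 * d' 6 4) + (d' 5 2 * d 6 5 - d 5 2 * d' 6 5) + 2 *
        (d' 6 2 * d 1 1 - d 6 2 * d' 1 1) \<and>
    c 6 4 = (d' 6 4 * d 2 2 - d 6 4 * d' 2 2) + (d' 5 4 * d 6 5 - d 5 4 * d' 6 5) \<and>
    c 6 5 = - inverse \<alpha> * \<beta> * (d' 5 4 * d 6 4 - d 5 4 * d' 6 4) +
        (d' 6 5 * d 2 2 - d 6 5 * d' 2 2) \<and>
    derived_algebra_iso scale mult (module_prod.scale ((*s) :: 'k \<Rightarrow> 'k ^ 2 \<Rightarrow> 'k ^ 2)
        ((*s) :: 'k \<Rightarrow> 'k ^ 4 \<Rightarrow> 'k ^ 4))"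
proof -
  have n: "n = 6"
    by (rule two_square_algebra_6_19(1)[OF assms(1-3)])
  have alg: "two_square_algebra scale mult 6 e (nth1 [1, 0, 0, 0, 0, 0])
      (nth1 [0, 1, - 1, \<alpha>, \<beta>, 0])"
    by (rule two_square_algebra_6_19(2)[OF assms(1-3)])
  have nz: "\<alpha> \<noteq> 0 \<and> \<beta> \<noteq> 0"
    using assms(3) by (simp add: N_6_19_def)
  interpret two_square_algebra scale mult 6 e "nth1 [1, 0, 0, 0, 0, 0]"
      "nth1 [0, 1, - 1, \<alpha>, \<beta>, 0]" by (rule alg)
  note bracket = bracket_form[of "form_6_19 \<alpha> \<beta>",
      OF derivation_matrix_form_6_19[OF _ nz] f[unfolded n] g[unfolded n] fg[unfolded n]]
  have "c j i = commutator 6 (form_6_19 \<alpha> \<beta> d) (form_6_19 \<alpha> \<beta> d') j i" if "i \<in> {1..6}"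
      "j \<in> {1..6}" for i j
    using bracket(2) that by (simp add: agree_def)
  then show ?thesis
    using linear_map_form_6_19[OF vector_space_axioms bracket(1)] derived_algebra_6_19[OF alg nz] nz
    by (simp add: commutator_form_6_19)
qed

subsection \<open>The derivations of \<open>N_6_20\<close>\<close>

definition form_6_20 :: "'k::field \<Rightarrow> 'k \<Rightarrow> (nat \<Rightarrow> nat \<Rightarrow> 'k) \<Rightarrow> nat \<Rightarrow> nat \<Rightarrow> 'k" where
  "form_6_20 \<alpha> \<beta> d = column_matrix
     [[d 1 1, 0, 0, d 4 1, 0, d 6 1],
      [0, d 2 2, 2 * d 1 1 - d 2 2, 0, d 5 2, d 6 2],
      [0, 2 * d 1 1 - d 2 2, d 2 2, 0, - d 5 2, - d 6 2],
      [- (\<alpha> * d 4 1), 0, 0, d 1 1, 0, d 6 4],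
      [0, - (\<beta> * d 5 2), - (\<beta> * d 5 2), 0, d 2 2, d 6 5],
      [0, 0, 0, 0, 0, 2 * d 2 2]]"

lemma derivation_matrix_form_6_20:
  assumes "derivation_matrix 6 (nth1 [1, 0, 0, \<alpha>, 0, 0]) (nth1 [0, 1, - 1, 0, \<beta>, 0]) d"
    and "\<alpha> \<noteq> 0 \<and> \<beta> \<noteq> 0"
  shows "agree 6 d (form_6_20 \<alpha> \<beta> d)"
  using assms middle_entries[OF assms(1)]
  by (auto simp: matrix_simps form_6_20_def agree_def derivation_matrix_def add_eq_0_iff)

lemma commutator_form_6_20:
  fixes d d' :: "nat \<Rightarrow> nat \<Rightarrow> 'k::field" and \<alpha> \<beta> :: 'k
  defines "c \<equiv> commutator 6 (form_6_20 \<alpha> \<beta> d) (form_6_20 \<alpha> \<beta> d')"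
  shows "c 1 1 = 0"
    "c 4 1 = 0"
    "c 2 2 = 0"
    "c 6 1 = (d' 1 1 * d 6 1 - d 1 1 * d' 6 1) + (d' 4 1 * d 6 4 - d 4 1 * d' 6 4) + 2 *
        (d' 6 1 * d 2 2 - d 6 1 * d' 2 2)"
    "c 5 2 = (d' 2 2 * d 5 2 - d 2 2 * d' 5 2) + 2 * (d 1 1 * d' 5 2 - d' 1 1 * d 5 2)"
    "c 6 2 = (d' 5 2 * d 6 5 - d 5 2 * d' 6 5) + 2 * (d 1 1 * d' 6 2 - d' 1 1 * d 6 2)"
    "c 6 4 = - \<alpha> * (d' 4 1 * d 6 1 - d 4 1 * d' 6 1) + (d' 1 1 * d 6 4 - d 1 1 * d' 6 4) + 2 *
        (d' 6 4 * d 2 2 - d 6 4 * d' 2 2)"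
    "c 6 5 = d' 6 5 * d 2 2 - d 6 5 * d' 2 2"
  by (simp_all add: matrix_simps form_6_20_def commutator_def c_def field_simps)

lemma linear_map_form_6_20:
  fixes scale :: "'k::field \<Rightarrow> 'v::ab_group_add \<Rightarrow> 'v"
  assumes "vector_space scale" "matrix_entries scale 6 e f (form_6_20 \<alpha> \<beta> c)"
  shows "D_6_20 scale e \<alpha> \<beta> c f"
proof -
  interpret vector_space scale by fact
  show ?thesis
    using assms(2)
    by (simp add: matrix_entries_def matrix_simps form_6_20_def D_6_20_def
        scale_right_distrib add.assoc)
qed

lemma two_square_algebra_6_20:
  fixes scale :: "'k::field \<Rightarrow> 'v::ab_group_add \<Rightarrow> 'v" and mult :: "'v \<Rightarrow> 'v \<Rightarrow> 'v"
  assumes "comm_algebra scale mult" "CHAR('k) \<noteq> 2" "N_6_20 scale mult n e \<alpha> \<beta>"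
  shows "n = 6" "two_square_algebra scale mult 6 e (nth1 [1, 0, 0, \<alpha>, 0, 0])
      (nth1 [0, 1, - 1, 0, \<beta>, 0])"
proof -
  interpret comm_algebra scale mult by fact
  show "n = 6" using assms(3) by (simp add: N_6_20_def)
  show "two_square_algebra scale mult 6 e (nth1 [1, 0, 0, \<alpha>, 0, 0]) (nth1 [0, 1, - 1, 0, \<beta>, 0])"
    using assms(2,3) by unfold_locales (auto simp: N_6_20_def normal_base_def matrix_simps)
qed

lemma derived_algebra_6_20:
  fixes scale :: "'k::field \<Rightarrow> 'v::ab_group_add \<Rightarrow> 'v" and mult :: "'v \<Rightarrow> 'v \<Rightarrow> 'v"
  assumes "two_square_algebra scale mult 6 e (nth1 [1, 0, 0, \<alpha>, 0, 0])
      (nth1 [0, 1, - 1, 0, \<beta>, 0])"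
    and "\<alpha> \<noteq> 0 \<and> \<beta> \<noteq> 0"
  shows "derived_algebra_iso scale mult (module_prod.scale ((*) :: 'k \<Rightarrow> 'k \<Rightarrow> 'k)
      ((*s) :: 'k \<Rightarrow> 'k ^ 4 \<Rightarrow> 'k ^ 4))"
proof -
  interpret two_square_algebra scale mult 6 e "nth1 [1, 0, 0, \<alpha>, 0, 0]"
      "nth1 [0, 1, - 1, 0, \<beta>, 0]" by fact
  let ?G = "form_6_20 \<alpha> \<beta>"
  let ?s = "\<lambda>u :: 'k \<times> ('k ^ 4). entries [((6, 1), fst u), ((5, 2), snd u $ 1),
      ((6, 2), snd u $ 2), ((6, 4), snd u $ 3), ((6, 5), snd u $ 4)]"
  let ?der = "derivation_matrix 6 (nth1 [1, 0, 0, \<alpha>, 0, 0]) (nth1 [0, 1, - 1, 0, \<beta>, 0])"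
  let ?t = "(module_prod.scale ((*) :: 'k \<Rightarrow> 'k \<Rightarrow> 'k) ((*s) :: 'k \<Rightarrow> 'k ^ 4 \<Rightarrow> 'k ^ 4))"
  note defs = matrix_simps form_6_20_def agree_def entries_def
  show ?thesis
  proof (rule derived_algebra_iso_formI[where G = ?G and s = ?s])
    show "vector_space ?t"
      by (intro prod_scale vec_space)
    show "agree 6 d (?G d)" if "?der d" for d
      using that assms(2-) by (rule derivation_matrix_form_6_20)
    show "?der (?G d)" for d
      using assms(2-) by (simp add: defs derivation_matrix_def)
    show "agree 6 (?G (?s (u + v))) (\<lambda>j i. ?G (?s u) j i + ?G (?s v) j i)" for u v
      by (simp add: defs algebra_simps)
    show "agree 6 (?G (?s (?t r u))) (\<lambda>j i. r * ?G (?s u) j i)" for r u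
      by (simp add: defs prod_scale vec_space algebra_simps)
    show "u = 0" if "agree 6 (?G (?s u)) (\<lambda>j i. 0)" for u
      using that by (simp add: defs prod_eq_iff vec_eq_iff forall_2 forall_3 forall_4)
    show "\<exists>u. agree 6 (?G (commutator 6 (?G d) (?G d'))) (?G (?s u))" for d d'
    proof -
      define c where "c = commutator 6 (?G d) (?G d')"
      have "c 1 1 = 0" "c 4 1 = 0" "c 2 2 = 0"
        unfolding c_def by (simp_all add: commutator_form_6_20)
      then show ?thesis
        unfolding c_def[symmetric]
        by (intro exI[of _ "(c 6 1, vector [c 5 2, c 6 2, c 6 4, c 6 5])"]) (simp add: defs)
    qed
    show "\<exists>L. agree 6 (?G (?s u)) (\<lambda>j i. \<Sum>(d, d')\<leftarrow>L. commutator 6 (?G d) (?G d') j i)" for u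
      using two assms(2-)
      by (intro exI[of _ "[(entries [((1, 1), 1), ((2, 2), 1)],
        entries [((6, 1), fst u), ((5, 2), snd u $ 1), ((6, 2), snd u $ 2 / 2),
            ((6, 4), snd u $ 3), ((6, 5), snd u $ 4)])]"])
        (simp add: defs commutator_def)
  qed
qed

lemma derivation_brackets_6_20:
  fixes scale :: "'k::field \<Rightarrow> 'v::ab_group_add \<Rightarrow> 'v" and mult :: "'v \<Rightarrow> 'v \<Rightarrow> 'v"
  assumes "comm_algebra scale mult" "CHAR('k) \<noteq> 2" "N_6_20 scale mult n e \<alpha> \<beta>"
    and f: "f \<in> derivations scale mult" "matrix_entries scale n e f d"
    and g: "g \<in> derivations scale mult" "matrix_entries scale n e g d'"
    and fg: "matrix_entries scale n e (bracket f g) c"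
  shows "D_6_20 scale e \<alpha> \<beta> c (bracket f g) \<and>
    c 1 1 = 0 \<and> c 4 1 = 0 \<and> c 2 2 = 0 \<and>
    c 6 1 = (d' 1 1 * d 6 1 - d 1 1 * d' 6 1) + (d' 4 1 * d 6 4 - d 4 1 * d' 6 4) + 2 *
        (d' 6 1 * d 2 2 - d 6 1 * d' 2 2) \<and>
    c 5 2 = (d' 2 2 * d 5 2 - d 2 2 * d' 5 2) + 2 * (d 1 1 * d' 5 2 - d' 1 1 * d 5 2) \<and>
    c 6 2 = (d' 5 2 * d 6 5 - d 5 2 * d' 6 5) + 2 * (d 1 1 * d' 6 2 - d' 1 1 * d 6 2) \<and>
    c 6 4 = - \<alpha> * (d' 4 1 * d 6 1 - d 4 1 * d' 6 1) + (d' 1 1 * d 6 4 - d 1 1 * d' 6 4) + 2 *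
        (d' 6 4 * d 2 2 - d 6 4 * d' 2 2) \<and>
    c 6 5 = d' 6 5 * d 2 2 - d 6 5 * d' 2 2 \<and>
    derived_algebra_iso scale mult (module_prod.scale ((*) :: 'k \<Rightarrow> 'k \<Rightarrow> 'k)
        ((*s) :: 'k \<Rightarrow> 'k ^ 4 \<Rightarrow> 'k ^ 4))"
proof -
  have n: "n = 6"
    by (rule two_square_algebra_6_20(1)[OF assms(1-3)])
  have alg: "two_square_algebra scale mult 6 e (nth1 [1, 0, 0, \<alpha>, 0, 0])
      (nth1 [0, 1, - 1, 0, \<beta>, 0])"
    by (rule two_square_algebra_6_20(2)[OF assms(1-3)])
  have nz: "\<alpha> \<noteq> 0 \<and> \<beta> \<noteq> 0"
    using assms(3) by (simp add: N_6_20_def)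
  interpret two_square_algebra scale mult 6 e "nth1 [1, 0, 0, \<alpha>, 0, 0]"
      "nth1 [0, 1, - 1, 0, \<beta>, 0]" by (rule alg)
  note bracket = bracket_form[of "form_6_20 \<alpha> \<beta>",
      OF derivation_matrix_form_6_20[OF _ nz] f[unfolded n] g[unfolded n] fg[unfolded n]]
  have "c j i = commutator 6 (form_6_20 \<alpha> \<beta> d) (form_6_20 \<alpha> \<beta> d') j i" if "i \<in> {1..6}"
      "j \<in> {1..6}" for i j
    using bracket(2) that by (simp add: agree_def)
  then show ?thesis
    using linear_map_form_6_20[OF vector_space_axioms bracket(1)] derived_algebra_6_20[OF alg nz] nz
    by (simp add: commutator_form_6_20)
qed

subsection \<open>The derivations of \<open>N_6_21\<close>\<close>

definition form_6_21 :: "'k::field \<Rightarrow> (nat \<Rightarrow> nat \<Rightarrow> 'k) \<Rightarrow> nat \<Rightarrow> nat \<Rightarrow> 'k" where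
  "form_6_21 \<gamma> d = column_matrix
     [[d 1 1, 0, 0, 0, 0, d 6 1],
      [0, d 1 1, d 1 1, 0, d 5 2, d 6 2],
      [0, d 1 1, d 1 1, 0, - d 5 2, - d 6 2],
      [0, 0, 0, d 1 1, 0, d 6 4],
      [0, - (\<gamma> * d 5 2), - (\<gamma> * d 5 2), 0, d 1 1, d 6 5],
      [0, 0, 0, 0, 0, 2 * d 1 1]]"

lemma derivation_matrix_form_6_21:
  assumes "derivation_matrix 6 (nth1 [1, 0, 0, \<alpha>, 0, 0]) (nth1 [0, 1, - 1, \<beta>, \<gamma>, 0]) d"
    and "\<alpha> \<noteq> 0 \<and> \<beta> \<noteq> 0 \<and> \<gamma> \<noteq> 0"
  shows "agree 6 d (form_6_21 \<gamma> d)"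
  using assms middle_entries[OF assms(1)] scalar_entries_eq[OF assms(1), of 4]
  by (auto simp: matrix_simps form_6_21_def agree_def derivation_matrix_def add_eq_0_iff)

lemma commutator_form_6_21:
  fixes d d' :: "nat \<Rightarrow> nat \<Rightarrow> 'k::field" and \<gamma> :: 'k
  defines "c \<equiv> commutator 6 (form_6_21 \<gamma> d) (form_6_21 \<gamma> d')"
  shows "c 1 1 = 0"
    "c 6 1 = d' 6 1 * d 1 1 - d 6 1 * d' 1 1"
    "c 5 2 = d' 5 2 * d 1 1 - d 5 2 * d' 1 1"
    "c 6 2 = (d' 5 2 * d 6 5 - d 5 2 * d' 6 5) + 2 * (d' 6 2 * d 1 1 - d 6 2 * d' 1 1)"
    "c 6 4 = d' 6 4 * d 1 1 - d 6 4 * d' 1 1"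
    "c 6 5 = d' 6 5 * d 1 1 - d 6 5 * d' 1 1"
  by (simp_all add: matrix_simps form_6_21_def commutator_def c_def field_simps)

lemma linear_map_form_6_21:
  fixes scale :: "'k::field \<Rightarrow> 'v::ab_group_add \<Rightarrow> 'v"
  assumes "vector_space scale" "matrix_entries scale 6 e f (form_6_21 \<gamma> c)"
  shows "D_6_21 scale e \<gamma> c f"
proof -
  interpret vector_space scale by fact
  show ?thesis
    using assms(2)
    by (simp add: matrix_entries_def matrix_simps form_6_21_def D_6_21_def
        scale_right_distrib add.assoc)
qed

lemma two_square_algebra_6_21:
  fixes scale :: "'k::field \<Rightarrow> 'v::ab_group_add \<Rightarrow> 'v" and mult :: "'v \<Rightarrow> 'v \<Rightarrow> 'v"
  assumes "comm_algebra scale mult" "CHAR('k) \<noteq> 2" "N_6_21 scale mult n e \<alpha> \<beta> \<gamma>"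
  shows "n = 6" "two_square_algebra scale mult 6 e (nth1 [1, 0, 0, \<alpha>, 0, 0])
      (nth1 [0, 1, - 1, \<beta>, \<gamma>, 0])"
proof -
  interpret comm_algebra scale mult by fact
  show "n = 6" using assms(3) by (simp add: N_6_21_def)
  show "two_square_algebra scale mult 6 e (nth1 [1, 0, 0, \<alpha>, 0, 0]) (nth1 [0, 1, - 1, \<beta>, \<gamma>, 0])"
    using assms(2,3) by unfold_locales (auto simp: N_6_21_def normal_base_def matrix_simps)
qed

lemma derived_algebra_6_21:
  fixes scale :: "'k::field \<Rightarrow> 'v::ab_group_add \<Rightarrow> 'v" and mult :: "'v \<Rightarrow> 'v \<Rightarrow> 'v"
  assumes "two_square_algebra scale mult 6 e (nth1 [1, 0, 0, \<alpha>, 0, 0])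
      (nth1 [0, 1, - 1, \<beta>, \<gamma>, 0])"
    and "\<alpha> \<noteq> 0 \<and> \<beta> \<noteq> 0 \<and> \<gamma> \<noteq> 0"
  shows "derived_algebra_iso scale mult (module_prod.scale ((*) :: 'k \<Rightarrow> 'k \<Rightarrow> 'k)
      ((*s) :: 'k \<Rightarrow> 'k ^ 4 \<Rightarrow> 'k ^ 4))"
proof -
  interpret two_square_algebra scale mult 6 e "nth1 [1, 0, 0, \<alpha>, 0, 0]"
      "nth1 [0, 1, - 1, \<beta>, \<gamma>, 0]" by fact
  let ?G = "form_6_21 \<gamma>"
  let ?s = "\<lambda>u :: 'k \<times> ('k ^ 4). entries [((6, 1), fst u), ((5, 2), snd u $ 1),
      ((6, 2), snd u $ 2), ((6, 4), snd u $ 3), ((6, 5), snd u $ 4)]"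
  let ?der = "derivation_matrix 6 (nth1 [1, 0, 0, \<alpha>, 0, 0]) (nth1 [0, 1, - 1, \<beta>, \<gamma>, 0])"
  let ?t = "(module_prod.scale ((*) :: 'k \<Rightarrow> 'k \<Rightarrow> 'k) ((*s) :: 'k \<Rightarrow> 'k ^ 4 \<Rightarrow> 'k ^ 4))"
  note defs = matrix_simps form_6_21_def agree_def entries_def
  show ?thesis
  proof (rule derived_algebra_iso_formI[where G = ?G and s = ?s])
    show "vector_space ?t"
      by (intro prod_scale vec_space)
    show "agree 6 d (?G d)" if "?der d" for d
      using that assms(2-) by (rule derivation_matrix_form_6_21)
    show "?der (?G d)" for d
      using assms(2-) by (simp add: defs derivation_matrix_def)
    show "agree 6 (?G (?s (u + v))) (\<lambda>j i. ?G (?s u) j i + ?G (?s v) j i)" for u v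
      by (simp add: defs algebra_simps)
    show "agree 6 (?G (?s (?t r u))) (\<lambda>j i. r * ?G (?s u) j i)" for r u
      by (simp add: defs prod_scale vec_space algebra_simps)
    show "u = 0" if "agree 6 (?G (?s u)) (\<lambda>j i. 0)" for u
      using that by (simp add: defs prod_eq_iff vec_eq_iff forall_2 forall_3 forall_4)
    show "\<exists>u. agree 6 (?G (commutator 6 (?G d) (?G d'))) (?G (?s u))" for d d'
    proof -
      define c where "c = commutator 6 (?G d) (?G d')"
      have "c 1 1 = 0"
        unfolding c_def by (simp_all add: commutator_form_6_21)
      then show ?thesis
        unfolding c_def[symmetric]
        by (intro exI[of _ "(c 6 1, vector [c 5 2, c 6 2, c 6 4, c 6 5])"]) (simp add: defs)
    qed
    show "\<exists>L. agree 6 (?G (?s u)) (\<lambda>j i. \<Sum>(d, d')\<leftarrow>L. commutator 6 (?G d) (?G d') j i)" for u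
      using two assms(2-)
      by (intro exI[of _ "[(entries [((1, 1), 1), ((2, 2), 1)],
        entries [((6, 1), fst u), ((5, 2), snd u $ 1), ((6, 2), snd u $ 2 / 2),
            ((6, 4), snd u $ 3), ((6, 5), snd u $ 4)])]"])
        (simp add: defs commutator_def)
  qed
qed

lemma derivation_brackets_6_21:
  fixes scale :: "'k::field \<Rightarrow> 'v::ab_group_add \<Rightarrow> 'v" and mult :: "'v \<Rightarrow> 'v \<Rightarrow> 'v"
  assumes "comm_algebra scale mult" "CHAR('k) \<noteq> 2" "N_6_21 scale mult n e \<alpha> \<beta> \<gamma>"
    and f: "f \<in> derivations scale mult" "matrix_entries scale n e f d"
    and g: "g \<in> derivations scale mult" "matrix_entries scale n e g d'"
    and fg: "matrix_entries scale n e (bracket f g) c"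
  shows "D_6_21 scale e \<gamma> c (bracket f g) \<and>
    c 1 1 = 0 \<and>
    c 6 1 = d' 6 1 * d 1 1 - d 6 1 * d' 1 1 \<and>
    c 5 2 = d' 5 2 * d 1 1 - d 5 2 * d' 1 1 \<and>
    c 6 2 = (d' 5 2 * d 6 5 - d 5 2 * d' 6 5) + 2 * (d' 6 2 * d 1 1 - d 6 2 * d' 1 1) \<and>
    c 6 4 = d' 6 4 * d 1 1 - d 6 4 * d' 1 1 \<and>
    c 6 5 = d' 6 5 * d 1 1 - d 6 5 * d' 1 1 \<and>
    derived_algebra_iso scale mult (module_prod.scale ((*) :: 'k \<Rightarrow> 'k \<Rightarrow> 'k)
        ((*s) :: 'k \<Rightarrow> 'k ^ 4 \<Rightarrow> 'k ^ 4))"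
proof -
  have n: "n = 6"
    by (rule two_square_algebra_6_21(1)[OF assms(1-3)])
  have alg: "two_square_algebra scale mult 6 e (nth1 [1, 0, 0, \<alpha>, 0, 0])
      (nth1 [0, 1, - 1, \<beta>, \<gamma>, 0])"
    by (rule two_square_algebra_6_21(2)[OF assms(1-3)])
  have nz: "\<alpha> \<noteq> 0 \<and> \<beta> \<noteq> 0 \<and> \<gamma> \<noteq> 0"
    using assms(3) by (simp add: N_6_21_def)
  interpret two_square_algebra scale mult 6 e "nth1 [1, 0, 0, \<alpha>, 0, 0]"
      "nth1 [0, 1, - 1, \<beta>, \<gamma>, 0]" by (rule alg)
  note bracket = bracket_form[of "form_6_21 \<gamma>",
      OF derivation_matrix_form_6_21[OF _ nz] f[unfolded n] g[unfolded n] fg[unfolded n]]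
  have "c j i = commutator 6 (form_6_21 \<gamma> d) (form_6_21 \<gamma> d') j i" if "i \<in> {1..6}" "j \<in> {1..6}"
      for i j
    using bracket(2) that by (simp add: agree_def)
  then show ?thesis
    using linear_map_form_6_21[OF vector_space_axioms bracket(1)] derived_algebra_6_21[OF alg nz] nz
    by (simp add: commutator_form_6_21)
qed

subsection \<open>The derivations of \<open>N_6_22\<close>\<close>

definition form_6_22 :: "'k::field \<Rightarrow> 'k \<Rightarrow> (nat \<Rightarrow> nat \<Rightarrow> 'k) \<Rightarrow> nat \<Rightarrow> nat \<Rightarrow> 'k" where
  "form_6_22 \<alpha> \<beta> d = column_matrix
     [[d 1 1, 0, 0, d 4 1, d 5 1, d 6 1],
      [0, d 2 2, 2 * d 1 1 - d 2 2, 0, 0, d 6 2],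
      [0, 2 * d 1 1 - d 2 2, d 2 2, 0, 0, - d 6 2],
      [- (\<alpha> * d 4 1), 0, 0, d 1 1, d 5 4, d 6 4],
      [- (\<beta> * d 5 1), 0, 0, - (inverse \<alpha> * \<beta> * d 5 4), d 1 1, d 6 5],
      [0, 0, 0, 0, 0, 2 * d 2 2]]"

lemma derivation_matrix_form_6_22:
  assumes "derivation_matrix 6 (nth1 [1, 0, 0, \<alpha>, \<beta>, 0]) (nth1 [0, 1, - 1, 0, 0, 0]) d"
    and "\<alpha> \<noteq> 0 \<and> \<beta> \<noteq> 0"
  shows "agree 6 d (form_6_22 \<alpha> \<beta> d)"
proof -
  have "d 4 5 = - (inverse \<alpha> * \<beta> * d 5 4)"
    using assms by (simp add: matrix_simps derivation_matrix_def add_eq_0_iff field_simps)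
  then show ?thesis
    using assms middle_entries[OF assms(1)]
    by (simp add: matrix_simps form_6_22_def agree_def derivation_matrix_def add_eq_0_iff)
qed

lemma commutator_form_6_22:
  fixes d d' :: "nat \<Rightarrow> nat \<Rightarrow> 'k::field" and \<alpha> \<beta> :: 'k
  assumes "\<alpha> \<noteq> 0"
  defines "c \<equiv> commutator 6 (form_6_22 \<alpha> \<beta> d) (form_6_22 \<alpha> \<beta> d')"
  shows "c 1 1 = 0"
    "c 2 2 = 0"
    "c 4 1 = inverse \<alpha> * \<beta> * (d 5 1 * d' 5 4 - d' 5 1 * d 5 4)"
    "c 5 1 = d' 4 1 * d 5 4 - d 4 1 * d' 5 4"
    "c 6 1 = (d' 1 1 * d 6 1 - d 1 1 * d' 6 1) + (d' 4 1 * d 6 4 - d 4 1 * d' 6 4) +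
        (d' 5 1 * d 6 5 - d 5 1 * d' 6 5) + 2 * (d' 6 1 * d 2 2 - d 6 1 * d' 2 2)"
    "c 6 2 = 2 * (d 1 1 * d' 6 2 - d' 1 1 * d 6 2)"
    "c 5 4 = \<alpha> * (d 4 1 * d' 5 1 - d' 4 1 * d 5 1)"
    "c 6 4 = (d' 1 1 * d 6 4 - d 1 1 * d' 6 4) + 2 * (d' 6 4 * d 2 2 - d 6 4 * d' 2 2) +
        (d' 5 4 * d 6 5 - d 5 4 * d' 6 5) + \<alpha> * (d 4 1 * d' 6 1 - d' 4 1 * d 6 1)"
    "c 6 5 = - \<beta> * (d' 5 1 * d 6 1 - d 5 1 * d' 6 1) - inverse \<alpha> * \<beta> *
        (d' 5 4 * d 6 4 - d 5 4 * d' 6 4) + (d' 1 1 * d 6 5 - d 1 1 * d' 6 5) + 2 *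
        (d' 6 5 * d 2 2 - d 6 5 * d' 2 2)"
  using assms(1)
  by (simp_all add: matrix_simps form_6_22_def commutator_def c_def field_simps)

lemma linear_map_form_6_22:
  fixes scale :: "'k::field \<Rightarrow> 'v::ab_group_add \<Rightarrow> 'v"
  assumes "vector_space scale" "matrix_entries scale 6 e f (form_6_22 \<alpha> \<beta> c)"
  shows "D_6_22 scale e \<alpha> \<beta> c f"
proof -
  interpret vector_space scale by fact
  show ?thesis
    using assms(2)
    by (simp add: matrix_entries_def matrix_simps form_6_22_def D_6_22_def
        scale_right_distrib add.assoc)
qed

lemma two_square_algebra_6_22:
  fixes scale :: "'k::field \<Rightarrow> 'v::ab_group_add \<Rightarrow> 'v" and mult :: "'v \<Rightarrow> 'v \<Rightarrow> 'v"
  assumes "comm_algebra scale mult" "CHAR('k) \<noteq> 2" "N_6_22 scale mult n e \<alpha> \<beta>"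
  shows "n = 6" "two_square_algebra scale mult 6 e (nth1 [1, 0, 0, \<alpha>, \<beta>, 0])
      (nth1 [0, 1, - 1, 0, 0, 0])"
proof -
  interpret comm_algebra scale mult by fact
  show "n = 6" using assms(3) by (simp add: N_6_22_def)
  show "two_square_algebra scale mult 6 e (nth1 [1, 0, 0, \<alpha>, \<beta>, 0]) (nth1 [0, 1, - 1, 0, 0, 0])"
    using assms(2,3) by unfold_locales (auto simp: N_6_22_def normal_base_def matrix_simps)
qed

text \<open>
  The squares of \<open>e\<^sub>1\<close>, \<open>e\<^sub>4\<close>, \<open>e\<^sub>5\<close> are nonzero multiples of one vector, and the entries
  \<open>(4, 1)\<close>, \<open>(5, 1)\<close>, \<open>(5, 4)\<close> describe the infinitesimal rotations of the space they span. This
  three-dimensional Lie algebra is perfect, so these entries survive in the derived algebra although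
  the grading derivation commutes with them.
\<close>

lemma derived_algebra_6_22:
  fixes scale :: "'k::field \<Rightarrow> 'v::ab_group_add \<Rightarrow> 'v" and mult :: "'v \<Rightarrow> 'v \<Rightarrow> 'v"
  assumes "two_square_algebra scale mult 6 e (nth1 [1, 0, 0, \<alpha>, \<beta>, 0])
      (nth1 [0, 1, - 1, 0, 0, 0])"
    and "\<alpha> \<noteq> 0 \<and> \<beta> \<noteq> 0"
  shows "derived_algebra_iso scale mult (module_prod.scale ((*s) :: 'k \<Rightarrow> 'k ^ 3 \<Rightarrow> 'k ^ 3)
      ((*s) :: 'k \<Rightarrow> 'k ^ 4 \<Rightarrow> 'k ^ 4))"
proof -
  interpret two_square_algebra scale mult 6 e "nth1 [1, 0, 0, \<alpha>, \<beta>, 0]"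
      "nth1 [0, 1, - 1, 0, 0, 0]" by fact
  let ?G = "form_6_22 \<alpha> \<beta>"
  let ?s = "\<lambda>u :: ('k ^ 3) \<times> ('k ^ 4). entries [((4, 1), fst u $ 1), ((5, 1), fst u $ 2),
      ((5, 4), fst u $ 3), ((6, 1), snd u $ 1), ((6, 2), snd u $ 2), ((6, 4), snd u $ 3),
      ((6, 5), snd u $ 4)]"
  let ?der = "derivation_matrix 6 (nth1 [1, 0, 0, \<alpha>, \<beta>, 0]) (nth1 [0, 1, - 1, 0, 0, 0])"
  let ?t = "(module_prod.scale ((*s) :: 'k \<Rightarrow> 'k ^ 3 \<Rightarrow> 'k ^ 3) ((*s) :: 'k \<Rightarrow> 'k ^ 4 \<Rightarrow> 'k ^ 4))"
  note defs = matrix_simps form_6_22_def agree_def entries_def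
  show ?thesis
  proof (rule derived_algebra_iso_formI[where G = ?G and s = ?s])
    show "vector_space ?t"
      by (intro prod_scale vec_space)
    show "agree 6 d (?G d)" if "?der d" for d
      using that assms(2-) by (rule derivation_matrix_form_6_22)
    show "?der (?G d)" for d
      using assms(2-) by (simp add: defs derivation_matrix_def)
    show "agree 6 (?G (?s (u + v))) (\<lambda>j i. ?G (?s u) j i + ?G (?s v) j i)" for u v
      by (simp add: defs algebra_simps)
    show "agree 6 (?G (?s (?t r u))) (\<lambda>j i. r * ?G (?s u) j i)" for r u
      by (simp add: defs prod_scale vec_space algebra_simps)
    show "u = 0" if "agree 6 (?G (?s u)) (\<lambda>j i. 0)" for u
      using that by (simp add: defs prod_eq_iff vec_eq_iff forall_2 forall_3 forall_4)
    show "\<exists>u. agree 6 (?G (commutator 6 (?G d) (?G d'))) (?G (?s u))" for d d'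
    proof -
      define c where "c = commutator 6 (?G d) (?G d')"
      have "c 1 1 = 0" "c 2 2 = 0"
        unfolding c_def by (simp_all add: commutator_form_6_22[OF conjunct1[OF assms(2)]])
      then show ?thesis
        unfolding c_def[symmetric]
        by (intro exI[of _ "(vector [c 4 1, c 5 1, c 5 4],
            vector [c 6 1, c 6 2, c 6 4, c 6 5])"]) (simp add: defs)
    qed
    \<comment> \<open>The grading derivation reaches the entries in row 6; the three others have weight 0 and are
      obtained as brackets of one another.\<close>
    show "\<exists>L. agree 6 (?G (?s u)) (\<lambda>j i. \<Sum>(d, d')\<leftarrow>L. commutator 6 (?G d) (?G d') j i)" for u
      using two assms(2-)
      by (intro exI[of _ "[(entries [((1, 1), 1), ((2, 2), 1)],
        entries [((6, 1), snd u $ 1), ((6, 2), snd u $ 2 / 2), ((6, 4), snd u $ 3),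
            ((6, 5), snd u $ 4)]),
       (entries [((5, 1), 1)], entries [((5, 4), inverse \<beta> * \<alpha> * fst u $ 1)]),
       (entries [((5, 4), 1)], entries [((4, 1), fst u $ 2)]),
       (entries [((4, 1), inverse \<alpha>)], entries [((5, 1), fst u $ 3)])]"])
        (simp add: defs commutator_def field_simps)
  qed
qed

lemma derivation_brackets_6_22:
  fixes scale :: "'k::field \<Rightarrow> 'v::ab_group_add \<Rightarrow> 'v" and mult :: "'v \<Rightarrow> 'v \<Rightarrow> 'v"
  assumes "comm_algebra scale mult" "CHAR('k) \<noteq> 2" "N_6_22 scale mult n e \<alpha> \<beta>"
    and f: "f \<in> derivations scale mult" "matrix_entries scale n e f d"
    and g: "g \<in> derivations scale mult" "matrix_entries scale n e g d'"
    and fg: "matrix_entries scale n e (bracket f g) c"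
  shows "D_6_22 scale e \<alpha> \<beta> c (bracket f g) \<and>
    c 1 1 = 0 \<and> c 2 2 = 0 \<and>
    c 4 1 = inverse \<alpha> * \<beta> * (d 5 1 * d' 5 4 - d' 5 1 * d 5 4) \<and>
    c 5 1 = d' 4 1 * d 5 4 - d 4 1 * d' 5 4 \<and>
    c 6 1 = (d' 1 1 * d 6 1 - d 1 1 * d' 6 1) + (d' 4 1 * d 6 4 - d 4 1 * d' 6 4) +
        (d' 5 1 * d 6 5 - d 5 1 * d' 6 5) + 2 * (d' 6 1 * d 2 2 - d 6 1 * d' 2 2) \<and>
    c 6 2 = 2 * (d 1 1 * d' 6 2 - d' 1 1 * d 6 2) \<and>
    c 5 4 = \<alpha> * (d 4 1 * d' 5 1 - d' 4 1 * d 5 1) \<and>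
    c 6 4 = (d' 1 1 * d 6 4 - d 1 1 * d' 6 4) + 2 * (d' 6 4 * d 2 2 - d 6 4 * d' 2 2) +
        (d' 5 4 * d 6 5 - d 5 4 * d' 6 5) + \<alpha> * (d 4 1 * d' 6 1 - d' 4 1 * d 6 1) \<and>
    c 6 5 = - \<beta> * (d' 5 1 * d 6 1 - d 5 1 * d' 6 1) - inverse \<alpha> * \<beta> *
        (d' 5 4 * d 6 4 - d 5 4 * d' 6 4) + (d' 1 1 * d 6 5 - d 1 1 * d' 6 5) + 2 *
        (d' 6 5 * d 2 2 - d 6 5 * d' 2 2) \<and>
    derived_algebra_iso scale mult (module_prod.scale ((*s) :: 'k \<Rightarrow> 'k ^ 3 \<Rightarrow> 'k ^ 3)
        ((*s) :: 'k \<Rightarrow> 'k ^ 4 \<Rightarrow> 'k ^ 4))"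
proof -
  have n: "n = 6"
    by (rule two_square_algebra_6_22(1)[OF assms(1-3)])
  have alg: "two_square_algebra scale mult 6 e (nth1 [1, 0, 0, \<alpha>, \<beta>, 0])
      (nth1 [0, 1, - 1, 0, 0, 0])"
    by (rule two_square_algebra_6_22(2)[OF assms(1-3)])
  have nz: "\<alpha> \<noteq> 0 \<and> \<beta> \<noteq> 0"
    using assms(3) by (simp add: N_6_22_def)
  interpret two_square_algebra scale mult 6 e "nth1 [1, 0, 0, \<alpha>, \<beta>, 0]"
      "nth1 [0, 1, - 1, 0, 0, 0]" by (rule alg)
  note bracket = bracket_form[of "form_6_22 \<alpha> \<beta>",
      OF derivation_matrix_form_6_22[OF _ nz] f[unfolded n] g[unfolded n] fg[unfolded n]]
  have "c j i = commutator 6 (form_6_22 \<alpha> \<beta> d) (form_6_22 \<alpha> \<beta> d') j i" if "i \<in> {1..6}"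
      "j \<in> {1..6}" for i j
    using bracket(2) that by (simp add: agree_def)
  then show ?thesis
    using linear_map_form_6_22[OF vector_space_axioms bracket(1)] derived_algebra_6_22[OF alg nz] nz
    by (simp add: commutator_form_6_22)
qed

subsection \<open>The derivations of \<open>N_6_23\<close>\<close>

definition form_6_23 :: "(nat \<Rightarrow> nat \<Rightarrow> 'k::field) \<Rightarrow> nat \<Rightarrow> nat \<Rightarrow> 'k" where
  "form_6_23 d = column_matrix
     [[d 1 1, 0, 0, 0, 0, d 6 1],
      [0, d 1 1, d 1 1, 0, 0, d 6 2],
      [0, d 1 1, d 1 1, 0, 0, - d 6 2],
      [0, 0, 0, d 1 1, 0, d 6 4],
      [0, 0, 0, 0, d 1 1, d 6 5],
      [0, 0, 0, 0, 0, 2 * d 1 1]]"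

text \<open>
  The squares of \<open>e\<^sub>4\<close> and \<open>e\<^sub>5\<close> are independent because \<open>\<alpha> * \<delta> - \<beta> * \<gamma> \<noteq> 0\<close>, so a derivation
  cannot mix the two.
\<close>

lemma derivation_matrix_form_6_23:
  assumes "derivation_matrix 6 (nth1 [1, 0, 0, \<alpha>, \<gamma>, 0]) (nth1 [0, 1, - 1, \<beta>, \<delta>, 0]) d"
    and "\<alpha> * \<delta> - \<beta> * \<gamma> \<noteq> 0 \<and> \<alpha> * \<gamma> \<noteq> 0 \<and> \<beta> * \<delta> \<noteq> 0"
  shows "agree 6 d (form_6_23 d)"
proof -
  have "\<alpha> * d 4 5 + \<gamma> * d 5 4 = 0" "\<beta> * d 4 5 + \<delta> * d 5 4 = 0"
    using assms(1) by (simp_all add: matrix_simps derivation_matrix_def add.commute)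
  then have "(\<alpha> * \<delta> - \<beta> * \<gamma>) * d 4 5 = 0" "(\<alpha> * \<delta> - \<beta> * \<gamma>) * d 5 4 = 0"
    by algebra+
  then have "d 4 5 = 0" "d 5 4 = 0"
    using assms(2) by auto
  then show ?thesis
    using assms middle_entries[OF assms(1)] scalar_entries_eq[OF assms(1), of 4]
    by (auto simp: matrix_simps form_6_23_def agree_def derivation_matrix_def add_eq_0_iff)
qed

lemma commutator_form_6_23:
  fixes d d' :: "nat \<Rightarrow> nat \<Rightarrow> 'k::field"
  defines "c \<equiv> commutator 6 (form_6_23 d) (form_6_23 d')"
  shows "c 1 1 = 0"
    "c 6 1 = d' 6 1 * d 1 1 - d' 1 1 * d 6 1"
    "c 6 2 = 2 * (d' 6 2 * d 1 1 - d 6 2 * d' 1 1)"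
    "c 6 4 = d' 6 4 * d 1 1 - d 6 4 * d' 1 1"
    "c 6 5 = d' 6 5 * d 1 1 - d 6 5 * d' 1 1"
  by (simp_all add: matrix_simps form_6_23_def commutator_def c_def field_simps)

lemma linear_map_form_6_23:
  fixes scale :: "'k::field \<Rightarrow> 'v::ab_group_add \<Rightarrow> 'v"
  assumes "vector_space scale" "matrix_entries scale 6 e f (form_6_23 c)"
  shows "D_6_23 scale e c f"
proof -
  interpret vector_space scale by fact
  show ?thesis
    using assms(2)
    by (simp add: matrix_entries_def matrix_simps form_6_23_def D_6_23_def
        scale_right_distrib add.assoc)
qed

lemma two_square_algebra_6_23:
  fixes scale :: "'k::field \<Rightarrow> 'v::ab_group_add \<Rightarrow> 'v" and mult :: "'v \<Rightarrow> 'v \<Rightarrow> 'v"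
  assumes "comm_algebra scale mult" "CHAR('k) \<noteq> 2" "N_6_23 scale mult n e \<alpha> \<beta> \<gamma> \<delta>"
  shows "n = 6" "two_square_algebra scale mult 6 e (nth1 [1, 0, 0, \<alpha>, \<gamma>, 0])
      (nth1 [0, 1, - 1, \<beta>, \<delta>, 0])"
proof -
  interpret comm_algebra scale mult by fact
  show "n = 6" using assms(3) by (simp add: N_6_23_def)
  show "two_square_algebra scale mult 6 e (nth1 [1, 0, 0, \<alpha>, \<gamma>, 0]) (nth1 [0, 1, - 1, \<beta>, \<delta>, 0])"
    using assms(2,3) by unfold_locales (auto simp: N_6_23_def normal_base_def matrix_simps)
qed

lemma derived_algebra_6_23:
  fixes scale :: "'k::field \<Rightarrow> 'v::ab_group_add \<Rightarrow> 'v" and mult :: "'v \<Rightarrow> 'v \<Rightarrow> 'v"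
  assumes "two_square_algebra scale mult 6 e (nth1 [1, 0, 0, \<alpha>, \<gamma>, 0])
      (nth1 [0, 1, - 1, \<beta>, \<delta>, 0])"
    and "\<alpha> * \<delta> - \<beta> * \<gamma> \<noteq> 0 \<and> \<alpha> * \<gamma> \<noteq> 0 \<and> \<beta> * \<delta> \<noteq> 0"
  shows "derived_algebra_iso scale mult ((*s) :: 'k \<Rightarrow> 'k ^ 4 \<Rightarrow> 'k ^ 4)"
proof -
  interpret two_square_algebra scale mult 6 e "nth1 [1, 0, 0, \<alpha>, \<gamma>, 0]"
      "nth1 [0, 1, - 1, \<beta>, \<delta>, 0]" by fact
  let ?G = "form_6_23"
  let ?s = "\<lambda>u :: 'k ^ 4. entries [((6, 1), u $ 1), ((6, 2), u $ 2), ((6, 4), u $ 3),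
      ((6, 5), u $ 4)]"
  let ?der = "derivation_matrix 6 (nth1 [1, 0, 0, \<alpha>, \<gamma>, 0]) (nth1 [0, 1, - 1, \<beta>, \<delta>, 0])"
  let ?t = "((*s) :: 'k \<Rightarrow> 'k ^ 4 \<Rightarrow> 'k ^ 4)"
  note defs = matrix_simps form_6_23_def agree_def entries_def
  show ?thesis
  proof (rule derived_algebra_iso_formI[where G = ?G and s = ?s])
    show "vector_space ?t"
      by (intro prod_scale vec_space)
    show "agree 6 d (?G d)" if "?der d" for d
      using that assms(2-) by (rule derivation_matrix_form_6_23)
    show "?der (?G d)" for d
      using assms(2-) by (simp add: defs derivation_matrix_def)
    show "agree 6 (?G (?s (u + v))) (\<lambda>j i. ?G (?s u) j i + ?G (?s v) j i)" for u v
      by (simp add: defs algebra_simps)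
    show "agree 6 (?G (?s (?t r u))) (\<lambda>j i. r * ?G (?s u) j i)" for r u
      by (simp add: defs algebra_simps)
    show "u = 0" if "agree 6 (?G (?s u)) (\<lambda>j i. 0)" for u
      using that by (simp add: defs prod_eq_iff vec_eq_iff forall_2 forall_3 forall_4)
    show "\<exists>u. agree 6 (?G (commutator 6 (?G d) (?G d'))) (?G (?s u))" for d d'
    proof -
      define c where "c = commutator 6 (?G d) (?G d')"
      have "c 1 1 = 0"
        unfolding c_def by (simp_all add: commutator_form_6_23)
      then show ?thesis
        unfolding c_def[symmetric]
        by (intro exI[of _ "vector [c 6 1, c 6 2, c 6 4, c 6 5]"]) (simp add: defs)
    qed
    show "\<exists>L. agree 6 (?G (?s u)) (\<lambda>j i. \<Sum>(d, d')\<leftarrow>L. commutator 6 (?G d) (?G d') j i)" for u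
      using two assms(2-)
      by (intro exI[of _ "[(entries [((1, 1), 1), ((2, 2), 1)],
        entries [((6, 1), u $ 1), ((6, 2), u $ 2 / 2), ((6, 4), u $ 3), ((6, 5), u $ 4)])]"])
        (simp add: defs commutator_def)
  qed
qed

lemma derivation_brackets_6_23:
  fixes scale :: "'k::field \<Rightarrow> 'v::ab_group_add \<Rightarrow> 'v" and mult :: "'v \<Rightarrow> 'v \<Rightarrow> 'v"
  assumes "comm_algebra scale mult" "CHAR('k) \<noteq> 2" "N_6_23 scale mult n e \<alpha> \<beta> \<gamma> \<delta>"
    and f: "f \<in> derivations scale mult" "matrix_entries scale n e f d"
    and g: "g \<in> derivations scale mult" "matrix_entries scale n e g d'"
    and fg: "matrix_entries scale n e (bracket f g) c"
  shows "D_6_23 scale e c (bracket f g) \<and>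
    c 1 1 = 0 \<and>
    c 6 1 = d' 6 1 * d 1 1 - d' 1 1 * d 6 1 \<and>
    c 6 2 = 2 * (d' 6 2 * d 1 1 - d 6 2 * d' 1 1) \<and>
    c 6 4 = d' 6 4 * d 1 1 - d 6 4 * d' 1 1 \<and>
    c 6 5 = d' 6 5 * d 1 1 - d 6 5 * d' 1 1 \<and>
    derived_algebra_iso scale mult ((*s) :: 'k \<Rightarrow> 'k ^ 4 \<Rightarrow> 'k ^ 4)"
proof -
  have n: "n = 6"
    by (rule two_square_algebra_6_23(1)[OF assms(1-3)])
  have alg: "two_square_algebra scale mult 6 e (nth1 [1, 0, 0, \<alpha>, \<gamma>, 0])
      (nth1 [0, 1, - 1, \<beta>, \<delta>, 0])"
    by (rule two_square_algebra_6_23(2)[OF assms(1-3)])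
  have nz: "\<alpha> * \<delta> - \<beta> * \<gamma> \<noteq> 0 \<and> \<alpha> * \<gamma> \<noteq> 0 \<and> \<beta> * \<delta> \<noteq> 0"
    using assms(3) by (simp add: N_6_23_def)
  interpret two_square_algebra scale mult 6 e "nth1 [1, 0, 0, \<alpha>, \<gamma>, 0]"
      "nth1 [0, 1, - 1, \<beta>, \<delta>, 0]" by (rule alg)
  note bracket = bracket_form[of "form_6_23",
      OF derivation_matrix_form_6_23[OF _ nz] f[unfolded n] g[unfolded n] fg[unfolded n]]
  have "c j i = commutator 6 (form_6_23 d) (form_6_23 d') j i" if "i \<in> {1..6}" "j \<in> {1..6}"
      for i j
    using bracket(2) that by (simp add: agree_def)
  then show ?thesis
    using linear_map_form_6_23[OF vector_space_axioms bracket(1)] derived_algebra_6_23[OF alg nz] nz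
    by (simp add: commutator_form_6_23)
qed

subsection \<open>The derivations of \<open>N_6_24\<close>\<close>

definition form_6_24 :: "'k::field \<Rightarrow> (nat \<Rightarrow> nat \<Rightarrow> 'k) \<Rightarrow> nat \<Rightarrow> nat \<Rightarrow> 'k" where
  "form_6_24 \<gamma> d = column_matrix
     [[d 1 1, 0, 0, 0, d 5 1, d 6 1],
      [0, d 1 1, d 1 1, 0, 0, d 6 2],
      [0, d 1 1, d 1 1, 0, 0, - d 6 2],
      [0, 0, 0, d 1 1, 0, d 6 4],
      [- (\<gamma> * d 5 1), 0, 0, 0, d 1 1, d 6 5],
      [0, 0, 0, 0, 0, 2 * d 1 1]]"

lemma derivation_matrix_form_6_24:
  assumes "derivation_matrix 6 (nth1 [1, 0, 0, \<alpha>, \<gamma>, 0]) (nth1 [0, 1, - 1, \<beta>, 0, 0]) d"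
    and "\<alpha> * \<beta> * \<gamma> \<noteq> 0"
  shows "agree 6 d (form_6_24 \<gamma> d)"
  using assms middle_entries[OF assms(1)] scalar_entries_eq[OF assms(1), of 4]
  by (auto simp: matrix_simps form_6_24_def agree_def derivation_matrix_def add_eq_0_iff)

lemma commutator_form_6_24:
  fixes d d' :: "nat \<Rightarrow> nat \<Rightarrow> 'k::field" and \<gamma> :: 'k
  defines "c \<equiv> commutator 6 (form_6_24 \<gamma> d) (form_6_24 \<gamma> d')"
  shows "c 1 1 = 0"
    "c 5 1 = 0"
    "c 6 1 = (d' 6 1 * d 1 1 - d 6 1 * d' 1 1) + (d' 5 1 * d 6 5 - d 5 1 * d' 6 5)"
    "c 6 2 = 2 * (d' 6 2 * d 1 1 - d 6 2 * d' 1 1)"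
    "c 6 4 = d' 6 4 * d 1 1 - d 6 4 * d' 1 1"
    "c 6 5 = \<gamma> * (d 5 1 * d' 6 1 - d' 5 1 * d 6 1) + (d' 6 5 * d 1 1 - d 6 5 * d' 1 1)"
  by (simp_all add: matrix_simps form_6_24_def commutator_def c_def field_simps)

lemma linear_map_form_6_24:
  fixes scale :: "'k::field \<Rightarrow> 'v::ab_group_add \<Rightarrow> 'v"
  assumes "vector_space scale" "matrix_entries scale 6 e f (form_6_24 \<gamma> c)"
  shows "D_6_24 scale e \<gamma> c f"
proof -
  interpret vector_space scale by fact
  show ?thesis
    using assms(2)
    by (simp add: matrix_entries_def matrix_simps form_6_24_def D_6_24_def
        scale_right_distrib add.assoc)
qed

lemma two_square_algebra_6_24:
  fixes scale :: "'k::field \<Rightarrow> 'v::ab_group_add \<Rightarrow> 'v" and mult :: "'v \<Rightarrow> 'v \<Rightarrow> 'v"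
  assumes "comm_algebra scale mult" "CHAR('k) \<noteq> 2" "N_6_24 scale mult n e \<alpha> \<beta> \<gamma>"
  shows "n = 6" "two_square_algebra scale mult 6 e (nth1 [1, 0, 0, \<alpha>, \<gamma>, 0])
      (nth1 [0, 1, - 1, \<beta>, 0, 0])"
proof -
  interpret comm_algebra scale mult by fact
  show "n = 6" using assms(3) by (simp add: N_6_24_def)
  show "two_square_algebra scale mult 6 e (nth1 [1, 0, 0, \<alpha>, \<gamma>, 0]) (nth1 [0, 1, - 1, \<beta>, 0, 0])"
    using assms(2,3) by unfold_locales (auto simp: N_6_24_def normal_base_def matrix_simps)
qed

lemma derived_algebra_6_24:
  fixes scale :: "'k::field \<Rightarrow> 'v::ab_group_add \<Rightarrow> 'v" and mult :: "'v \<Rightarrow> 'v \<Rightarrow> 'v"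
  assumes "two_square_algebra scale mult 6 e (nth1 [1, 0, 0, \<alpha>, \<gamma>, 0])
      (nth1 [0, 1, - 1, \<beta>, 0, 0])"
    and "\<alpha> * \<beta> * \<gamma> \<noteq> 0"
  shows "derived_algebra_iso scale mult ((*s) :: 'k \<Rightarrow> 'k ^ 4 \<Rightarrow> 'k ^ 4)"
proof -
  interpret two_square_algebra scale mult 6 e "nth1 [1, 0, 0, \<alpha>, \<gamma>, 0]"
      "nth1 [0, 1, - 1, \<beta>, 0, 0]" by fact
  let ?G = "form_6_24 \<gamma>"
  let ?s = "\<lambda>u :: 'k ^ 4. entries [((6, 1), u $ 1), ((6, 2), u $ 2), ((6, 4), u $ 3),
      ((6, 5), u $ 4)]"
  let ?der = "derivation_matrix 6 (nth1 [1, 0, 0, \<alpha>, \<gamma>, 0]) (nth1 [0, 1, - 1, \<beta>, 0, 0])"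
  let ?t = "((*s) :: 'k \<Rightarrow> 'k ^ 4 \<Rightarrow> 'k ^ 4)"
  note defs = matrix_simps form_6_24_def agree_def entries_def
  show ?thesis
  proof (rule derived_algebra_iso_formI[where G = ?G and s = ?s])
    show "vector_space ?t"
      by (intro prod_scale vec_space)
    show "agree 6 d (?G d)" if "?der d" for d
      using that assms(2-) by (rule derivation_matrix_form_6_24)
    show "?der (?G d)" for d
      using assms(2-) by (simp add: defs derivation_matrix_def)
    show "agree 6 (?G (?s (u + v))) (\<lambda>j i. ?G (?s u) j i + ?G (?s v) j i)" for u v
      by (simp add: defs algebra_simps)
    show "agree 6 (?G (?s (?t r u))) (\<lambda>j i. r * ?G (?s u) j i)" for r u
      by (simp add: defs algebra_simps)
    show "u = 0" if "agree 6 (?G (?s u)) (\<lambda>j i. 0)" for u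
      using that by (simp add: defs prod_eq_iff vec_eq_iff forall_2 forall_3 forall_4)
    show "\<exists>u. agree 6 (?G (commutator 6 (?G d) (?G d'))) (?G (?s u))" for d d'
    proof -
      define c where "c = commutator 6 (?G d) (?G d')"
      have "c 1 1 = 0" "c 5 1 = 0"
        unfolding c_def by (simp_all add: commutator_form_6_24)
      then show ?thesis
        unfolding c_def[symmetric]
        by (intro exI[of _ "vector [c 6 1, c 6 2, c 6 4, c 6 5]"]) (simp add: defs)
    qed
    show "\<exists>L. agree 6 (?G (?s u)) (\<lambda>j i. \<Sum>(d, d')\<leftarrow>L. commutator 6 (?G d) (?G d') j i)" for u
      using two assms(2-)
      by (intro exI[of _ "[(entries [((1, 1), 1), ((2, 2), 1)],
        entries [((6, 1), u $ 1), ((6, 2), u $ 2 / 2), ((6, 4), u $ 3), ((6, 5), u $ 4)])]"])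
        (simp add: defs commutator_def)
  qed
qed

lemma derivation_brackets_6_24:
  fixes scale :: "'k::field \<Rightarrow> 'v::ab_group_add \<Rightarrow> 'v" and mult :: "'v \<Rightarrow> 'v \<Rightarrow> 'v"
  assumes "comm_algebra scale mult" "CHAR('k) \<noteq> 2" "N_6_24 scale mult n e \<alpha> \<beta> \<gamma>"
    and f: "f \<in> derivations scale mult" "matrix_entries scale n e f d"
    and g: "g \<in> derivations scale mult" "matrix_entries scale n e g d'"
    and fg: "matrix_entries scale n e (bracket f g) c"
  shows "D_6_24 scale e \<gamma> c (bracket f g) \<and>
    c 1 1 = 0 \<and> c 5 1 = 0 \<and>
    c 6 1 = (d' 6 1 * d 1 1 - d 6 1 * d' 1 1) + (d' 5 1 * d 6 5 - d 5 1 * d' 6 5) \<and>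
    c 6 2 = 2 * (d' 6 2 * d 1 1 - d 6 2 * d' 1 1) \<and>
    c 6 4 = d' 6 4 * d 1 1 - d 6 4 * d' 1 1 \<and>
    c 6 5 = \<gamma> * (d 5 1 * d' 6 1 - d' 5 1 * d 6 1) + (d' 6 5 * d 1 1 - d 6 5 * d' 1 1) \<and>
    derived_algebra_iso scale mult ((*s) :: 'k \<Rightarrow> 'k ^ 4 \<Rightarrow> 'k ^ 4)"
proof -
  have n: "n = 6"
    by (rule two_square_algebra_6_24(1)[OF assms(1-3)])
  have alg: "two_square_algebra scale mult 6 e (nth1 [1, 0, 0, \<alpha>, \<gamma>, 0])
      (nth1 [0, 1, - 1, \<beta>, 0, 0])"
    by (rule two_square_algebra_6_24(2)[OF assms(1-3)])
  have nz: "\<alpha> * \<beta> * \<gamma> \<noteq> 0"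
    using assms(3) by (simp add: N_6_24_def)
  interpret two_square_algebra scale mult 6 e "nth1 [1, 0, 0, \<alpha>, \<gamma>, 0]"
      "nth1 [0, 1, - 1, \<beta>, 0, 0]" by (rule alg)
  note bracket = bracket_form[of "form_6_24 \<gamma>",
      OF derivation_matrix_form_6_24[OF _ nz] f[unfolded n] g[unfolded n] fg[unfolded n]]
  have "c j i = commutator 6 (form_6_24 \<gamma> d) (form_6_24 \<gamma> d') j i" if "i \<in> {1..6}" "j \<in> {1..6}"
      for i j
    using bracket(2) that by (simp add: agree_def)
  then show ?thesis
    using linear_map_form_6_24[OF vector_space_axioms bracket(1)] derived_algebra_6_24[OF alg nz] nz
    by (simp add: commutator_form_6_24)
qed

section \<open>Brackets of derivations in all normal forms\<close>


theorem proposition5p1p2: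
  fixes scale :: "'k::field \<Rightarrow> 'v::ab_group_add \<Rightarrow> 'v"
    and mult :: "'v \<Rightarrow> 'v \<Rightarrow> 'v"
    and n :: nat and e :: "nat \<Rightarrow> 'v"
    and f g :: "'v \<Rightarrow> 'v"
    and d d' c :: "nat \<Rightarrow> nat \<Rightarrow> 'k"
    and \<alpha> \<beta> \<gamma> \<delta> :: 'k
  assumes char: "CHAR('k) \<noteq> 2"
    and evolution: "evolution_algebra scale mult"
    and indecomposable: "indecomposable scale mult"
    and power_associative: "power_associative scale mult"
    and nil: "nil_algebra mult"
    and dim: "vector_space.dim scale (UNIV :: 'v set) \<le> 6"
    and not_associative: "\<not> associative_on mult UNIV"
    and dim_ann: "vector_space.dim scale (annihilator mult) = 1"
    and basis: "natural_basis scale mult n e"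
    and f: "f \<in> derivations scale mult" "matrix_entries scale n e f d"
    and g: "g \<in> derivations scale mult" "matrix_entries scale n e g d'"
    and fg: "matrix_entries scale n e (bracket f g) c"
  shows
    "bracket f g \<in> derivations scale mult \<and>
     (N_4_6 scale mult n e \<longrightarrow>
       D_4_6 scale e c (bracket f g) \<and>
       c 1 1 = 0 \<and> c 2 2 = 0 \<and>
       c 4 1 = (d' 1 1 * d 4 1 - d 1 1 * d' 4 1) + 2 * (d' 4 1 * d 2 2 - d 4 1 * d' 2 2) \<and>
       c 4 2 = 2 * (d' 4 2 * d 1 1 - d 4 2 * d' 1 1) \<and>
       derived_algebra_iso scale mult ((*s) :: 'k \<Rightarrow> 'k ^ 2 \<Rightarrow> 'k ^ 2)) \<and>
     (N_5_10 scale mult n e \<alpha> \<longrightarrow>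
       D_5_10 scale e \<alpha> c (bracket f g) \<and>
       c 1 1 = 0 \<and> c 2 2 = 0 \<and>
       c 5 1 = (d' 1 1 * d 5 1 - d 1 1 * d' 5 1) + 2 * (d' 5 1 * d 2 2 - d 5 1 * d' 2 2) \<and>
       c 4 2 = (d' 2 2 * d 4 2 - d 2 2 * d' 4 2) + 2 * (d' 4 2 * d 1 1 - d 4 2 * d' 1 1) \<and>
       c 5 2 = (d' 4 2 * d 5 4 - d 4 2 * d' 5 4) + 2 * (d' 5 2 * d 1 1 - d 5 2 * d' 1 1) \<and>
       c 5 4 = d' 5 4 * d 2 2 - d 5 4 * d' 2 2 \<and>
       derived_algebra_iso scale mult (module_prod.scale ((*) :: 'k \<Rightarrow> 'k \<Rightarrow> 'k) ((*s) :: 'k \<Rightarrow> 'k ^ 3 \<Rightarrow> 'k ^ 3))) \<and>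
     (N_5_11 scale mult n e \<alpha> \<longrightarrow>
       D_5_11 scale e \<alpha> c (bracket f g) \<and>
       c 1 1 = 0 \<and> c 4 1 = 0 \<and> c 2 2 = 0 \<and>
       c 5 1 = (d' 1 1 * d 5 1 - d 1 1 * d' 5 1) + (d' 4 1 * d 5 4 - d 4 1 * d' 5 4) + 2 * (d' 5 1 * d 2 2 - d 5 1 * d' 2 2) \<and>
       c 5 2 = 2 * (d' 5 2 * d 1 1 - d 5 2 * d' 1 1) \<and>
       c 5 4 = - \<alpha> * (d' 4 1 * d 5 1 - d 4 1 * d' 5 1) + (d' 1 1 * d 5 4 - d 1 1 * d' 5 4) + 2 * (d' 5 4 * d 2 2 - d 5 4 * d' 2 2) \<and>
       derived_algebra_iso scale mult ((*s) :: 'k \<Rightarrow> 'k ^ 3 \<Rightarrow> 'k ^ 3)) \<and>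
     (N_5_12 scale mult n e \<alpha> \<beta> \<longrightarrow>
       D_5_12 scale e c (bracket f g) \<and>
       c 1 1 = 0 \<and>
       c 5 1 = d' 5 1 * d 1 1 - d 5 1 * d' 1 1 \<and>
       c 5 2 = 2 * (d' 5 2 * d 1 1 - d 5 2 * d' 1 1) \<and>
       c 5 4 = d' 5 4 * d 1 1 - d 5 4 * d' 1 1 \<and>
       derived_algebra_iso scale mult ((*s) :: 'k \<Rightarrow> 'k ^ 3 \<Rightarrow> 'k ^ 3)) \<and>
     (N_6_19 scale mult n e \<alpha> \<beta> \<longrightarrow>
       D_6_19 scale e \<alpha> \<beta> c (bracket f g) \<and>
       c 1 1 = 0 \<and> c 2 2 = 0 \<and> c 5 4 = 0 \<and>
       c 6 1 = (d' 1 1 * d 6 1 - d 1 1 * d' 6 1) + 2 * (d' 6 1 * d 2 2 - d 6 1 * d' 2 2) \<and>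
       c 4 2 = (d' 2 2 * d 4 2 - d 2 2 * d' 4 2) + 2 * (d 1 1 * d' 4 2 - d' 1 1 * d 4 2) - inverse \<alpha> * \<beta> * (d' 5 2 * d 5 4 - d 5 2 * d' 5 4) \<and>
       c 5 2 = (d' 4 2 * d 5 4 - d 4 2 * d' 5 4) + (d' 2 2 * d 5 2 - d 2 2 * d' 5 2) + 2 * (d 1 1 * d' 5 2 - d' 1 1 * d 5 2) \<and>
       c 6 2 = (d' 4 2 * d 6 4 - d 4 2 * d' 6 4) + (d' 5 2 * d 6 5 - d 5 2 * d' 6 5) + 2 * (d' 6 2 * d 1 1 - d 6 2 * d' 1 1) \<and>
       c 6 4 = (d' 6 4 * d 2 2 - d 6 4 * d' 2 2) + (d' 5 4 * d 6 5 - d 5 4 * d' 6 5) \<and>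
       c 6 5 = - inverse \<alpha> * \<beta> * (d' 5 4 * d 6 4 - d 5 4 * d' 6 4) + (d' 6 5 * d 2 2 - d 6 5 * d' 2 2) \<and>
       derived_algebra_iso scale mult (module_prod.scale ((*s) :: 'k \<Rightarrow> 'k ^ 2 \<Rightarrow> 'k ^ 2) ((*s) :: 'k \<Rightarrow> 'k ^ 4 \<Rightarrow> 'k ^ 4))) \<and>
     (N_6_20 scale mult n e \<alpha> \<beta> \<longrightarrow>
       D_6_20 scale e \<alpha> \<beta> c (bracket f g) \<and>
       c 1 1 = 0 \<and> c 4 1 = 0 \<and> c 2 2 = 0 \<and>
       c 6 1 = (d' 1 1 * d 6 1 - d 1 1 * d' 6 1) + (d' 4 1 * d 6 4 - d 4 1 * d' 6 4) + 2 * (d' 6 1 * d 2 2 - d 6 1 * d' 2 2) \<and>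
       c 5 2 = (d' 2 2 * d 5 2 - d 2 2 * d' 5 2) + 2 * (d 1 1 * d' 5 2 - d' 1 1 * d 5 2) \<and>
       c 6 2 = (d' 5 2 * d 6 5 - d 5 2 * d' 6 5) + 2 * (d 1 1 * d' 6 2 - d' 1 1 * d 6 2) \<and>
       c 6 4 = - \<alpha> * (d' 4 1 * d 6 1 - d 4 1 * d' 6 1) + (d' 1 1 * d 6 4 - d 1 1 * d' 6 4) + 2 * (d' 6 4 * d 2 2 - d 6 4 * d' 2 2) \<and>
       c 6 5 = d' 6 5 * d 2 2 - d 6 5 * d' 2 2 \<and>
       derived_algebra_iso scale mult (module_prod.scale ((*) :: 'k \<Rightarrow> 'k \<Rightarrow> 'k) ((*s) :: 'k \<Rightarrow> 'k ^ 4 \<Rightarrow> 'k ^ 4))) \<and>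
     (N_6_21 scale mult n e \<alpha> \<beta> \<gamma> \<longrightarrow>
       D_6_21 scale e \<gamma> c (bracket f g) \<and>
       c 1 1 = 0 \<and>
       c 6 1 = d' 6 1 * d 1 1 - d 6 1 * d' 1 1 \<and>
       c 5 2 = d' 5 2 * d 1 1 - d 5 2 * d' 1 1 \<and>
       c 6 2 = (d' 5 2 * d 6 5 - d 5 2 * d' 6 5) + 2 * (d' 6 2 * d 1 1 - d 6 2 * d' 1 1) \<and>
       c 6 4 = d' 6 4 * d 1 1 - d 6 4 * d' 1 1 \<and>
       c 6 5 = d' 6 5 * d 1 1 - d 6 5 * d' 1 1 \<and>
       derived_algebra_iso scale mult (module_prod.scale ((*) :: 'k \<Rightarrow> 'k \<Rightarrow> 'k) ((*s) :: 'k \<Rightarrow> 'k ^ 4 \<Rightarrow> 'k ^ 4))) \<and>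
     (N_6_22 scale mult n e \<alpha> \<beta> \<longrightarrow>
       D_6_22 scale e \<alpha> \<beta> c (bracket f g) \<and>
       c 1 1 = 0 \<and> c 2 2 = 0 \<and>
       c 4 1 = inverse \<alpha> * \<beta> * (d 5 1 * d' 5 4 - d' 5 1 * d 5 4) \<and>
       c 5 1 = d' 4 1 * d 5 4 - d 4 1 * d' 5 4 \<and>
       c 6 1 = (d' 1 1 * d 6 1 - d 1 1 * d' 6 1) + (d' 4 1 * d 6 4 - d 4 1 * d' 6 4) + (d' 5 1 * d 6 5 - d 5 1 * d' 6 5) + 2 * (d' 6 1 * d 2 2 - d 6 1 * d' 2 2) \<and>
       c 6 2 = 2 * (d 1 1 * d' 6 2 - d' 1 1 * d 6 2) \<and>
       c 5 4 = \<alpha> * (d 4 1 * d' 5 1 - d' 4 1 * d 5 1) \<and>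
       c 6 4 = (d' 1 1 * d 6 4 - d 1 1 * d' 6 4) + 2 * (d' 6 4 * d 2 2 - d 6 4 * d' 2 2) + (d' 5 4 * d 6 5 - d 5 4 * d' 6 5) + \<alpha> * (d 4 1 * d' 6 1 - d' 4 1 * d 6 1) \<and>
       c 6 5 = - \<beta> * (d' 5 1 * d 6 1 - d 5 1 * d' 6 1) - inverse \<alpha> * \<beta> * (d' 5 4 * d 6 4 - d 5 4 * d' 6 4) + (d' 1 1 * d 6 5 - d 1 1 * d' 6 5) + 2 * (d' 6 5 * d 2 2 - d 6 5 * d' 2 2) \<and>
       derived_algebra_iso scale mult (module_prod.scale ((*s) :: 'k \<Rightarrow> 'k ^ 3 \<Rightarrow> 'k ^ 3) ((*s) :: 'k \<Rightarrow> 'k ^ 4 \<Rightarrow> 'k ^ 4))) \<and>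
     (N_6_23 scale mult n e \<alpha> \<beta> \<gamma> \<delta> \<longrightarrow>
       D_6_23 scale e c (bracket f g) \<and>
       c 1 1 = 0 \<and>
       c 6 1 = d' 6 1 * d 1 1 - d' 1 1 * d 6 1 \<and>
       c 6 2 = 2 * (d' 6 2 * d 1 1 - d 6 2 * d' 1 1) \<and>
       c 6 4 = d' 6 4 * d 1 1 - d 6 4 * d' 1 1 \<and>
       c 6 5 = d' 6 5 * d 1 1 - d 6 5 * d' 1 1 \<and>
       derived_algebra_iso scale mult ((*s) :: 'k \<Rightarrow> 'k ^ 4 \<Rightarrow> 'k ^ 4)) \<and>
     (N_6_24 scale mult n e \<alpha> \<beta> \<gamma> \<longrightarrow>
       D_6_24 scale e \<gamma> c (bracket f g) \<and>
       c 1 1 = 0 \<and> c 5 1 = 0 \<and>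
       c 6 1 = (d' 6 1 * d 1 1 - d 6 1 * d' 1 1) + (d' 5 1 * d 6 5 - d 5 1 * d' 6 5) \<and>
       c 6 2 = 2 * (d' 6 2 * d 1 1 - d 6 2 * d' 1 1) \<and>
       c 6 4 = d' 6 4 * d 1 1 - d 6 4 * d' 1 1 \<and>
       c 6 5 = \<gamma> * (d 5 1 * d' 6 1 - d' 5 1 * d 6 1) + (d' 6 5 * d 1 1 - d 6 5 * d' 1 1) \<and>
       derived_algebra_iso scale mult ((*s) :: 'k \<Rightarrow> 'k ^ 4 \<Rightarrow> 'k ^ 4))"
proof -
  have algebra: "comm_algebra scale mult"
    using evolution by (simp add: evolution_algebra_def)
  interpret comm_algebra scale mult by (rule algebra)
  show ?thesis
    by ((rule bracket_derivation[OF f(1) g(1)]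
      | rule derivation_brackets_4_6[OF algebra char _ f g fg], assumption
      | rule derivation_brackets_5_10[OF algebra char _ f g fg], assumption
      | rule derivation_brackets_5_11[OF algebra char _ f g fg], assumption
      | rule derivation_brackets_5_12[OF algebra char _ f g fg], assumption
      | rule derivation_brackets_6_19[OF algebra char _ f g fg], assumption
      | rule derivation_brackets_6_20[OF algebra char _ f g fg], assumption
      | rule derivation_brackets_6_21[OF algebra char _ f g fg], assumption
      | rule derivation_brackets_6_22[OF algebra char _ f g fg], assumption
      | rule derivation_brackets_6_23[OF algebra char _ f g fg], assumption
      | rule derivation_brackets_6_24[OF algebra char _ f g fg], assumption
      | rule conjI | rule impI)+)
qed

end
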